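(* Let $(X_t,\Lambda_t)_{t\ge0}$ be a two-state regime-switching geometric Brownian motion, driven by the Brownian motion $(B_t)$, with coefficients $\mu_0,\mu_1\in\mathbb R$, $\sigma_0>\sigma_1>0$ and switching rates $\lambda_0,\lambda_1>0$, with $\Lambda_0=0$, and let $\Delta_i=\mu_i-\frac12\sigma_i^2$ for $i=0,1$. Let $0<a<x=X_0$, $\tau_a^{(x)}=\inf\{t>0:\ X_t=a\}$, $T>0$, and $\mathscr F_\Lambda=\sigma(\Lambda_t;\ t\le T)$. Let $\alpha(t)$ and $\beta(t)=t-\alpha(t)$ be the times spent by $(\Lambda_s)$ up to time $t$ in the states $0$ and $1$, respectively, and let $\eta_0$ be a standard normal random variable independent of $(B_t,\Lambda_t)_{t\ge0}$. Then, almost surely, $$\begin{aligned}\mathbb P\big(\tau_a^{(x)}>T\,\big|\,\mathscr F_\Lambda\big)&=\mathbb P\Big(\min_{0\le t\le T}\Big\{\int_0^t\sigma_{\Lambda_s}\,dB_s+\int_0^t\Delta_{\Lambda_s}\,ds-\ln(a/x)\Big\}>0\,\Big|\,\mathscr F_\Lambda\Big)\\ &\le\mathbb P\Big(\min_{0\le t\le T}\Big\{\sqrt{\sigma_0^2-\sigma_1^2}\,B_{\alpha(t)}+\sqrt t\,\sigma_1\eta_0+\Delta_0\alpha(t)+\Delta_1\beta(t)-\ln(a/x)\Big\}>0\,\Big|\,\mathscr F_\Lambda\Big).\end{aligned}$$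
   Context: Two-state regime-switching geometric Brownian motion: $(\Lambda_t)_{t\ge0}$ is a continuous-time Markov chain on $\{0,1\}$ with $Q$-matrix $\begin{pmatrix}-\lambda_0&\lambda_0\\ \lambda_1&-\lambda_1\end{pmatrix}$, $\lambda_0,\lambda_1>0$; $(B_t)_{t\ge0}$ is a one-dimensional standard Brownian motion independent of $(\Lambda_t)$; $\mu_0,\mu_1\in\mathbb R$, $\sigma_0,\sigma_1>0$; and $(X_t)$ solves $$dX_t=\mu_{\Lambda_t}X_t\,dt+\sigma_{\Lambda_t}X_t\,dB_t,\qquad X_0=x>0,$$ equivalently $X_t=x\exp\big[\int_0^t(\mu_{\Lambda_s}-\frac12\sigma_{\Lambda_s}^2)\,ds+\int_0^t\sigma_{\Lambda_s}\,dB_s\big]$. Convention: $\inf\emptyset=\infty$. *)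

theory Defs
  imports "HOL-Probability.Probability"
begin

text \<open>
  Processes are functions \<open>real \<Rightarrow> 'a \<Rightarrow> 'b\<close>; only their values at times \<open>t \<ge> 0\<close> matter.
\<close>

definition process_sigma :: "'a measure \<Rightarrow> 'b measure \<Rightarrow> real set \<Rightarrow> (real \<Rightarrow> 'a \<Rightarrow> 'b) \<Rightarrow> 'a measure" where
  "process_sigma M N I X = sigma (space M) (\<Union>t\<in>I. {X t -` A \<inter> space M | A. A \<in> sets N})"

definition cond_probability :: "'a measure \<Rightarrow> 'a measure \<Rightarrow> 'a set \<Rightarrow> 'a \<Rightarrow> real" where
  "cond_probability M F A = real_cond_exp M F (indicator A)"

definition standard_brownian_motion :: "'a measure \<Rightarrow> (real \<Rightarrow> 'a \<Rightarrow> real) \<Rightarrow> bool" where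
  "standard_brownian_motion M B \<longleftrightarrow>
     (\<forall>t\<ge>0. B t \<in> borel_measurable M) \<and>
     (\<forall>\<omega>\<in>space M. B 0 \<omega> = 0 \<and> continuous_on {0..} (\<lambda>t. B t \<omega>)) \<and>
     (\<forall>s t. 0 \<le> s \<longrightarrow> s < t \<longrightarrow>
        distributed M lborel (\<lambda>\<omega>. B t \<omega> - B s \<omega>) (normal_density 0 (sqrt (t - s)))) \<and>
     (\<forall>n p. 0 \<le> p 0 \<longrightarrow> mono_on {..n} p \<longrightarrow>
        prob_space.indep_vars M (\<lambda>_. borel) (\<lambda>k \<omega>. B (p (Suc k)) \<omega> - B (p k) \<omega>) {..<n::nat})"

text \<open>The transition matrix \<open>e\<^bsup>tQ\<^esup>\<close> of the chain with \<open>Q\<close>-matrix \<open>Q\<close>; entry \<open>(i, j)\<close> is the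
  probability of going from \<open>i\<close> to \<open>j\<close> in time \<open>t\<close>.\<close>

definition transition_matrix :: "real^'s^'s \<Rightarrow> real \<Rightarrow> real^'s^'s" where
  "transition_matrix Q t = (\<chi> i j. \<Sum>n. t ^ n / fact n * (((**) Q ^^ n) (mat 1)) $ i $ j)"

text \<open>Paths are right-continuous step functions with left limits (for the discrete topology on
  the finite state space).  The last clause is the Markov property with transition
  matrices \<open>e\<^bsup>tQ\<^esup>\<close>, multiplied out so that conditioning events may have probability zero.\<close>

definition markov_chain_Q :: "'a measure \<Rightarrow> real^'s^'s \<Rightarrow> (real \<Rightarrow> 'a \<Rightarrow> 's::finite) \<Rightarrow> bool" where
  "markov_chain_Q M Q \<Lambda> \<longleftrightarrow>
     (\<forall>t\<ge>0. \<Lambda> t \<in> measurable M (count_space UNIV)) \<and>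
     (\<forall>\<omega>\<in>space M. \<forall>t\<ge>0. \<forall>\<^sub>F s in at_right t. \<Lambda> s \<omega> = \<Lambda> t \<omega>) \<and>
     (\<forall>\<omega>\<in>space M. \<forall>t>0. \<exists>i. \<forall>\<^sub>F s in at_left t. \<Lambda> s \<omega> = i) \<and>
     (\<forall>n p i. 0 \<le> p 0 \<longrightarrow> mono_on {..Suc n} p \<longrightarrow>
        measure M {\<omega>\<in>space M. \<forall>k\<le>Suc n. \<Lambda> (p k) \<omega> = i k} =
        measure M {\<omega>\<in>space M. \<forall>k\<le>n. \<Lambda> (p k) \<omega> = i k} *
          transition_matrix Q (p (Suc n) - p n) $ i n $ i (Suc n))"

text \<open>The two-element type \<open>2\<close> has exactly the elements \<open>0\<close> and \<open>1\<close>; it is the state space of the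
  two-state chain, with \<open>rate i\<close> the rate of leaving state \<open>i\<close>.\<close>

definition two_state_Q :: "(2 \<Rightarrow> real) \<Rightarrow> real^2^2" where
  "two_state_Q rate = (\<chi> i j. if i = j then - rate i else rate i)"

text \<open>Elementary integrands \<open>\<Sum>k<n. \<xi> k * indicator {p k<..p (Suc k)}\<close> for a filtration \<open>F\<close>, and
  their stochastic integrals over \<open>[0, t]\<close>.\<close>

definition elementary :: "(real \<Rightarrow> 'a measure) \<Rightarrow> nat \<Rightarrow> (nat \<Rightarrow> real) \<Rightarrow> (nat \<Rightarrow> 'a \<Rightarrow> real) \<Rightarrow> bool" where
  "elementary F n p \<xi> \<longleftrightarrow> 0 \<le> p 0 \<and> mono_on {..n} p \<and>
     (\<forall>k<n. \<xi> k \<in> borel_measurable (F (p k)) \<and> (\<exists>C. \<forall>\<omega>\<in>space (F (p k)). \<bar>\<xi> k \<omega>\<bar> \<le> C))"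

definition elementary_process :: "nat \<Rightarrow> (nat \<Rightarrow> real) \<Rightarrow> (nat \<Rightarrow> 'a \<Rightarrow> real) \<Rightarrow> real \<Rightarrow> 'a \<Rightarrow> real" where
  "elementary_process n p \<xi> s \<omega> = (\<Sum>k<n. \<xi> k \<omega> * indicator {p k<..p (Suc k)} s)"

definition elementary_integral ::
  "(real \<Rightarrow> 'a \<Rightarrow> real) \<Rightarrow> nat \<Rightarrow> (nat \<Rightarrow> real) \<Rightarrow> (nat \<Rightarrow> 'a \<Rightarrow> real) \<Rightarrow> real \<Rightarrow> 'a \<Rightarrow> real" where
  "elementary_integral B n p \<xi> t \<omega> =
     (\<Sum>k<n. \<xi> k \<omega> * (B (min t (p (Suc k))) \<omega> - B (min t (p k)) \<omega>))"

text \<open>\<open>J\<close> is a continuous version of the Ito integral \<open>\<integral>\<^sub>0\<^sup>t H\<^sub>s dB\<^sub>s\<close>: \<open>J t\<close> is the \<open>L\<^sup>2(P)\<close>-limit of the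
  integrals of elementary processes which converge to \<open>H\<close> in \<open>L\<^sup>2([0,t] \<times> P)\<close>.  By the Ito isometry
  \<open>J t\<close> does not depend, up to null sets, on the approximating sequence, provided \<open>B\<close> is a
  Brownian motion for the filtration \<open>F\<close>.\<close>

definition ito_integral ::
  "'a measure \<Rightarrow> (real \<Rightarrow> 'a measure) \<Rightarrow> (real \<Rightarrow> 'a \<Rightarrow> real) \<Rightarrow> (real \<Rightarrow> 'a \<Rightarrow> real) \<Rightarrow> (real \<Rightarrow> 'a \<Rightarrow> real) \<Rightarrow> bool"
where
  "ito_integral M F B H J \<longleftrightarrow>
     (\<lambda>(s, \<omega>). H s \<omega>) \<in> borel_measurable (restrict_space borel {0..} \<Otimes>\<^sub>M M) \<and>
     (\<forall>t\<ge>0. J t \<in> borel_measurable M) \<and>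
     (\<forall>\<omega>\<in>space M. continuous_on {0..} (\<lambda>t. J t \<omega>)) \<and>
     (\<forall>t\<ge>0. \<exists>n p \<xi>.
        (\<forall>m::nat. elementary F (n m) (p m) (\<xi> m)) \<and>
        (\<lambda>m. \<integral>\<^sup>+\<omega>. (\<integral>\<^sup>+s\<in>{0..t}. ennreal ((H s \<omega> - elementary_process (n m) (p m) (\<xi> m) s \<omega>)\<^sup>2) \<partial>lborel) \<partial>M)
          \<longlonglongrightarrow> 0 \<and>
        (\<lambda>m. \<integral>\<^sup>+\<omega>. ennreal ((J t \<omega> - elementary_integral B (n m) (p m) (\<xi> m) t \<omega>)\<^sup>2) \<partial>M) \<longlonglongrightarrow> 0)"

definition natural_filtration :: "'a measure \<Rightarrow> (real \<Rightarrow> 'a \<Rightarrow> real) \<Rightarrow> (real \<Rightarrow> 'a \<Rightarrow> 2) \<Rightarrow> real \<Rightarrow> 'a measure" where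
  "natural_filtration M B \<Lambda> t =
     process_sigma M (borel \<Otimes>\<^sub>M count_space UNIV) {0..t} (\<lambda>s \<omega>. (B s \<omega>, \<Lambda> s \<omega>))"

definition volatility_integral ::
  "'a measure \<Rightarrow> (real \<Rightarrow> 'a \<Rightarrow> real) \<Rightarrow> (real \<Rightarrow> 'a \<Rightarrow> 2) \<Rightarrow> (2 \<Rightarrow> real) \<Rightarrow> (real \<Rightarrow> 'a \<Rightarrow> real) \<Rightarrow> bool" where
  "volatility_integral M B \<Lambda> \<sigma> J \<longleftrightarrow>
     ito_integral M (natural_filtration M B \<Lambda>) B (\<lambda>s \<omega>. \<sigma> (\<Lambda> s \<omega>)) J"

text \<open>\<open>X\<close> is given in the explicit form
  \<open>X\<^sub>t = x exp (\<integral>\<^sub>0\<^sup>t (\<mu>(\<Lambda>\<^sub>s) - \<sigma>(\<Lambda>\<^sub>s)\<^sup>2 / 2) ds + \<integral>\<^sub>0\<^sup>t \<sigma>(\<Lambda>\<^sub>s) dB\<^sub>s)\<close> of the solution of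
  \<open>dX\<^sub>t = \<mu>(\<Lambda>\<^sub>t) X\<^sub>t dt + \<sigma>(\<Lambda>\<^sub>t) X\<^sub>t dB\<^sub>t\<close>, \<open>X\<^sub>0 = x\<close>.\<close>

definition regime_switching_GBM ::
  "'a measure \<Rightarrow> (2 \<Rightarrow> real) \<Rightarrow> (2 \<Rightarrow> real) \<Rightarrow> (2 \<Rightarrow> real) \<Rightarrow> real \<Rightarrow>
   (real \<Rightarrow> 'a \<Rightarrow> real) \<Rightarrow> (real \<Rightarrow> 'a \<Rightarrow> 2) \<Rightarrow> (real \<Rightarrow> 'a \<Rightarrow> real) \<Rightarrow> bool" where
  "regime_switching_GBM M \<mu> \<sigma> rate x B \<Lambda> X \<longleftrightarrow>
     standard_brownian_motion M B \<and>
     markov_chain_Q M (two_state_Q rate) \<Lambda> \<and>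
     prob_space.indep_set M (sets (process_sigma M borel {0..} B))
       (sets (process_sigma M (count_space UNIV) {0..} \<Lambda>)) \<and>
     (\<exists>J. volatility_integral M B \<Lambda> \<sigma> J \<and>
       (\<forall>t\<ge>0. \<forall>\<omega>\<in>space M.
          X t \<omega> = x * exp ((LBINT s:{0..t}. \<mu> (\<Lambda> s \<omega>) - (\<sigma> (\<Lambda> s \<omega>))\<^sup>2 / 2) + J t \<omega>)))"

definition hitting_time :: "(real \<Rightarrow> 'a \<Rightarrow> real) \<Rightarrow> real \<Rightarrow> 'a \<Rightarrow> ereal" where
  "hitting_time X a \<omega> = (INF t\<in>{t. 0 < t \<and> X t \<omega> = a}. ereal t)"

definition occupation_time :: "(real \<Rightarrow> 'a \<Rightarrow> 2) \<Rightarrow> 2 \<Rightarrow> real \<Rightarrow> 'a \<Rightarrow> real" where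
  "occupation_time \<Lambda> i t \<omega> = measure lborel {s\<in>{0..t}. \<Lambda> s \<omega> = i}"

end

theory Submission
  imports Defs
begin

text \<open>
  The volatility integral is the \<open>L\<^sup>2\<close>-limit of the sums of \<open>\<sigma>(\<Lambda>)\<close>, sampled on a grid, against the
  increments of \<open>B\<close>.  Given the sampled values of \<open>\<Lambda>\<close>, such a sum has, at the grid points, the
  Gaussian law of \<open>sqrt (\<sigma>\<^sub>0\<^sup>2 - \<sigma>\<^sub>1\<^sup>2) B(\<alpha>(t)) + \<sigma>\<^sub>1 W(t)\<close> with a Brownian motion \<open>W\<close> independent of \<open>B(\<alpha>)\<close>.
  Slepian's inequality is not needed: after conditioning on the first term, the probability that
  \<open>W(t) > g(t)\<close> at all grid points is at most the minimum of the individual probabilities, and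
  this minimum is the probability that \<open>sqrt t \<eta>\<^sub>0 > g(t)\<close> at all grid points, because these events are
  nested.
\<close>

section \<open>Independence and Brownian increments\<close>

text \<open>The conditional inequality is tested as
  \<open>prob (L \<inter> A) \<le> prob (L \<inter> A')\<close> on chain events \<open>L\<close>.
  Cutting \<open>L\<close> by the finitely many patterns of sampled chain values freezes the
  volatilities and the clock, and independence factors the chain out, so no conditional law has to
  be constructed. Taking the smaller variance out of every cell leaves an excess only in state 0,
  which is why \<open>B\<close> runs on the occupation time of that state. The definition of
  \<open>J\<close> gives L2 limits along unspecified elementary integrands. To replace them by the
  sums on the grid, the Ito isometry is proved over a filtration that knows the whole chain in
  advance; independence of chain and \<open>B\<close> keeps it valid. Convergence in probability at
  single times does not control a minimum over an interval, so the comparison is made on the dyadic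
  times of one level, where error probabilities add up; the grid is refined first, the threshold
  dropping from \<open>2 * e\<close> to \<open>e\<close>, and then the level and \<open>e\<close>
  pass to the limit by continuity of paths.\<close>

lemma sets_process_sigma:
  "sets (process_sigma M N I X) =
     sigma_sets (space M) (\<Union>t\<in>I. {X t -` A \<inter> space M | A. A \<in> sets N})"
  unfolding process_sigma_def by (rule sets_measure_of) auto

lemma space_process_sigma [simp]: "space (process_sigma M N I X) = space M"
  unfolding process_sigma_def by (rule space_measure_of) auto

lemma measurable_process_sigma:
  assumes "t \<in> I" "X t \<in> space M \<rightarrow> space N"
  shows "X t \<in> measurable (process_sigma M N I X) N"
  using assms by (intro measurableI) (auto simp: sets_process_sigma intro!: sigma_sets.Basic)

lemma sets_process_sigma_le:
  assumes "space G = space M" "\<And>t. t \<in> I \<Longrightarrow> X t \<in> measurable G N"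
  shows "sets (process_sigma M N I X) \<subseteq> sets G"
proof -
  have "(\<Union>t\<in>I. {X t -` A \<inter> space M | A. A \<in> sets N}) \<subseteq> sets G"
    using assms measurable_sets[of "X _" G N] by fastforce
  then show ?thesis
    unfolding sets_process_sigma using sets.sigma_sets_subset[of _ G] assms(1) by simp
qed

lemma sets_process_sigma_mono:
  "I \<subseteq> I' \<Longrightarrow> sets (process_sigma M N I X) \<subseteq> sets (process_sigma M N I' X)"
  unfolding sets_process_sigma by (rule sigma_sets_mono') blast

lemma vimage_Pair_Times:
  "(\<lambda>x. (f x, g x)) -` (P \<times> Q) \<inter> S = (f -` P \<inter> S) \<inter> (g -` Q \<inter> S)"
  by auto

lemma (in prob_space) indep_set_mono:
  "indep_set A B \<Longrightarrow> A' \<subseteq> A \<Longrightarrow> B' \<subseteq> B \<Longrightarrow> indep_set A' B'"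
  unfolding indep_sets2_eq by blast

lemma (in prob_space) indep_set_commute: "indep_set A B \<Longrightarrow> indep_set B A"
  unfolding indep_sets2_eq by (metis Int_commute mult.commute)

text \<open>The intersections \<open>a \<inter> b\<close> form a pi-system generating the join of
  \<open>A\<close> and \<open>B\<close>, and on it the product rule follows by peeling off first
  \<open>a\<close> and then \<open>b\<close>. This regrouping serves twice: to add the chain to the
  past of \<open>B\<close>, and to set the pair of \<open>\<eta>\<close> and \<open>B\<close>
  against the chain.\<close>

lemma (in prob_space) indep_set_sigma_Un:
  assumes A: "sigma_algebra (space M) A" and B: "sigma_algebra (space M) B"
    and C: "sigma_algebra (space M) C"
    and ABC: "indep_set A (sigma_sets (space M) (B \<union> C))" and BC: "indep_set B C"
  shows "indep_set (sigma_sets (space M) (A \<union> B)) C"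
proof -
  interpret A: sigma_algebra "space M" A by fact
  interpret B: sigma_algebra "space M" B by fact
  interpret C: sigma_algebra "space M" C by fact
  interpret BC: sigma_algebra "space M" "sigma_sets (space M) (B \<union> C)"
    using B.space_closed C.space_closed by (intro sigma_algebra_sigma_sets) auto
  let ?E = "{a \<inter> b | a b. a \<in> A \<and> b \<in> B}"
  have ev: "A \<subseteq> events" "B \<subseteq> events" "C \<subseteq> events"
    using ABC BC by (auto simp: indep_sets2_eq)
  have stable: "Int_stable ?E"
  proof (rule Int_stableI, clarify)
    fix a b a' b' assume "a \<in> A" "b \<in> B" "a' \<in> A" "b' \<in> B"
    then show "\<exists>aa ba. a \<inter> b \<inter> (a' \<inter> b') = aa \<inter> ba \<and> aa \<in> A \<and> ba \<in> B"
      by (intro exI[of _ "a \<inter> a'"] exI[of _ "b \<inter> b'"]) auto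
  qed
  have "indep_set ?E C"
  proof (rule indep_setI)
    show "?E \<subseteq> events" "C \<subseteq> events" using ev by auto
    fix e c assume "e \<in> ?E" "c \<in> C"
    then obtain a b where e: "e = a \<inter> b" "a \<in> A" "b \<in> B" by auto
    have bc: "b \<inter> c \<in> sigma_sets (space M) (B \<union> C)"
      using e \<open>c \<in> C\<close> by (intro BC.Int) (auto intro: sigma_sets.Basic)
    have b: "b \<in> sigma_sets (space M) (B \<union> C)"
      using e by (auto intro: sigma_sets.Basic)
    have "prob (e \<inter> c) = prob (a \<inter> (b \<inter> c))" by (simp add: e Int_assoc)
    also have "\<dots> = prob a * (prob b * prob c)"
      using indep_setD[OF ABC e(2) bc] indep_setD[OF BC e(3) \<open>c \<in> C\<close>] by simp
    also have "\<dots> = prob e * prob c"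
      using indep_setD[OF ABC e(2) b] by (simp add: e)
    finally show "prob (e \<inter> c) = prob e * prob c" .
  qed
  from indep_set_sigma_sets[OF this stable C.Int_stable]
  have "indep_set (sigma_sets (space M) ?E) (sigma_sets (space M) C)" .
  moreover have "sigma_sets (space M) (A \<union> B) \<subseteq> sigma_sets (space M) ?E"
  proof (rule sigma_sets_mono', clarify)
    fix x assume "x \<in> A \<union> B"
    then show "\<exists>a b. x = a \<inter> b \<and> a \<in> A \<and> b \<in> B"
    proof
      assume "x \<in> A"
      then show ?thesis using A.sets_into_space by (intro exI[of _ x] exI[of _ "space M"]) auto
    next
      assume "x \<in> B"
      then show ?thesis using B.sets_into_space by (intro exI[of _ x] exI[of _ "space M"]) auto
    qed
  qed
  moreover have "C \<subseteq> sigma_sets (space M) C" by (auto intro: sigma_sets.Basic)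
  ultimately show ?thesis by (rule indep_set_mono)
qed

lemma (in prob_space) indep_set_imp_indep_var:
  assumes "indep_set A B" "space S' = space M" "space T' = space M"
    "sets S' = A" "sets T' = B" "X \<in> measurable S' S" "Y \<in> measurable T' T"
  shows "indep_var S X T Y"
proof -
  have sub: "sets S' \<subseteq> events" "sets T' \<subseteq> events"
    using assms by (auto simp: indep_sets2_eq)
  have "X \<in> measurable M S" "Y \<in> measurable M T"
    using assms sub measurable_mono[of S S] measurable_mono[of T T]
    by (metis (no_types, lifting) order_refl subsetD)+
  moreover have "sigma_sets (space M) {X -` A \<inter> space M |A. A \<in> sets S} \<subseteq> A"
    using sets.sigma_sets_subset[of "{X -` A \<inter> space M |A. A \<in> sets S}" S'] assms measurable_sets[of X S' S]
    by auto
  moreover have "sigma_sets (space M) {Y -` A \<inter> space M |A. A \<in> sets T} \<subseteq> B"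
    using sets.sigma_sets_subset[of "{Y -` A \<inter> space M |A. A \<in> sets T}" T'] assms measurable_sets[of Y T' T]
    by auto
  ultimately show ?thesis
    unfolding indep_var_eq using indep_set_mono[OF assms(1)] by auto
qed

text \<open>Fubini for the product law: conditioning on \<open>X\<close> amounts to freezing its
  value in an inner probability. Two joint events with the same \<open>X\<close> can then be
  compared section by section.\<close>

lemma (in prob_space) emeasure_indep_var:
  assumes ind: "indep_var S X T Y" and C: "C \<in> sets (S \<Otimes>\<^sub>M T)"
  shows "emeasure M {\<omega> \<in> space M. (X \<omega>, Y \<omega>) \<in> C} =
    (\<integral>\<^sup>+\<omega>. emeasure M {\<omega>' \<in> space M. (X \<omega>, Y \<omega>') \<in> C} \<partial>M)"
proof -
  have [measurable]: "X \<in> measurable M S" "Y \<in> measurable M T"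
    using ind indep_var_rv1 indep_var_rv2 by auto
  interpret Y: prob_space "distr M T Y" by (rule prob_space_distr) simp
  have CY: "C \<in> sets (distr M S X \<Otimes>\<^sub>M distr M T Y)"
    using C by (simp cong: sets_pair_measure_cong)
  have "emeasure M {\<omega> \<in> space M. (X \<omega>, Y \<omega>) \<in> C} =
      emeasure (distr M (S \<Otimes>\<^sub>M T) (\<lambda>x. (X x, Y x))) C"
    using C by (subst emeasure_distr) (auto intro!: arg_cong[where f="emeasure M"])
  also have "\<dots> = emeasure (distr M S X \<Otimes>\<^sub>M distr M T Y) C"
    using ind by (simp add: indep_var_distribution_eq)
  also have "\<dots> = (\<integral>\<^sup>+x. emeasure (distr M T Y) (Pair x -` C) \<partial>distr M S X)"
    using CY by (rule Y.emeasure_pair_measure_alt)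
  also have "\<dots> = (\<integral>\<^sup>+\<omega>. emeasure (distr M T Y) (Pair (X \<omega>) -` C) \<partial>M)"
    by (subst nn_integral_distr) (use Y.measurable_emeasure_Pair[OF CY] in auto)
  also have "\<dots> = (\<integral>\<^sup>+\<omega>. emeasure M {\<omega>' \<in> space M. (X \<omega>, Y \<omega>') \<in> C} \<partial>M)"
  proof (rule nn_integral_cong)
    fix \<omega> assume "\<omega> \<in> space M"
    have "Pair (X \<omega>) -` C \<in> sets T" using C by (rule sets_Pair1)
    then show "emeasure (distr M T Y) (Pair (X \<omega>) -` C) = emeasure M {\<omega>' \<in> space M. (X \<omega>, Y \<omega>') \<in> C}"
      by (subst emeasure_distr) (auto intro!: arg_cong[where f="emeasure M"])
  qed
  finally show ?thesis .
qed

section \<open>Brownian motion: independence of the past from later increments\<close>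

locale brownian = prob_space M for M :: "'a measure" +
  fixes B :: "real \<Rightarrow> 'a \<Rightarrow> real"
  assumes BM: "standard_brownian_motion M B"
begin

lemma measurable_B [measurable]: "0 \<le> t \<Longrightarrow> B t \<in> borel_measurable M"
  using BM by (simp add: standard_brownian_motion_def)

lemma B_0: "\<omega> \<in> space M \<Longrightarrow> B 0 \<omega> = 0"
  using BM by (simp add: standard_brownian_motion_def)

lemma continuous_B: "\<omega> \<in> space M \<Longrightarrow> continuous_on {0..} (\<lambda>t. B t \<omega>)"
  using BM by (simp add: standard_brownian_motion_def)

lemma distributed_increment:
  "0 \<le> s \<Longrightarrow> s < t \<Longrightarrow>
    distributed M lborel (\<lambda>\<omega>. B t \<omega> - B s \<omega>) (normal_density 0 (sqrt (t - s)))"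
  using BM by (simp add: standard_brownian_motion_def)

lemma indep_increments:
  "0 \<le> p 0 \<Longrightarrow> mono_on {..n} p \<Longrightarrow>
    indep_vars (\<lambda>_. borel) (\<lambda>k \<omega>. B (p (Suc k)) \<omega> - B (p k) \<omega>) {..<n::nat}"
  using BM by (simp add: standard_brownian_motion_def)

lemma subalgebra_B: "I \<subseteq> {0..} \<Longrightarrow> sets (process_sigma M borel I B) \<subseteq> events"
  by (rule sets_process_sigma_le) auto

lemma sum_increments:
  assumes "\<omega> \<in> space M" "p 0 = 0"
  shows "(\<Sum>j<k. B (p (Suc j)) \<omega> - B (p j) \<omega>) = B (p k) \<omega>"
  using sum_lessThan_telescope[of "\<lambda>j. B (p j) \<omega>" k] assms by (simp add: B_0)

text \<open>Independence of increments is available only along one monotone partition. Sorting the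
  finitely many times of \<open>U\<close> into such a partition of the interval up to
  \<open>s\<close>, and appending \<open>t\<close>, makes the values on \<open>U\<close> partial
  sums of the earlier increments and \<open>B t - B s\<close> the last increment.\<close>

lemma indep_past_cylinder:
  assumes s: "0 \<le> s" "s \<le> t" and U: "finite U" "U \<subseteq> {0..s}"
    and A: "\<And>u. A u \<in> sets borel" and C: "C \<in> sets borel"
  shows "prob ({\<omega>\<in>space M. \<forall>u\<in>U. B u \<omega> \<in> A u} \<inter> {\<omega>\<in>space M. B t \<omega> - B s \<omega> \<in> C}) =
    prob {\<omega>\<in>space M. \<forall>u\<in>U. B u \<omega> \<in> A u} * prob {\<omega>\<in>space M. B t \<omega> - B s \<omega> \<in> C}"
proof -
  \<comment> \<open>The time \<open>0\<close> lets the increments telescope to the values of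
    \<open>B\<close>; the time \<open>s\<close> makes cell number \<open>n\<close>, the last one,
    run exactly from \<open>s\<close> to \<open>t\<close>.\<close>
  define V where "V = insert 0 (insert s U)"
  define L where "L = sorted_list_of_set V"
  define n where "n = length L - 1"
  define p where "p k = (if k \<le> n then L ! k else t)" for k
  have V: "finite V" "V \<subseteq> {0..s}" "0 \<in> V" "s \<in> V" using U s by (auto simp: V_def)
  have setL: "set L = V" and sortL: "sorted L" using V by (auto simp: L_def)
  have len: "length L = Suc n"
    using V(3) setL by (cases L) (auto simp: n_def)
  have L0: "L ! 0 = 0"
  proof -
    obtain i where i: "i < length L" "L ! i = 0" using setL V(3) by (metis in_set_conv_nth)
    have "L ! 0 \<le> 0" using sorted_nth_mono[OF sortL, of 0 i] i by simp
    moreover have "L ! 0 \<in> V" using setL len by (metis nth_mem zero_less_Suc)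
    ultimately show ?thesis using V(2) by (auto simp: subset_eq intro: antisym)
  qed
  have Ln: "L ! n = s"
  proof -
    obtain i where i: "i < length L" "L ! i = s" using setL V(4) by (metis in_set_conv_nth)
    have "s \<le> L ! n" using sorted_nth_mono[OF sortL, of i n] i len by simp
    moreover have "L ! n \<in> V" using setL len by (metis nth_mem lessI)
    ultimately show ?thesis using V(2) by (auto simp: subset_eq intro: antisym)
  qed
  have p0: "p 0 = 0" and pn: "p n = s" and pSn: "p (Suc n) = t" using L0 Ln by (auto simp: p_def)
  have mono: "mono_on {..Suc n} p"
  proof (rule mono_onI)
    fix i j assume ij: "i \<in> {..Suc n}" "j \<in> {..Suc n}" "i \<le> j"
    show "p i \<le> p j"
    proof (cases "j \<le> n")
      case True
      then show ?thesis using ij sorted_nth_mono[OF sortL, of i j] len by (auto simp: p_def)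
    next
      case False
      then have "j = Suc n" using ij by auto
      moreover have "i \<le> n \<Longrightarrow> L ! i \<le> s"
        using sorted_nth_mono[OF sortL, of i n] len Ln by simp
      ultimately show ?thesis using s by (auto simp: p_def)
    qed
  qed
  have Up: "\<exists>k\<le>n. p k = u" if "u \<in> U" for u
  proof -
    have "u \<in> set L" using that by (simp add: setL V_def)
    then obtain k where "k < length L" "L ! k = u" by (metis in_set_conv_nth)
    then show ?thesis using len by (intro exI[of _ k]) (auto simp: p_def)
  qed
  let ?I = "\<lambda>k \<omega>. B (p (Suc k)) \<omega> - B (p k) \<omega>"
  have ind: "indep_vars (\<lambda>_. borel) ?I {..<Suc n}"
    by (rule indep_increments) (use p0 mono in auto)
  have iv: "indep_var (PiM {..<n} (\<lambda>_. borel)) (\<lambda>\<omega>. restrict (\<lambda>i. ?I i \<omega>) {..<n})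
      (PiM {n} (\<lambda>_. borel)) (\<lambda>\<omega>. restrict (\<lambda>i. ?I i \<omega>) {n})"
    by (rule indep_var_restrict[OF ind]) auto
  let ?P = "{x \<in> space (PiM {..<n} (\<lambda>_. borel :: real measure)). \<forall>k\<in>{..n}. p k \<in> U \<longrightarrow> (\<Sum>j<k. x j) \<in> A (p k)}"
  let ?Q = "{x \<in> space (PiM {n} (\<lambda>_. borel :: real measure)). x n \<in> C}"
  have [measurable]: "A u \<in> sets borel" "C \<in> sets borel" for u using A C by auto
  have P: "?P \<in> sets (PiM {..<n} (\<lambda>_. borel))"
  proof (rule sets.sets_Collect_finite_All')
    fix k assume k: "k \<in> {..n}"
    have [measurable]: "(\<lambda>x::nat\<Rightarrow>real. \<Sum>j<k. x j) \<in> borel_measurable (PiM {..<n} (\<lambda>_. borel))"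
      using k by (intro borel_measurable_sum measurable_component_singleton) auto
    show "{x \<in> space (PiM {..<n} (\<lambda>_. borel :: real measure)). p k \<in> U \<longrightarrow> (\<Sum>j<k. x j) \<in> A (p k)}
        \<in> sets (PiM {..<n} (\<lambda>_. borel))"
      by measurable
  qed auto
  have Q: "?Q \<in> sets (PiM {n} (\<lambda>_. borel))" by measurable
  have *: "(\<lambda>\<omega>. restrict (\<lambda>i. ?I i \<omega>) {..<n}) -` ?P \<inter> space M = {\<omega>\<in>space M. \<forall>u\<in>U. B u \<omega> \<in> A u}"
  proof (rule set_eqI)
    fix \<omega>
    have eq: "(\<Sum>j<k. restrict (\<lambda>i. ?I i \<omega>) {..<n} j) = B (p k) \<omega>" if "k \<le> n" "\<omega> \<in> space M" for k
    proof -
      have "(\<Sum>j<k. restrict (\<lambda>i. ?I i \<omega>) {..<n} j) = (\<Sum>j<k. ?I j \<omega>)"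
        using that by (intro sum.cong) auto
      then show ?thesis using sum_increments[OF that(2), of p k] p0 by simp
    qed
    show "\<omega> \<in> (\<lambda>\<omega>. restrict (\<lambda>i. ?I i \<omega>) {..<n}) -` ?P \<inter> space M \<longleftrightarrow> \<omega> \<in> {\<omega>\<in>space M. \<forall>u\<in>U. B u \<omega> \<in> A u}"
    proof (cases "\<omega> \<in> space M")
      case True
      then have "\<omega> \<in> (\<lambda>\<omega>. restrict (\<lambda>i. ?I i \<omega>) {..<n}) -` ?P \<inter> space M \<longleftrightarrow>
          (\<forall>k\<in>{..n}. p k \<in> U \<longrightarrow> B (p k) \<omega> \<in> A (p k))"
        using eq[OF _ True] by (simp add: space_PiM)
      also have "\<dots> \<longleftrightarrow> (\<forall>u\<in>U. B u \<omega> \<in> A u)" using Up by (metis atMost_iff)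
      finally show ?thesis using True by simp
    qed simp
  qed
  have **: "(\<lambda>\<omega>. restrict (\<lambda>i. ?I i \<omega>) {n}) -` ?Q \<inter> space M = {\<omega>\<in>space M. B t \<omega> - B s \<omega> \<in> C}"
    using pn pSn by (auto simp: space_PiM)
  show ?thesis
    using indep_varD[OF iv P Q] unfolding vimage_Pair_Times * ** .
qed

lemma indep_past_increment:
  assumes s: "0 \<le> s" "s \<le> t"
  shows "indep_set (sets (process_sigma M borel {0..s} B))
    (sets (vimage_algebra (space M) (\<lambda>\<omega>. B t \<omega> - B s \<omega>) borel))"
proof -
  let ?E = "{{\<omega>\<in>space M. \<forall>u\<in>U. B u \<omega> \<in> A u} | U A. finite U \<and> U \<subseteq> {0..s} \<and> (\<forall>u. A u \<in> sets borel)}"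
  let ?F = "{(\<lambda>\<omega>. B t \<omega> - B s \<omega>) -` C \<inter> space M | C. C \<in> sets borel}"
  have stable: "Int_stable ?E"
  proof (rule Int_stableI, clarify)
    fix U V :: "real set" and A A' :: "real \<Rightarrow> real set"
    assume *: "finite U" "U \<subseteq> {0..s}" "\<forall>u. A u \<in> sets borel" "finite V" "V \<subseteq> {0..s}" "\<forall>u. A' u \<in> sets borel"
    \<comment> \<open>Each cylinder constrains only its own times; the other times get the trivial
      condition \<open>UNIV\<close>, so the union of the two time sets describes the
      intersection.\<close>
    let ?A = "\<lambda>u. (if u \<in> U then A u else UNIV) \<inter> (if u \<in> V then A' u else UNIV)"
    show "\<exists>Ua Aa. {\<omega> \<in> space M. \<forall>u\<in>U. B u \<omega> \<in> A u} \<inter> {\<omega> \<in> space M. \<forall>u\<in>V. B u \<omega> \<in> A' u} =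
          {\<omega> \<in> space M. \<forall>u\<in>Ua. B u \<omega> \<in> Aa u} \<and> finite Ua \<and> Ua \<subseteq> {0..s} \<and> (\<forall>u. Aa u \<in> sets borel)"
      using * by (intro exI[of _ "U \<union> V"] exI[of _ ?A]) auto
  qed
  have stableF: "Int_stable ?F"
  proof (rule Int_stableI, clarify)
    fix C C' :: "real set" assume "C \<in> sets borel" "C' \<in> sets borel"
    then show "\<exists>Ca. ((\<lambda>\<omega>. B t \<omega> - B s \<omega>) -` C \<inter> space M) \<inter> ((\<lambda>\<omega>. B t \<omega> - B s \<omega>) -` C' \<inter> space M) =
        (\<lambda>\<omega>. B t \<omega> - B s \<omega>) -` Ca \<inter> space M \<and> Ca \<in> sets borel"
      by (intro exI[of _ "C \<inter> C'"]) auto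
  qed
  have ind: "indep_set ?E ?F"
  proof (rule indep_setI)
    show "?E \<subseteq> events"
    proof clarify
      fix U and A :: "real \<Rightarrow> real set" assume *: "finite U" "U \<subseteq> {0..s}" "\<forall>u. A u \<in> sets (borel::real measure)"
      show "{\<omega>\<in>space M. \<forall>u\<in>U. B u \<omega> \<in> A u} \<in> events"
        using * by (intro sets.sets_Collect_finite_All measurable_sets_Collect[OF measurable_B]) auto
    qed
    show "?F \<subseteq> events"
    proof clarify
      fix C assume [measurable]: "C \<in> sets (borel::real measure)"
      have "(\<lambda>\<omega>. B t \<omega> - B s \<omega>) \<in> borel_measurable M"
        using s by (intro borel_measurable_diff measurable_B) auto
      then show "(\<lambda>\<omega>. B t \<omega> - B s \<omega>) -` C \<inter> space M \<in> events" by measurable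
    qed
    fix a b assume "a \<in> ?E" "b \<in> ?F"
    then obtain U A C where *: "finite U" "U \<subseteq> {0..s}" "\<And>u. A u \<in> sets (borel::real measure)" "C \<in> sets borel"
       "a = {\<omega>\<in>space M. \<forall>u\<in>U. B u \<omega> \<in> A u}" "b = (\<lambda>\<omega>. B t \<omega> - B s \<omega>) -` C \<inter> space M" by blast
    then have "b = {\<omega>\<in>space M. B t \<omega> - B s \<omega> \<in> C}" by auto
    then show "prob (a \<inter> b) = prob a * prob b"
      using indep_past_cylinder[OF s *(1,2), of A C] * by simp
  qed
  have "indep_set (sigma_sets (space M) ?E) (sigma_sets (space M) ?F)"
    by (rule indep_set_sigma_sets[OF ind stable stableF])
  then show ?thesis
  proof (rule indep_set_mono)
    show "sets (process_sigma M borel {0..s} B) \<subseteq> sigma_sets (space M) ?E"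
      unfolding sets_process_sigma
    proof (rule sigma_sets_mono', clarify)
      fix u A assume "u \<in> {0..s}" "A \<in> sets (borel::real measure)"
      then show "\<exists>U A'. B u -` A \<inter> space M = {\<omega> \<in> space M. \<forall>u\<in>U. B u \<omega> \<in> A' u} \<and>
             finite U \<and> U \<subseteq> {0..s} \<and> (\<forall>u. A' u \<in> sets borel)"
        by (intro exI[of _ "{u}"] exI[of _ "\<lambda>_. A"]) auto
    qed
    show "sets (vimage_algebra (space M) (\<lambda>\<omega>. B t \<omega> - B s \<omega>) borel) \<subseteq> sigma_sets (space M) ?F"
      unfolding vimage_algebra_def by (subst sets_measure_of) auto
  qed
qed

end

section \<open>The Ito isometry\<close>

lemma integrable_mult_of_squares:
  fixes f g :: "'a \<Rightarrow> real"
  assumes [measurable]: "f \<in> borel_measurable M" "g \<in> borel_measurable M"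
    and "integrable M (\<lambda>x. (f x)\<^sup>2)" "integrable M (\<lambda>x. (g x)\<^sup>2)"
  shows "integrable M (\<lambda>x. f x * g x)"
proof (rule Bochner_Integration.integrable_bound)
  show "integrable M (\<lambda>x. (f x)\<^sup>2 + (g x)\<^sup>2)" using assms by auto
  show "AE x in M. norm (f x * g x) \<le> norm ((f x)\<^sup>2 + (g x)\<^sup>2)"
  proof (rule AE_I2)
    fix x
    have "2 * (\<bar>f x\<bar> * \<bar>g x\<bar>) \<le> (f x)\<^sup>2 + (g x)\<^sup>2"
      using sum_squares_bound[of "\<bar>f x\<bar>" "\<bar>g x\<bar>"] by (simp add: power2_eq_square)
    moreover have "0 \<le> \<bar>f x\<bar> * \<bar>g x\<bar>" by simp
    ultimately have "\<bar>f x\<bar> * \<bar>g x\<bar> \<le> (f x)\<^sup>2 + (g x)\<^sup>2" by linarith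
    then show "norm (f x * g x) \<le> norm ((f x)\<^sup>2 + (g x)\<^sup>2)" by (simp add: abs_mult)
  qed
qed simp

lemma integrable_bounded_mult:
  fixes f g :: "'a \<Rightarrow> real"
  assumes [measurable]: "f \<in> borel_measurable M" and "\<And>x. x \<in> space M \<Longrightarrow> \<bar>f x\<bar> \<le> C"
    and g: "integrable M g"
  shows "integrable M (\<lambda>x. f x * g x)"
proof (rule Bochner_Integration.integrable_bound)
  have [measurable]: "g \<in> borel_measurable M" using g by auto
  show "integrable M (\<lambda>x. C * g x)" using g by auto
  show "AE x in M. norm (f x * g x) \<le> norm (C * g x)"
    using assms(2) by (auto intro!: AE_I2 mult_right_mono simp: abs_mult intro: order_trans abs_ge_self)
  show "(\<lambda>x. f x * g x) \<in> borel_measurable M" by measurable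
qed

section \<open>The Brownian past enlarged by the chain\<close>

locale regime_switching = brownian M B for M :: "'a measure" and B +
  fixes \<Lambda> :: "real \<Rightarrow> 'a \<Rightarrow> 2"
  assumes measurable_\<Lambda> [measurable]: "0 \<le> t \<Longrightarrow> \<Lambda> t \<in> measurable M (count_space UNIV)"
    and right_continuous: "\<omega> \<in> space M \<Longrightarrow> 0 \<le> t \<Longrightarrow> \<forall>\<^sub>F s in at_right t. \<Lambda> s \<omega> = \<Lambda> t \<omega>"
    and indep_B_\<Lambda>: "indep_set (sets (process_sigma M borel {0..} B))
       (sets (process_sigma M (count_space UNIV) {0..} \<Lambda>))"
begin

text \<open>Only the Brownian part stops at \<open>s\<close>; the chain enters with its entire path,
  future included. Integrands may thus look ahead along the chain, while increments of
  \<open>B\<close> after \<open>s\<close> stay independent of what is known.\<close>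

definition past :: "real \<Rightarrow> 'a measure" where
  "past s = sigma (space M) (sets (process_sigma M borel {0..s} B) \<union>
     sets (process_sigma M (count_space UNIV) {0..} \<Lambda>))"

lemma process_sigma_subset_Pow: "sets (process_sigma M N I X) \<subseteq> Pow (space M)"
  using sets.sets_into_space[of _ "process_sigma M N I X"] by auto

lemma space_past [simp]: "space (past s) = space M"
  unfolding past_def by (intro space_measure_of Un_least process_sigma_subset_Pow)

lemma sets_past:
  "sets (past s) = sigma_sets (space M) (sets (process_sigma M borel {0..s} B) \<union>
     sets (process_sigma M (count_space UNIV) {0..} \<Lambda>))"
  unfolding past_def by (intro sets_measure_of Un_least process_sigma_subset_Pow)

lemma subalgebra_\<Lambda>: "sets (process_sigma M (count_space UNIV) {0..} \<Lambda>) \<subseteq> events"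
  by (rule sets_process_sigma_le) auto

lemma sets_past_le: "sets (past s) \<subseteq> events"
  unfolding sets_past using subalgebra_B[of "{0..s}"] subalgebra_\<Lambda>
  by (intro sets.sigma_sets_subset) auto

lemma sets_past_mono: "s \<le> t \<Longrightarrow> sets (past s) \<subseteq> sets (past t)"
  unfolding sets_past using sets_process_sigma_mono[of "{0..s}" "{0..t}" M borel B]
  by (intro sigma_sets_mono') auto

lemma measurable_past_mono: "f \<in> measurable (past s) N \<Longrightarrow> s \<le> t \<Longrightarrow> f \<in> measurable (past t) N"
  using measurable_mono[of N N "past s" "past t"] sets_past_mono by auto

lemma measurable_past: "f \<in> measurable (past s) N \<Longrightarrow> f \<in> measurable M N"
  using measurable_mono[of N N "past s" M] sets_past_le by auto

lemma B_past: "0 \<le> u \<Longrightarrow> u \<le> s \<Longrightarrow> B u \<in> borel_measurable (past s)"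
  using measurable_process_sigma[of u "{0..s}" B M borel]
    measurable_mono[of borel borel "process_sigma M borel {0..s} B" "past s"]
  by (auto simp: sets_past)

lemma \<Lambda>_past: "0 \<le> u \<Longrightarrow> \<Lambda> u \<in> measurable (past s) (count_space UNIV)"
  using measurable_process_sigma[of u "{0..}" \<Lambda> M "count_space UNIV"]
    measurable_mono[of "count_space UNIV" "count_space UNIV" "process_sigma M (count_space UNIV) {0..} \<Lambda>" "past s"]
  by (auto simp: sets_past)

text \<open>The chain is independent of the Brownian past and the increment taken together, and
  these two are independent of each other; regrouping puts chain and past on one side.\<close>

lemma indep_past:
  assumes s: "0 \<le> s" "s \<le> t" and G: "G \<in> borel_measurable (past s)"
  shows "indep_var borel G borel (\<lambda>\<omega>. B t \<omega> - B s \<omega>)"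
proof -
  let ?L = "sets (process_sigma M (count_space UNIV) {0..} \<Lambda>)"
  let ?B = "sets (process_sigma M borel {0..s} B)"
  let ?V = "vimage_algebra (space M) (\<lambda>\<omega>. B t \<omega> - B s \<omega>) (borel :: real measure)"
  have V: "(\<lambda>\<omega>. B t \<omega> - B s \<omega>) \<in> measurable (process_sigma M borel {0..} B) borel"
    using s by (intro borel_measurable_diff measurable_process_sigma) auto
  have VB: "sets ?V \<subseteq> sets (process_sigma M borel {0..} B)"
    using V by (subst sets_vimage_algebra2) (auto dest: measurable_sets)
  have BV: "sigma_sets (space M) (?B \<union> sets ?V) \<subseteq> sets (process_sigma M borel {0..} B)"
    using VB sets_process_sigma_mono[of "{0..s}" "{0..}" M borel B]
      sets.sigma_sets_subset[of "?B \<union> sets ?V" "process_sigma M borel {0..} B"] by auto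
  have 1: "indep_set ?L (sigma_sets (space M) (?B \<union> sets ?V))"
    by (rule indep_set_mono[OF indep_set_commute[OF indep_B_\<Lambda>] order_refl BV])
  have "indep_set (sigma_sets (space M) (?L \<union> ?B)) (sets ?V)"
    by (rule indep_set_sigma_Un[OF _ _ _ 1 indep_past_increment[OF s]])
      (use sets.sigma_algebra_axioms[of "process_sigma M (count_space UNIV) {0..} \<Lambda>"]
        sets.sigma_algebra_axioms[of "process_sigma M borel {0..s} B"]
        sets.sigma_algebra_axioms[of ?V] in auto)
  then have ind: "indep_set (sets (past s)) (sets ?V)"
    by (simp add: sets_past Un_commute)
  show ?thesis
    by (rule indep_set_imp_indep_var[OF ind, of "past s" ?V])
      (use G in \<open>auto intro: measurable_vimage_algebra1\<close>)
qed

lemma increment_measurable: "0 \<le> s \<Longrightarrow> 0 \<le> t \<Longrightarrow> (\<lambda>\<omega>. B t \<omega> - B s \<omega>) \<in> borel_measurable M"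
  by (intro borel_measurable_diff measurable_B)

lemma increment_moments:
  assumes "0 \<le> s" "s \<le> t"
  shows "integrable M (\<lambda>\<omega>. B t \<omega> - B s \<omega>)" "integrable M (\<lambda>\<omega>. (B t \<omega> - B s \<omega>)\<^sup>2)"
    "expectation (\<lambda>\<omega>. B t \<omega> - B s \<omega>) = 0" "expectation (\<lambda>\<omega>. (B t \<omega> - B s \<omega>)\<^sup>2) = t - s"
proof -
  have "integrable M (\<lambda>\<omega>. B t \<omega> - B s \<omega>) \<and> integrable M (\<lambda>\<omega>. (B t \<omega> - B s \<omega>)\<^sup>2) \<and>
    expectation (\<lambda>\<omega>. B t \<omega> - B s \<omega>) = 0 \<and> expectation (\<lambda>\<omega>. (B t \<omega> - B s \<omega>)\<^sup>2) = t - s"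
  proof (cases "s = t")
    case False
    then have st: "s < t" using assms by auto
    then have pos: "0 < sqrt (t - s)" by simp
    note D = distributed_increment[OF assms(1) st]
    have 1: "integrable M (\<lambda>\<omega>. B t \<omega> - B s \<omega>)"
      using distributed_integrable[OF D, of "\<lambda>x. x"] integrable_normal_moment_nz_1[OF pos, of 0] by simp
    have 2: "integrable M (\<lambda>\<omega>. (B t \<omega> - B s \<omega>)\<^sup>2)"
      using distributed_integrable[OF D, of "\<lambda>x. x\<^sup>2"] integrable_normal_moment[OF pos, of 0 2] by simp
    have 3: "expectation (\<lambda>\<omega>. B t \<omega> - B s \<omega>) = 0"
      by (rule normal_distributed_expectation[OF pos D])
    show ?thesis using 1 2 3 normal_distributed_variance[OF pos D] st by simp
  qed simp
  then show "integrable M (\<lambda>\<omega>. B t \<omega> - B s \<omega>)" "integrable M (\<lambda>\<omega>. (B t \<omega> - B s \<omega>)\<^sup>2)"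
    "expectation (\<lambda>\<omega>. B t \<omega> - B s \<omega>) = 0" "expectation (\<lambda>\<omega>. (B t \<omega> - B s \<omega>)\<^sup>2) = t - s" by auto
qed

lemma integrable_increments_mult:
  assumes "0 \<le> a" "a \<le> b" "0 \<le> a'" "a' \<le> b'"
  shows "integrable M (\<lambda>\<omega>. (B b \<omega> - B a \<omega>) * (B b' \<omega> - B a' \<omega>))"
  by (rule integrable_mult_of_squares) (use assms increment_moments in \<open>auto intro: increment_measurable\<close>)

lemma past_times_increment:
  assumes "0 \<le> a" "a \<le> b" "\<zeta> \<in> borel_measurable (past a)" "integrable M \<zeta>"
  shows "integrable M (\<lambda>\<omega>. \<zeta> \<omega> * (B b \<omega> - B a \<omega>))" "expectation (\<lambda>\<omega>. \<zeta> \<omega> * (B b \<omega> - B a \<omega>)) = 0"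
  using indep_var_integrable[OF indep_past[OF assms(1-3)] assms(4) increment_moments(1)[OF assms(1,2)]]
    indep_var_lebesgue_integral[OF indep_past[OF assms(1-3)] assms(4) increment_moments(1)[OF assms(1,2)]]
    increment_moments(3)[OF assms(1,2)] by simp_all

text \<open>The longer increment is split at \<open>b\<close>. Its first part gives the squared
  increment, with mean \<open>b - a\<close> and independent of \<open>\<zeta>\<close>; its second
  part is centred and independent of everything known at \<open>b\<close>.\<close>

lemma past_times_increment_square:
  assumes a: "0 \<le> a" "a \<le> b" and "b \<le> b'" and \<zeta>: "\<zeta> \<in> borel_measurable (past a)"
    and bd: "\<And>\<omega>. \<omega> \<in> space M \<Longrightarrow> \<bar>\<zeta> \<omega>\<bar> \<le> C"
  shows "expectation (\<lambda>\<omega>. \<zeta> \<omega> * ((B b \<omega> - B a \<omega>) * (B b' \<omega> - B a \<omega>))) = expectation \<zeta> * (b - a)"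
proof -
  have \<zeta>M: "\<zeta> \<in> borel_measurable M" using \<zeta> by (rule measurable_past)
  have \<zeta>i: "integrable M \<zeta>"
    using integrable_bounded_mult[OF \<zeta>M bd, of "\<lambda>_. 1"] by simp
  have sq: "indep_var borel \<zeta> borel (\<lambda>\<omega>. (B b \<omega> - B a \<omega>)\<^sup>2)"
    using indep_var_compose[OF indep_past[OF a \<zeta>], of "\<lambda>x. x" borel "\<lambda>x. x\<^sup>2" borel] by (simp add: comp_def)
  have past: "(\<lambda>\<omega>. \<zeta> \<omega> * (B b \<omega> - B a \<omega>)) \<in> borel_measurable (past b)"
    using a by (intro borel_measurable_times borel_measurable_diff measurable_past_mono[OF \<zeta>] B_past) auto
  have b: "0 \<le> b" using a by simp
  note P = past_times_increment[OF b \<open>b \<le> b'\<close> past past_times_increment(1)[OF a \<zeta> \<zeta>i]]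
  have "expectation (\<lambda>\<omega>. \<zeta> \<omega> * ((B b \<omega> - B a \<omega>) * (B b' \<omega> - B a \<omega>))) =
     expectation (\<lambda>\<omega>. \<zeta> \<omega> * (B b \<omega> - B a \<omega>)\<^sup>2 + \<zeta> \<omega> * (B b \<omega> - B a \<omega>) * (B b' \<omega> - B b \<omega>))"
    by (intro Bochner_Integration.integral_cong) (auto simp: algebra_simps power2_eq_square)
  also have "\<dots> = expectation (\<lambda>\<omega>. \<zeta> \<omega> * (B b \<omega> - B a \<omega>)\<^sup>2) +
      expectation (\<lambda>\<omega>. \<zeta> \<omega> * (B b \<omega> - B a \<omega>) * (B b' \<omega> - B b \<omega>))"
    using indep_var_integrable[OF sq \<zeta>i increment_moments(2)[OF a]] P(1)
    by (rule Bochner_Integration.integral_add)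
  also have "\<dots> = expectation \<zeta> * (b - a)"
    using indep_var_lebesgue_integral[OF sq \<zeta>i increment_moments(2)[OF a]] P(2) increment_moments(4)[OF a] by simp
  finally show ?thesis .
qed

text \<open>Length of the intersection of \<open>{a<..b}\<close> and \<open>{a'<..b'}\<close>, which
  is also the covariance of the corresponding Brownian increments.\<close>

definition overlap :: "real \<Rightarrow> real \<Rightarrow> real \<Rightarrow> real \<Rightarrow> real" where
  "overlap a b a' b' = max 0 (min b b' - max a a')"

lemma overlap_commute: "overlap a b a' b' = overlap a' b' a b"
  by (simp add: overlap_def min.commute max.commute)

text \<open>The earlier interval is cut at \<open>c = min b a'\<close>. What happens up to
  \<open>c\<close> is known at \<open>a'\<close>, so its product with the second increment has mean
  zero; what remains is either trivial or starts together with the second increment, where the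
  squared increment decides. The order \<open>a \<le> a'\<close> is restored by symmetry
  afterwards.\<close>

lemma expectation_increments_aux:
  assumes a: "0 \<le> a" "a \<le> b" "a' \<le> b'" and aa': "a \<le> a'"
    and \<xi>: "\<xi> \<in> borel_measurable (past a)" and \<xi>': "\<xi>' \<in> borel_measurable (past a')"
    and bd: "\<And>\<omega>. \<omega> \<in> space M \<Longrightarrow> \<bar>\<xi> \<omega>\<bar> \<le> C" and bd': "\<And>\<omega>. \<omega> \<in> space M \<Longrightarrow> \<bar>\<xi>' \<omega>\<bar> \<le> C'"
  shows "expectation (\<lambda>\<omega>. (\<xi> \<omega> * (B b \<omega> - B a \<omega>)) * (\<xi>' \<omega> * (B b' \<omega> - B a' \<omega>))) =
    expectation (\<lambda>\<omega>. \<xi> \<omega> * \<xi>' \<omega>) * overlap a b a' b'"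
proof -
  let ?\<zeta> = "\<lambda>\<omega>. \<xi> \<omega> * \<xi>' \<omega>"
  define c where "c = min b a'"
  have c: "a \<le> c" "c \<le> a'" "c \<le> b" using a aa' by (auto simp: c_def)
  have a'0: "0 \<le> a'" using a aa' by simp
  have \<zeta>: "?\<zeta> \<in> borel_measurable (past a')"
    using measurable_past_mono[OF \<xi> aa'] \<xi>' by (rule borel_measurable_times)
  have \<zeta>bd: "\<bar>?\<zeta> \<omega>\<bar> \<le> C * C'" if "\<omega> \<in> space M" for \<omega>
    using bd[OF that] bd'[OF that] by (auto simp: abs_mult intro!: mult_mono intro: order_trans[OF abs_ge_zero])
  have \<zeta>M: "?\<zeta> \<in> borel_measurable M" using \<zeta> by (rule measurable_past)
  have past1: "(\<lambda>\<omega>. ?\<zeta> \<omega> * (B c \<omega> - B a \<omega>)) \<in> borel_measurable (past a')"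
    using c a by (intro borel_measurable_times \<zeta> borel_measurable_diff B_past \<xi>' measurable_past_mono[OF \<xi> aa']) auto
  have int1: "integrable M (\<lambda>\<omega>. ?\<zeta> \<omega> * (B c \<omega> - B a \<omega>))"
    using increment_moments(1) a c by (intro integrable_bounded_mult[OF \<zeta>M \<zeta>bd]) auto
  note P = past_times_increment[OF a'0 a(3) past1 int1]
  have int2: "integrable M (\<lambda>\<omega>. ?\<zeta> \<omega> * ((B b \<omega> - B c \<omega>) * (B b' \<omega> - B a' \<omega>)))"
    using integrable_increments_mult a c a'0 by (intro integrable_bounded_mult[OF \<zeta>M \<zeta>bd]) auto
  have "expectation (\<lambda>\<omega>. (\<xi> \<omega> * (B b \<omega> - B a \<omega>)) * (\<xi>' \<omega> * (B b' \<omega> - B a' \<omega>))) =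
     expectation (\<lambda>\<omega>. ?\<zeta> \<omega> * (B c \<omega> - B a \<omega>) * (B b' \<omega> - B a' \<omega>) +
        ?\<zeta> \<omega> * ((B b \<omega> - B c \<omega>) * (B b' \<omega> - B a' \<omega>)))"
    by (intro Bochner_Integration.integral_cong) (auto simp: algebra_simps)
  also have "\<dots> = expectation (\<lambda>\<omega>. ?\<zeta> \<omega> * ((B b \<omega> - B c \<omega>) * (B b' \<omega> - B a' \<omega>)))"
    using Bochner_Integration.integral_add[OF P(1) int2] P(2) by simp
  also have "\<dots> = expectation ?\<zeta> * overlap a b a' b'"
  proof (cases "b \<le> a'")
    case True
    then show ?thesis using a aa' by (simp add: c_def overlap_def)
  next
    case False
    then have ca: "c = a'" by (simp add: c_def)
    show ?thesis
    proof (cases "b \<le> b'")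
      case True
      then show ?thesis
        using past_times_increment_square[OF a'0 _ True \<zeta> \<zeta>bd] False aa' by (simp add: ca overlap_def)
    next
      case F: False
      then have "b' \<le> b" by simp
      from past_times_increment_square[OF a'0 a(3) this \<zeta> \<zeta>bd] show ?thesis
        using F False a aa' by (simp add: ca overlap_def mult.commute)
    qed
  qed
  finally show ?thesis .
qed

lemma expectation_increments:
  assumes "0 \<le> a" "a \<le> b" "0 \<le> a'" "a' \<le> b'"
    and "\<xi> \<in> borel_measurable (past a)" "\<xi>' \<in> borel_measurable (past a')"
    and "\<And>\<omega>. \<omega> \<in> space M \<Longrightarrow> \<bar>\<xi> \<omega>\<bar> \<le> C" "\<And>\<omega>. \<omega> \<in> space M \<Longrightarrow> \<bar>\<xi>' \<omega>\<bar> \<le> C'"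
  shows "expectation (\<lambda>\<omega>. (\<xi> \<omega> * (B b \<omega> - B a \<omega>)) * (\<xi>' \<omega> * (B b' \<omega> - B a' \<omega>))) =
    expectation (\<lambda>\<omega>. \<xi> \<omega> * \<xi>' \<omega>) * overlap a b a' b'"
proof (cases "a \<le> a'")
  case True
  show ?thesis by (rule expectation_increments_aux) (use assms True in auto)
next
  case False
  have "expectation (\<lambda>\<omega>. (\<xi>' \<omega> * (B b' \<omega> - B a' \<omega>)) * (\<xi> \<omega> * (B b \<omega> - B a \<omega>))) =
    expectation (\<lambda>\<omega>. \<xi>' \<omega> * \<xi> \<omega>) * overlap a' b' a b"
    by (rule expectation_increments_aux) (use assms False in auto)
  then show ?thesis by (simp add: mult.commute overlap_commute)
qed

lemma integral_indicator_overlap: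
  assumes "a \<le> b" "a' \<le> b'"
  shows "integrable lborel (\<lambda>s. indicator {a<..b} s * indicator {a'<..b'} s :: real)"
    "(\<integral>s. indicator {a<..b} s * indicator {a'<..b'} s \<partial>lborel) = overlap a b a' b'"
proof -
  have eq: "(\<lambda>s. indicator {a<..b} s * indicator {a'<..b'} s :: real) = indicator {max a a'<..min b b'}"
    by (auto simp: indicator_def)
  have fin: "emeasure lborel {max a a'<..min b b'} < \<infinity>"
    by (cases "max a a' \<le> min b b'") auto
  show "integrable lborel (\<lambda>s. indicator {a<..b} s * indicator {a'<..b'} s :: real)"
    unfolding eq using fin by (intro integrable_real_indicator) auto
  show "(\<integral>s. indicator {a<..b} s * indicator {a'<..b'} s \<partial>lborel) = overlap a b a' b'"
    unfolding eq by (cases "max a a' \<le> min b b'") (auto simp: overlap_def measure_def)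
qed

text \<open>Both sides expand into the same double sum of \<open>expectation (\<lambda>\<omega>.
  \<xi> k \<omega> * \<xi> l \<omega>)\<close> times the overlap of cells \<open>k\<close> and
  \<open>l\<close>. Cells may overlap arbitrarily, so the difference of two elementary integrals on
  unrelated partitions is covered without a common refinement.\<close>

lemma isometry:
  fixes a b :: "'i \<Rightarrow> real"
  assumes K: "finite K" and ab: "\<And>k. k \<in> K \<Longrightarrow> 0 \<le> a k" "\<And>k. k \<in> K \<Longrightarrow> a k \<le> b k"
    and \<xi>: "\<And>k. k \<in> K \<Longrightarrow> \<xi> k \<in> borel_measurable (past (a k))"
    and bd: "\<And>k \<omega>. k \<in> K \<Longrightarrow> \<omega> \<in> space M \<Longrightarrow> \<bar>\<xi> k \<omega>\<bar> \<le> C k"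
  shows "(\<integral>\<^sup>+\<omega>. ennreal ((\<Sum>k\<in>K. \<xi> k \<omega> * (B (b k) \<omega> - B (a k) \<omega>))\<^sup>2) \<partial>M) =
    (\<integral>\<^sup>+\<omega>. (\<integral>\<^sup>+s. ennreal ((\<Sum>k\<in>K. \<xi> k \<omega> * indicator {a k<..b k} s)\<^sup>2) \<partial>lborel) \<partial>M)"
proof -
  let ?m = "\<lambda>k l. overlap (a k) (b k) (a l) (b l)"
  let ?I = "\<lambda>k \<omega>. \<xi> k \<omega> * (B (b k) \<omega> - B (a k) \<omega>)"
  have \<xi>M: "\<xi> k \<in> borel_measurable M" if "k \<in> K" for k using \<xi>[OF that] by (rule measurable_past)
  have \<xi>\<xi>bd: "\<bar>\<xi> k \<omega> * \<xi> l \<omega>\<bar> \<le> C k * C l" if "k \<in> K" "l \<in> K" "\<omega> \<in> space M" for k l \<omega>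
    using bd[OF that(1,3)] bd[OF that(2,3)] by (auto simp: abs_mult intro!: mult_mono intro: order_trans[OF abs_ge_zero])
  have \<xi>\<xi>M: "(\<lambda>\<omega>. \<xi> k \<omega> * \<xi> l \<omega>) \<in> borel_measurable M" if "k \<in> K" "l \<in> K" for k l
    using \<xi>M that by auto
  have int\<xi>: "integrable M (\<lambda>\<omega>. \<xi> k \<omega> * \<xi> l \<omega>)" if "k \<in> K" "l \<in> K" for k l
    using integrable_bounded_mult[OF \<xi>\<xi>M[OF that] \<xi>\<xi>bd[OF that], of "\<lambda>_. 1"] by simp
  have intI: "integrable M (\<lambda>\<omega>. ?I k \<omega> * ?I l \<omega>)" if "k \<in> K" "l \<in> K" for k l
  proof -
    have "integrable M (\<lambda>\<omega>. (\<xi> k \<omega> * \<xi> l \<omega>) * ((B (b k) \<omega> - B (a k) \<omega>) * (B (b l) \<omega> - B (a l) \<omega>)))"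
      by (rule integrable_bounded_mult[OF \<xi>\<xi>M[OF that] \<xi>\<xi>bd[OF that]])
        (use ab that in \<open>auto intro: integrable_increments_mult\<close>)
    then show ?thesis by (simp add: algebra_simps)
  qed
  have sq1: "(\<Sum>k\<in>K. ?I k \<omega>)\<^sup>2 = (\<Sum>k\<in>K. \<Sum>l\<in>K. ?I k \<omega> * ?I l \<omega>)" for \<omega>
    unfolding power2_eq_square by (rule sum_product)
  have 1: "(\<integral>\<^sup>+\<omega>. ennreal ((\<Sum>k\<in>K. ?I k \<omega>)\<^sup>2) \<partial>M) =
      ennreal (\<Sum>k\<in>K. \<Sum>l\<in>K. expectation (\<lambda>\<omega>. \<xi> k \<omega> * \<xi> l \<omega>) * ?m k l)"
  proof -
    have "integrable M (\<lambda>\<omega>. (\<Sum>k\<in>K. ?I k \<omega>)\<^sup>2)"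
      unfolding sq1 by (intro Bochner_Integration.integrable_sum intI)
    then have "(\<integral>\<^sup>+\<omega>. ennreal ((\<Sum>k\<in>K. ?I k \<omega>)\<^sup>2) \<partial>M) = ennreal (expectation (\<lambda>\<omega>. (\<Sum>k\<in>K. ?I k \<omega>)\<^sup>2))"
      by (intro nn_integral_eq_integral) auto
    also have "expectation (\<lambda>\<omega>. (\<Sum>k\<in>K. ?I k \<omega>)\<^sup>2) = (\<Sum>k\<in>K. \<Sum>l\<in>K. expectation (\<lambda>\<omega>. ?I k \<omega> * ?I l \<omega>))"
      unfolding sq1 using intI by (simp add: Bochner_Integration.integral_sum Bochner_Integration.integrable_sum)
    also have "\<dots> = (\<Sum>k\<in>K. \<Sum>l\<in>K. expectation (\<lambda>\<omega>. \<xi> k \<omega> * \<xi> l \<omega>) * ?m k l)"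
      using ab \<xi> bd by (intro sum.cong refl expectation_increments[where C="C _" and C'="C _"]) auto
    finally show ?thesis .
  qed
  have sq2: "(\<Sum>k\<in>K. \<xi> k \<omega> * indicator {a k<..b k} s)\<^sup>2 =
      (\<Sum>k\<in>K. \<Sum>l\<in>K. (\<xi> k \<omega> * \<xi> l \<omega>) * (indicator {a k<..b k} s * indicator {a l<..b l} s))" for \<omega> s
    unfolding power2_eq_square sum_product by (intro sum.cong refl) (simp add: algebra_simps)
  have inner: "(\<integral>\<^sup>+s. ennreal ((\<Sum>k\<in>K. \<xi> k \<omega> * indicator {a k<..b k} s)\<^sup>2) \<partial>lborel) =
      ennreal (\<Sum>k\<in>K. \<Sum>l\<in>K. (\<xi> k \<omega> * \<xi> l \<omega>) * ?m k l)"
    and inner0: "0 \<le> (\<Sum>k\<in>K. \<Sum>l\<in>K. (\<xi> k \<omega> * \<xi> l \<omega>) * ?m k l)" for \<omega>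
  proof -
    have i: "integrable lborel (\<lambda>s. (\<xi> k \<omega> * \<xi> l \<omega>) * (indicator {a k<..b k} s * indicator {a l<..b l} s))"
      if "k \<in> K" "l \<in> K" for k l
      using integral_indicator_overlap(1)[OF ab(2)[OF that(1)] ab(2)[OF that(2)]] by simp
    have int: "integrable lborel (\<lambda>s. (\<Sum>k\<in>K. \<xi> k \<omega> * indicator {a k<..b k} s)\<^sup>2)"
      unfolding sq2 by (intro Bochner_Integration.integrable_sum i)
    have eq: "(\<integral>s. (\<Sum>k\<in>K. \<xi> k \<omega> * indicator {a k<..b k} s)\<^sup>2 \<partial>lborel) =
        (\<Sum>k\<in>K. \<Sum>l\<in>K. (\<xi> k \<omega> * \<xi> l \<omega>) * ?m k l)"
      unfolding sq2 using i ab
      by (simp add: Bochner_Integration.integral_sum Bochner_Integration.integrable_sum integral_indicator_overlap(2))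
    show "(\<integral>\<^sup>+s. ennreal ((\<Sum>k\<in>K. \<xi> k \<omega> * indicator {a k<..b k} s)\<^sup>2) \<partial>lborel) =
      ennreal (\<Sum>k\<in>K. \<Sum>l\<in>K. (\<xi> k \<omega> * \<xi> l \<omega>) * ?m k l)"
      using nn_integral_eq_integral[OF int] by (simp add: eq)
    show "0 \<le> (\<Sum>k\<in>K. \<Sum>l\<in>K. (\<xi> k \<omega> * \<xi> l \<omega>) * ?m k l)"
      unfolding eq[symmetric] by (rule integral_nonneg_AE) simp
  qed
  have i2: "integrable M (\<lambda>\<omega>. \<Sum>k\<in>K. \<Sum>l\<in>K. (\<xi> k \<omega> * \<xi> l \<omega>) * ?m k l)"
    by (intro Bochner_Integration.integrable_sum integrable_mult_left int\<xi>)
  have "(\<integral>\<^sup>+\<omega>. (\<integral>\<^sup>+s. ennreal ((\<Sum>k\<in>K. \<xi> k \<omega> * indicator {a k<..b k} s)\<^sup>2) \<partial>lborel) \<partial>M) =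
      ennreal (expectation (\<lambda>\<omega>. \<Sum>k\<in>K. \<Sum>l\<in>K. (\<xi> k \<omega> * \<xi> l \<omega>) * ?m k l))"
    unfolding inner by (rule nn_integral_eq_integral[OF i2]) (simp add: inner0)
  also have "expectation (\<lambda>\<omega>. \<Sum>k\<in>K. \<Sum>l\<in>K. (\<xi> k \<omega> * \<xi> l \<omega>) * ?m k l) =
      (\<Sum>k\<in>K. \<Sum>l\<in>K. expectation (\<lambda>\<omega>. \<xi> k \<omega> * \<xi> l \<omega>) * ?m k l)"
    using int\<xi> by (simp add: Bochner_Integration.integral_sum Bochner_Integration.integrable_sum)
  finally show ?thesis using 1 by simp
qed

end

section \<open>Approximation of the volatility integral on a grid\<close>

lemma ennreal_square_add_le: "ennreal ((x + y)\<^sup>2) \<le> 2 * ennreal (x\<^sup>2) + 2 * ennreal (y\<^sup>2)"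
proof -
  have "(x + y)\<^sup>2 \<le> 2 * x\<^sup>2 + 2 * y\<^sup>2"
    using sum_squares_bound[of x y] by (simp add: power2_sum)
  then have "ennreal ((x + y)\<^sup>2) \<le> ennreal (2 * x\<^sup>2 + 2 * y\<^sup>2)" by (rule ennreal_leI)
  also have "\<dots> = 2 * ennreal (x\<^sup>2) + 2 * ennreal (y\<^sup>2)"
    by (simp add: ennreal_plus ennreal_mult)
  finally show ?thesis .
qed

text \<open>Replaces the triangle inequality of L2: it stays within \<open>ennreal\<close>, where
  infinite integrals cause no side conditions, at the price of the factor 2.\<close>

lemma nn_integral_square_add_le:
  fixes u v :: "'a \<Rightarrow> real"
  assumes [measurable]: "u \<in> borel_measurable N" "v \<in> borel_measurable N"
  shows "(\<integral>\<^sup>+x. ennreal ((u x + v x)\<^sup>2) \<partial>N) \<le>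
    2 * (\<integral>\<^sup>+x. ennreal ((u x)\<^sup>2) \<partial>N) + 2 * (\<integral>\<^sup>+x. ennreal ((v x)\<^sup>2) \<partial>N)"
proof -
  have "(\<integral>\<^sup>+x. ennreal ((u x + v x)\<^sup>2) \<partial>N) \<le> (\<integral>\<^sup>+x. 2 * ennreal ((u x)\<^sup>2) + 2 * ennreal ((v x)\<^sup>2) \<partial>N)"
    by (intro nn_integral_mono ennreal_square_add_le)
  also have "\<dots> = 2 * (\<integral>\<^sup>+x. ennreal ((u x)\<^sup>2) \<partial>N) + 2 * (\<integral>\<^sup>+x. ennreal ((v x)\<^sup>2) \<partial>N)"
    by (simp add: nn_integral_add nn_integral_cmult)
  finally show ?thesis .
qed

text \<open>The Ito integral is defined with the closed interval, whereas elementary processes live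
  on cells open on the left; only the null set of the point 0 separates the two. The indicator goes
  inside the square to fit the isometry.\<close>

lemma nn_integral_lborel_Ioc:
  fixes f :: "real \<Rightarrow> real"
  shows "(\<integral>\<^sup>+s\<in>{0..t}. ennreal ((f s)\<^sup>2) \<partial>lborel) =
    (\<integral>\<^sup>+s. ennreal ((f s * indicator {0<..t} s)\<^sup>2) \<partial>lborel)"
proof (rule nn_integral_cong_AE)
  show "AE s in lborel. ennreal ((f s)\<^sup>2) * indicator {0..t} s = ennreal ((f s * indicator {0<..t} s)\<^sup>2)"
    using AE_lborel_singleton[of "0::real"] by eventually_elim (auto simp: indicator_def)
qed

section \<open>Uniform grids and step processes on them\<close>

definition grid :: "real \<Rightarrow> nat \<Rightarrow> nat \<Rightarrow> real" where
  "grid T N k = real k * T / real N"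

lemma grid_0 [simp]: "grid T N 0 = 0"
  by (simp add: grid_def)

lemma grid_nonneg: "0 < T \<Longrightarrow> 0 \<le> grid T N k"
  by (simp add: grid_def)

lemma grid_mono: "0 < T \<Longrightarrow> i \<le> j \<Longrightarrow> grid T N i \<le> grid T N j"
  by (simp add: grid_def divide_right_mono)

lemma grid_Suc: "grid T N (Suc k) = grid T N k + T / real N"
  by (simp add: grid_def distrib_right add_divide_distrib)

lemma obtain_grid_cell:
  assumes "0 < s" "s \<le> T" "0 < N"
  obtains k where "k < N" "grid T N k < s" "s \<le> grid T N (Suc k)"
proof -
  have T: "0 < T" using assms by simp
  define x where "x = s * N / T"
  have x: "0 < x" "x \<le> N" using assms T by (auto simp: x_def field_simps)
  \<comment> \<open>Cells are open on the left and closed on the right, so a grid point belongs to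
    the cell that ends there: ceiling minus one instead of a floor.\<close>
  define k where "k = nat (\<lceil>x\<rceil> - 1)"
  have c: "1 \<le> \<lceil>x\<rceil>" using x by (simp add: le_ceiling_iff)
  have rk: "real k = of_int \<lceil>x\<rceil> - 1" using c by (simp add: k_def)
  have lt: "real k < x" "x \<le> real k + 1" using ceiling_correct[of x] by (auto simp: rk)
  have "real k < real N" using lt x by linarith
  moreover have "grid T N k < s" "s \<le> grid T N (Suc k)"
    using lt T assms by (auto simp: grid_def x_def field_simps)
  ultimately show ?thesis using that[of k] by simp
qed

lemma elementary_process_grid:
  assumes "0 < T" "k < N" "grid T N k < s" "s \<le> grid T N (Suc k)"
  shows "elementary_process N (grid T N) \<xi> s \<omega> = \<xi> k \<omega>"
proof -
  have *: "indicator {grid T N j<..grid T N (Suc j)} s = (if j = k then 1 else 0 :: real)" for j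
  proof (cases j k rule: linorder_cases)
    case less
    then have "grid T N (Suc j) \<le> grid T N k" using assms by (intro grid_mono) auto
    then show ?thesis using less assms by auto
  next
    case greater
    then have "grid T N (Suc k) \<le> grid T N j" using assms by (intro grid_mono) auto
    then show ?thesis using greater assms by auto
  qed (use assms in auto)
  show ?thesis using assms(2) unfolding elementary_process_def * by (simp add: if_distrib cong: if_cong)
qed

context regime_switching
begin

text \<open>The chain is sampled at the right end of each cell, so that right-continuity alone gives
  convergence at every time.  The integrand is still adapted, because \<open>past s\<close> contains the whole chain.\<close>

definition sample :: "real \<Rightarrow> nat \<Rightarrow> (2 \<Rightarrow> real) \<Rightarrow> nat \<Rightarrow> 'a \<Rightarrow> real" where
  "sample T N g k \<omega> = g (\<Lambda> (grid T N (Suc k)) \<omega>)"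

lemma abs_le_sum_UNIV: "\<bar>g i\<bar> \<le> (\<Sum>j\<in>UNIV. \<bar>g j\<bar>)" for g :: "2 \<Rightarrow> real"
  by (rule member_le_sum) auto

lemma abs_sample_le: "\<bar>sample T N g k \<omega>\<bar> \<le> (\<Sum>j\<in>UNIV. \<bar>g j\<bar>)"
  unfolding sample_def by (rule abs_le_sum_UNIV)

lemma sample_past: "0 < T \<Longrightarrow> sample T N g k \<in> borel_measurable (past s)"
  unfolding sample_def using \<Lambda>_past[of "grid T N (Suc k)" s]
  by (rule measurable_compose) (auto simp: grid_nonneg)

lemma sample_measurable: "0 < T \<Longrightarrow> sample T N g k \<in> borel_measurable M"
  using sample_past by (rule measurable_past)

lemma elementary_sample: "0 < T \<Longrightarrow> elementary past N (grid T N) (sample T N g)"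
  unfolding elementary_def
  by (auto intro!: mono_onI grid_mono sample_past abs_sample_le simp: grid_nonneg)

text \<open>The right end of the cell containing \<open>s\<close> is at least \<open>s\<close> and
  less than \<open>s + T / N\<close>, hence eventually inside the interval after \<open>s\<close> on
  which the path is constant. The step process is then not merely close to the limit but equal to
  it.\<close>

lemma sample_tendsto:
  assumes "0 < s" "s \<le> T" "\<omega> \<in> space M"
  shows "(\<lambda>N. elementary_process N (grid T N) (sample T N g) s \<omega>) \<longlonglongrightarrow> g (\<Lambda> s \<omega>)"
proof (rule tendsto_eventually)
  have T: "0 < T" using assms by simp
  have "\<forall>\<^sub>F u in at_right s. \<Lambda> u \<omega> = \<Lambda> s \<omega>" using assms by (intro right_continuous) auto
  then obtain b where b: "s < b" "\<And>u. s < u \<Longrightarrow> u < b \<Longrightarrow> \<Lambda> u \<omega> = \<Lambda> s \<omega>"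
    unfolding eventually_at_right_field by auto
  have "(\<lambda>N. T / real N) \<longlonglongrightarrow> 0" by (rule lim_const_over_n)
  then have "\<forall>\<^sub>F N in sequentially. T / real N < b - s"
    using b(1) by (intro order_tendstoD(2)) auto
  with eventually_gt_at_top[of 0]
  show "\<forall>\<^sub>F N in sequentially. elementary_process N (grid T N) (sample T N g) s \<omega> = g (\<Lambda> s \<omega>)"
  proof eventually_elim
    case (elim N)
    from obtain_grid_cell[OF assms(1,2) elim(1)] obtain k
      where k: "k < N" "grid T N k < s" "s \<le> grid T N (Suc k)" .
    have "\<Lambda> (grid T N (Suc k)) \<omega> = \<Lambda> s \<omega>"
    proof (cases "grid T N (Suc k) = s")
      case False
      then show ?thesis using k elim b(1) by (intro b(2)) (auto simp: grid_Suc)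
    qed simp
    then show ?case by (simp add: elementary_process_grid[OF T k] sample_def)
  qed
qed

lemma abs_elementary_process_sample_le:
  assumes "0 < s" "s \<le> T"
  shows "\<bar>elementary_process N (grid T N) (sample T N g) s \<omega>\<bar> \<le> (\<Sum>j\<in>UNIV. \<bar>g j\<bar>)"
proof (cases "N = 0")
  case True
  then show ?thesis by (simp add: elementary_process_def sum_nonneg)
next
  case False
  then obtain k where k: "k < N" "grid T N k < s" "s \<le> grid T N (Suc k)"
    using obtain_grid_cell[OF assms] by auto
  have "0 < T" using assms by simp
  from elementary_process_grid[OF this k, of "sample T N g" \<omega>] show ?thesis by (simp add: abs_sample_le)
qed

text \<open>The approximations supplied by the definition of the integral are adapted to the natural
  filtration, the sampled sums only to \<open>past\<close>; this inclusion lets both meet in one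
  isometry.\<close>

lemma elementary_natural_past:
  assumes "elementary (natural_filtration M B \<Lambda>) n p \<xi>"
  shows "elementary past n p \<xi>"
proof -
  have le: "sets (natural_filtration M B \<Lambda> s) \<subseteq> sets (past s)" for s
    unfolding natural_filtration_def
    by (intro sets_process_sigma_le measurable_Pair B_past \<Lambda>_past) auto
  have sp: "space (natural_filtration M B \<Lambda> s) = space M" for s
    by (simp add: natural_filtration_def)
  have *: "f \<in> borel_measurable (past s)" if "f \<in> borel_measurable (natural_filtration M B \<Lambda> s)" for f :: "'a \<Rightarrow> real" and s
  proof (rule subsetD[OF measurable_mono that])
    show "sets (natural_filtration M B \<Lambda> s) \<subseteq> sets (past s)" by (rule le)
  qed (simp_all add: sp)
  show ?thesis using assms * unfolding elementary_def sp space_past by blast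
qed

lemma elementary_process_measurable:
  assumes "elementary past n p \<xi>"
  shows "(\<lambda>(\<omega>, s). elementary_process n p \<xi> s \<omega>) \<in> borel_measurable (M \<Otimes>\<^sub>M lborel)"
proof -
  have [measurable]: "\<xi> k \<in> borel_measurable M" if "k < n" for k
    using assms that measurable_past by (auto simp: elementary_def)
  show ?thesis unfolding elementary_process_def case_prod_beta
    by (intro borel_measurable_sum) measurable
qed

lemma elementary_integral_measurable:
  assumes "elementary past n p \<xi>" "0 \<le> t"
  shows "elementary_integral B n p \<xi> t \<in> borel_measurable M"
proof -
  have \<xi>: "\<xi> k \<in> borel_measurable M" if "k < n" for k
    using assms that measurable_past by (auto simp: elementary_def)
  have p: "0 \<le> p k" if "k \<le> n" for k
    using assms that mono_onD[of "{..n}" p 0 k] by (auto simp: elementary_def)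
  show ?thesis unfolding elementary_integral_def
    by (intro borel_measurable_sum borel_measurable_times \<xi> borel_measurable_diff measurable_B)
      (use assms(2) p in auto)
qed

lemma elementary_isometry:
  assumes E: "elementary past n p \<xi>" and E': "elementary past n' p' \<xi>'" and t: "0 \<le> t"
  shows "(\<integral>\<^sup>+\<omega>. ennreal ((elementary_integral B n p \<xi> t \<omega> - elementary_integral B n' p' \<xi>' t \<omega>)\<^sup>2) \<partial>M) =
    (\<integral>\<^sup>+\<omega>. (\<integral>\<^sup>+s. ennreal (((elementary_process n p \<xi> s \<omega> - elementary_process n' p' \<xi>' s \<omega>) *
       indicator {0<..t} s)\<^sup>2) \<partial>lborel) \<partial>M)"
proof -
  \<comment> \<open>The difference becomes a single family over the disjoint union of the index
    sets, the second half with negated coefficients.\<close>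
  let ?K = "{..<n} <+> {..<n'}"
  define q where "q = case_sum p p'"
  define q1 where "q1 = case_sum (\<lambda>k. p (Suc k)) (\<lambda>k. p' (Suc k))"
  define x where "x = case_sum \<xi> (\<lambda>k \<omega>. - \<xi>' k \<omega>)"
  define a where "a k = min t (q k)" for k
  define b where "b k = min t (q1 k)" for k
  \<comment> \<open>Truncation at \<open>t\<close> moves the start of a cell with
    \<open>q k > t\<close> down to \<open>t\<close>, where \<open>x k\<close> need not be
    measurable. Such a cell has become empty, so setting its coefficient to zero restores
    measurability and changes neither sum.\<close>
  define \<zeta> where "\<zeta> k \<omega> = (if q k \<le> t then x k \<omega> else 0)" for k \<omega>
  have p: "0 \<le> p k" "k < n \<Longrightarrow> p k \<le> p (Suc k)" if "k \<le> n" for k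
    using E that mono_onD[of "{..n}" p 0 k] mono_onD[of "{..n}" p k "Suc k"]
    by (auto simp: elementary_def)
  have p': "0 \<le> p' k" "k < n' \<Longrightarrow> p' k \<le> p' (Suc k)" if "k \<le> n'" for k
    using E' that mono_onD[of "{..n'}" p' 0 k] mono_onD[of "{..n'}" p' k "Suc k"]
    by (auto simp: elementary_def)
  have q: "0 \<le> q k \<and> q k \<le> q1 k" if "k \<in> ?K" for k
    using that p p' by (auto simp: q_def q1_def)
  have xm: "x k \<in> borel_measurable (past (q k))" if "k \<in> ?K" for k
    using that E E' by (auto simp: x_def q_def elementary_def)
  have xb: "\<exists>C. \<forall>\<omega>\<in>space M. \<bar>x k \<omega>\<bar> \<le> C" if "k \<in> ?K" for k
    using that E E' by (auto simp: x_def elementary_def)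
  from xb obtain C where C: "\<And>k \<omega>. k \<in> ?K \<Longrightarrow> \<omega> \<in> space M \<Longrightarrow> \<bar>x k \<omega>\<bar> \<le> C k"
    by metis
  have \<zeta>m: "\<zeta> k \<in> borel_measurable (past (a k))" if "k \<in> ?K" for k
  proof -
    have "\<zeta> k = (if q k \<le> t then x k else (\<lambda>_. 0))" by (auto simp: \<zeta>_def)
    then show ?thesis using xm[OF that] by (auto simp: a_def min_def)
  qed
  have \<zeta>b: "\<bar>\<zeta> k \<omega>\<bar> \<le> \<bar>C k\<bar>" if "k \<in> ?K" "\<omega> \<in> space M" for k \<omega>
    using C[OF that] by (auto simp: \<zeta>_def)
  have "(\<Sum>k\<in>?K. \<zeta> k \<omega> * (B (b k) \<omega> - B (a k) \<omega>)) = (\<Sum>k\<in>?K. x k \<omega> * (B (b k) \<omega> - B (a k) \<omega>))" for \<omega>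
  proof (rule sum.cong[OF refl])
    fix k assume "k \<in> ?K"
    with q[OF this] show "\<zeta> k \<omega> * (B (b k) \<omega> - B (a k) \<omega>) = x k \<omega> * (B (b k) \<omega> - B (a k) \<omega>)"
      by (auto simp: \<zeta>_def a_def b_def)
  qed
  then have 1: "(\<Sum>k\<in>?K. \<zeta> k \<omega> * (B (b k) \<omega> - B (a k) \<omega>)) =
      elementary_integral B n p \<xi> t \<omega> - elementary_integral B n' p' \<xi>' t \<omega>" for \<omega>
    by (simp add: sum.Plus elementary_integral_def x_def a_def b_def q_def q1_def sum_negf)
  have "(\<Sum>k\<in>?K. \<zeta> k \<omega> * indicator {a k<..b k} s) =
      (\<Sum>k\<in>?K. x k \<omega> * indicator {q k<..q1 k} s) * indicator {0<..t} s" for \<omega> s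
    unfolding sum_distrib_right
  proof (rule sum.cong[OF refl])
    fix k assume "k \<in> ?K"
    with q[OF this] show "\<zeta> k \<omega> * indicator {a k<..b k} s = x k \<omega> * indicator {q k<..q1 k} s * indicator {0<..t} s"
      by (auto simp: \<zeta>_def a_def b_def indicator_def)
  qed
  then have 2: "(\<Sum>k\<in>?K. \<zeta> k \<omega> * indicator {a k<..b k} s) =
      (elementary_process n p \<xi> s \<omega> - elementary_process n' p' \<xi>' s \<omega>) * indicator {0<..t} s" for \<omega> s
    by (simp only: sum.Plus finite_lessThan elementary_process_def x_def q_def q1_def sum.case o_def
        mult_minus_left sum_negf add_uminus_conv_diff)
  have "(\<integral>\<^sup>+\<omega>. ennreal ((\<Sum>k\<in>?K. \<zeta> k \<omega> * (B (b k) \<omega> - B (a k) \<omega>))\<^sup>2) \<partial>M) =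
    (\<integral>\<^sup>+\<omega>. (\<integral>\<^sup>+s. ennreal ((\<Sum>k\<in>?K. \<zeta> k \<omega> * indicator {a k<..b k} s)\<^sup>2) \<partial>lborel) \<partial>M)"
  proof (rule isometry[where C="\<lambda>k. \<bar>C k\<bar>"])
    fix k assume "k \<in> ?K"
    with q[OF this] t show "0 \<le> a k" "a k \<le> b k" by (auto simp: a_def b_def)
  qed (use \<zeta>m \<zeta>b in auto)
  then show ?thesis unfolding 1 2 .
qed

text \<open>The sampled step processes are jointly measurable, and right-continuity makes them
  converge at every point of \<open>{0<..t}\<close>.\<close>

lemma integrand_measurable:
  fixes g :: "2 \<Rightarrow> real"
  assumes "0 < t"
  shows "(\<lambda>(\<omega>, s). g (\<Lambda> s \<omega>) * indicator {0<..t} s) \<in> borel_measurable (M \<Otimes>\<^sub>M lborel)"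
proof -
  let ?u = "\<lambda>N (\<omega>, s). elementary_process N (grid t N) (sample t N g) s \<omega> * indicator {0<..t} s"
  have 1: "(\<lambda>N. ?u N z) \<longlonglongrightarrow> (case z of (\<omega>, s) \<Rightarrow> g (\<Lambda> s \<omega>) * indicator {0<..t} s)"
    if "z \<in> space (M \<Otimes>\<^sub>M lborel)" for z
    using that sample_tendsto[of "snd z" t "fst z" g]
    by (cases z) (auto simp: space_pair_measure indicator_def)
  have "(\<lambda>z. (\<lambda>(\<omega>, s). elementary_process N (grid t N) (sample t N g) s \<omega>) z * indicator {0<..t} (snd z))
      \<in> borel_measurable (M \<Otimes>\<^sub>M lborel)" for N
    by (intro borel_measurable_times elementary_process_measurable elementary_sample assms) measurable
  then have 2: "?u N \<in> borel_measurable (M \<Otimes>\<^sub>M lborel)" for N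
    by (simp add: case_prod_beta)
  show ?thesis by (rule borel_measurable_LIMSEQ_real[OF 1 2])
qed

lemma elementary_process_indicator_measurable:
  assumes "elementary past n p \<xi>"
  shows "(\<lambda>(\<omega>, s). elementary_process n p \<xi> s \<omega> * indicator {0<..t::real} s) \<in> borel_measurable (M \<Otimes>\<^sub>M lborel)"
proof -
  have "(\<lambda>z. (\<lambda>(\<omega>, s). elementary_process n p \<xi> s \<omega>) z * indicator {0<..t} (snd z))
      \<in> borel_measurable (M \<Otimes>\<^sub>M lborel)"
    by (intro borel_measurable_times elementary_process_measurable assms) measurable
  then show ?thesis by (simp add: case_prod_beta)
qed

lemma integrand_section_measurable:
  fixes g :: "2 \<Rightarrow> real"
  assumes "\<omega> \<in> space M"
  shows "(\<lambda>s. g (\<Lambda> s \<omega>) * indicator {0<..t} s) \<in> borel_measurable lborel"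
proof (cases "0 < t")
  case True
  show ?thesis using measurable_compose[OF measurable_Pair1'[OF assms] integrand_measurable[OF True, of g]] by simp
next
  case False
  then have "(\<lambda>s. g (\<Lambda> s \<omega>) * indicator {0<..t} s) = (\<lambda>s. 0)" by (auto simp: indicator_def)
  then show ?thesis by simp
qed

lemma nn_integral_square_add_le2:
  fixes u v :: "'a \<Rightarrow> real \<Rightarrow> real"
  assumes u: "(\<lambda>(\<omega>, s). u \<omega> s) \<in> borel_measurable (M \<Otimes>\<^sub>M lborel)"
    and v: "(\<lambda>(\<omega>, s). v \<omega> s) \<in> borel_measurable (M \<Otimes>\<^sub>M lborel)"
  shows "(\<integral>\<^sup>+\<omega>. (\<integral>\<^sup>+s. ennreal ((u \<omega> s + v \<omega> s)\<^sup>2) \<partial>lborel) \<partial>M) \<le>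
    2 * (\<integral>\<^sup>+\<omega>. (\<integral>\<^sup>+s. ennreal ((u \<omega> s)\<^sup>2) \<partial>lborel) \<partial>M) +
    2 * (\<integral>\<^sup>+\<omega>. (\<integral>\<^sup>+s. ennreal ((v \<omega> s)\<^sup>2) \<partial>lborel) \<partial>M)"
proof -
  have sec: "u \<omega> \<in> borel_measurable lborel" "v \<omega> \<in> borel_measurable lborel" if "\<omega> \<in> space M" for \<omega>
    using measurable_compose[OF measurable_Pair1'[OF that] u] measurable_compose[OF measurable_Pair1'[OF that] v] by auto
  have out: "(\<lambda>\<omega>. \<integral>\<^sup>+s. ennreal ((u \<omega> s)\<^sup>2) \<partial>lborel) \<in> borel_measurable M"
    "(\<lambda>\<omega>. \<integral>\<^sup>+s. ennreal ((v \<omega> s)\<^sup>2) \<partial>lborel) \<in> borel_measurable M"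
    using u v by (auto intro!: lborel.borel_measurable_nn_integral simp: case_prod_beta')
  have "(\<integral>\<^sup>+\<omega>. (\<integral>\<^sup>+s. ennreal ((u \<omega> s + v \<omega> s)\<^sup>2) \<partial>lborel) \<partial>M) \<le>
    (\<integral>\<^sup>+\<omega>. 2 * (\<integral>\<^sup>+s. ennreal ((u \<omega> s)\<^sup>2) \<partial>lborel) + 2 * (\<integral>\<^sup>+s. ennreal ((v \<omega> s)\<^sup>2) \<partial>lborel) \<partial>M)"
    by (intro nn_integral_mono nn_integral_square_add_le sec)
  also have "\<dots> = 2 * (\<integral>\<^sup>+\<omega>. (\<integral>\<^sup>+s. ennreal ((u \<omega> s)\<^sup>2) \<partial>lborel) \<partial>M) +
    2 * (\<integral>\<^sup>+\<omega>. (\<integral>\<^sup>+s. ennreal ((v \<omega> s)\<^sup>2) \<partial>lborel) \<partial>M)"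
    using out by (simp add: nn_integral_add nn_integral_cmult)
  finally show ?thesis .
qed

text \<open>Between \<open>J t\<close> and the given elementary integral stands the approximating
  integral \<open>I m\<close> of the definition. The isometry turns its distance to the given one
  into a distance of integrands, which is split once more at
  \<open>g (\<Lambda> s \<omega>)\<close>. As \<open>m\<close> grows only the last term survives;
  the 4 is the factor 2 of the two splittings.\<close>

lemma ito_integral_approx_le:
  assumes ito: "ito_integral M (natural_filtration M B \<Lambda>) B (\<lambda>s \<omega>. g (\<Lambda> s \<omega>)) J"
    and t: "0 < t" and E: "elementary past n p \<xi>"
  shows "(\<integral>\<^sup>+\<omega>. ennreal ((J t \<omega> - elementary_integral B n p \<xi> t \<omega>)\<^sup>2) \<partial>M) \<le>
    4 * (\<integral>\<^sup>+\<omega>. (\<integral>\<^sup>+s. ennreal (((g (\<Lambda> s \<omega>) - elementary_process n p \<xi> s \<omega>) * indicator {0<..t} s)\<^sup>2) \<partial>lborel) \<partial>M)"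
    (is "?X \<le> 4 * ?D")
proof -
  from t have t': "0 \<le> t" by simp
  have Jm: "J t \<in> borel_measurable M" using ito t' by (simp add: ito_integral_def)
  from ito t' obtain n' p' \<xi>' where
    El: "\<And>m::nat. elementary (natural_filtration M B \<Lambda>) (n' m) (p' m) (\<xi>' m)" and
    A: "(\<lambda>m. \<integral>\<^sup>+\<omega>. (\<integral>\<^sup>+s\<in>{0..t}. ennreal ((g (\<Lambda> s \<omega>) - elementary_process (n' m) (p' m) (\<xi>' m) s \<omega>)\<^sup>2) \<partial>lborel) \<partial>M)
          \<longlonglongrightarrow> 0" and
    J: "(\<lambda>m. \<integral>\<^sup>+\<omega>. ennreal ((J t \<omega> - elementary_integral B (n' m) (p' m) (\<xi>' m) t \<omega>)\<^sup>2) \<partial>M) \<longlonglongrightarrow> 0"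
    unfolding ito_integral_def by blast
  define I where "I m = elementary_integral B (n' m) (p' m) (\<xi>' m) t" for m
  define e where "e m \<omega> s = elementary_process (n' m) (p' m) (\<xi>' m) s \<omega> * indicator {0<..t} s" for m \<omega> s
  define e0 where "e0 \<omega> s = elementary_process n p \<xi> s \<omega> * indicator {0<..t} s" for \<omega> s
  define H where "H \<omega> s = g (\<Lambda> s \<omega>) * indicator {0<..t} s" for \<omega> s
  let ?A = "\<lambda>m. \<integral>\<^sup>+\<omega>. (\<integral>\<^sup>+s. ennreal ((H \<omega> s - e m \<omega> s)\<^sup>2) \<partial>lborel) \<partial>M"
  let ?J = "\<lambda>m. \<integral>\<^sup>+\<omega>. ennreal ((J t \<omega> - I m \<omega>)\<^sup>2) \<partial>M"
  have Em: "elementary past (n' m) (p' m) (\<xi>' m)" for m by (rule elementary_natural_past[OF El])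
  have em: "(\<lambda>(\<omega>, s). e m \<omega> s) \<in> borel_measurable (M \<Otimes>\<^sub>M lborel)" for m
    unfolding e_def by (rule elementary_process_indicator_measurable[OF Em])
  have e0: "(\<lambda>(\<omega>, s). e0 \<omega> s) \<in> borel_measurable (M \<Otimes>\<^sub>M lborel)"
    unfolding e0_def by (rule elementary_process_indicator_measurable[OF E])
  have Hm: "(\<lambda>(\<omega>, s). H \<omega> s) \<in> borel_measurable (M \<Otimes>\<^sub>M lborel)"
    unfolding H_def by (rule integrand_measurable[OF t])
  have Im: "I m \<in> borel_measurable M" for m
    unfolding I_def by (rule elementary_integral_measurable[OF Em t'])
  have I0: "elementary_integral B n p \<xi> t \<in> borel_measurable M"
    by (rule elementary_integral_measurable[OF E t'])
  have D: "?D = (\<integral>\<^sup>+\<omega>. (\<integral>\<^sup>+s. ennreal ((H \<omega> s - e0 \<omega> s)\<^sup>2) \<partial>lborel) \<partial>M)"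
    by (simp add: H_def e0_def left_diff_distrib)
  have A': "?A \<longlonglongrightarrow> 0"
    using A unfolding nn_integral_lborel_Ioc by (simp add: H_def e_def left_diff_distrib)
  have "?X \<le> 2 * ?J m + 2 * (2 * ?A m + 2 * ?D)" for m
  proof -
    have "?X = (\<integral>\<^sup>+\<omega>. ennreal (((J t \<omega> - I m \<omega>) + (I m \<omega> - elementary_integral B n p \<xi> t \<omega>))\<^sup>2) \<partial>M)"
      by simp
    also have "\<dots> \<le> 2 * ?J m + 2 * (\<integral>\<^sup>+\<omega>. ennreal ((I m \<omega> - elementary_integral B n p \<xi> t \<omega>)\<^sup>2) \<partial>M)"
      using Jm Im I0 by (intro nn_integral_square_add_le) auto
    also have "(\<integral>\<^sup>+\<omega>. ennreal ((I m \<omega> - elementary_integral B n p \<xi> t \<omega>)\<^sup>2) \<partial>M) =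
        (\<integral>\<^sup>+\<omega>. (\<integral>\<^sup>+s. ennreal ((e m \<omega> s - e0 \<omega> s)\<^sup>2) \<partial>lborel) \<partial>M)"
      unfolding I_def elementary_isometry[OF Em E t'] by (simp add: e_def e0_def left_diff_distrib)
    also have "\<dots> = (\<integral>\<^sup>+\<omega>. (\<integral>\<^sup>+s. ennreal (((e m \<omega> s - H \<omega> s) + (H \<omega> s - e0 \<omega> s))\<^sup>2) \<partial>lborel) \<partial>M)"
      by simp
    also have "\<dots> \<le> 2 * (\<integral>\<^sup>+\<omega>. (\<integral>\<^sup>+s. ennreal ((e m \<omega> s - H \<omega> s)\<^sup>2) \<partial>lborel) \<partial>M) + 2 * ?D"
      unfolding D using em e0 Hm by (intro nn_integral_square_add_le2) (auto simp: case_prod_beta')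
    also have "(\<integral>\<^sup>+\<omega>. (\<integral>\<^sup>+s. ennreal ((e m \<omega> s - H \<omega> s)\<^sup>2) \<partial>lborel) \<partial>M) = ?A m"
      by (simp add: power2_commute)
    finally show ?thesis by (simp add: mult_left_mono add_left_mono)
  qed
  moreover have "(\<lambda>m. 2 * ?J m + 2 * (2 * ?A m + 2 * ?D)) \<longlonglongrightarrow> 2 * 0 + 2 * (2 * 0 + 2 * ?D)"
    using J unfolding I_def[symmetric]
    by (intro tendsto_add ennreal_tendsto_cmult A' tendsto_const) auto
  ultimately have "?X \<le> 2 * 0 + 2 * (2 * 0 + 2 * ?D)"
    by (intro LIMSEQ_le_const) auto
  then show ?thesis by (simp add: mult.assoc[symmetric])
qed

text \<open>Dominated convergence in \<open>s\<close> and then in the sample point. The domination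
  is free because \<open>g\<close> takes two values: the sum \<open>C\<close> of their absolute
  values bounds both the process and its samples.\<close>

lemma sample_L2_tendsto:
  assumes "0 < t" "t \<le> T"
  shows "(\<lambda>N. \<integral>\<^sup>+\<omega>. (\<integral>\<^sup>+s. ennreal (((g (\<Lambda> s \<omega>) - elementary_process N (grid T N) (sample T N g) s \<omega>) *
    indicator {0<..t} s)\<^sup>2) \<partial>lborel) \<partial>M) \<longlonglongrightarrow> 0"
proof -
  have T: "0 < T" using assms by simp
  define C where "C = (\<Sum>j\<in>UNIV. \<bar>g j\<bar>)"
  have C0: "0 \<le> C" by (simp add: C_def sum_nonneg)
  let ?u = "\<lambda>N \<omega> s. (g (\<Lambda> s \<omega>) - elementary_process N (grid T N) (sample T N g) s \<omega>) * indicator {0<..t} s"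
  have um: "(\<lambda>(\<omega>, s). ?u N \<omega> s) \<in> borel_measurable (M \<Otimes>\<^sub>M lborel)" for N
  proof -
    have "(\<lambda>(\<omega>, s). elementary_process N (grid T N) (sample T N g) s \<omega> * indicator {0<..t} s)
        \<in> borel_measurable (M \<Otimes>\<^sub>M lborel)"
      by (rule elementary_process_indicator_measurable[OF elementary_sample[OF T]])
    from borel_measurable_diff[OF integrand_measurable[OF assms(1), of g] this] show ?thesis
      by (simp add: case_prod_beta' left_diff_distrib)
  qed
  have sec: "?u N \<omega> \<in> borel_measurable lborel" if "\<omega> \<in> space M" for N \<omega>
    using measurable_compose[OF measurable_Pair1'[OF that] um] by simp
  have bd: "ennreal ((?u N \<omega> s)\<^sup>2) \<le> ennreal ((2 * C)\<^sup>2) * indicator {0<..t} s" for N \<omega> s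
  proof (cases "s \<in> {0<..t}")
    case True
    have "\<bar>g (\<Lambda> s \<omega>)\<bar> \<le> C" unfolding C_def by (rule abs_le_sum_UNIV)
    moreover have "\<bar>elementary_process N (grid T N) (sample T N g) s \<omega>\<bar> \<le> C"
      unfolding C_def using True assms by (intro abs_elementary_process_sample_le) auto
    ultimately have "\<bar>?u N \<omega> s\<bar> \<le> 2 * C" using True by auto
    then have "(?u N \<omega> s)\<^sup>2 \<le> (2 * C)\<^sup>2" using C0 by (intro abs_le_square_iff[THEN iffD1]) auto
    then show ?thesis using True by (auto intro: ennreal_leI)
  qed auto
  have fin: "(\<integral>\<^sup>+s. ennreal ((2 * C)\<^sup>2) * indicator {0<..t} s \<partial>lborel) = ennreal ((2 * C)\<^sup>2 * t)"
    using assms by (simp add: nn_integral_cmult ennreal_mult)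
  have inner: "(\<lambda>N. \<integral>\<^sup>+s. ennreal ((?u N \<omega> s)\<^sup>2) \<partial>lborel) \<longlonglongrightarrow> 0" if \<omega>: "\<omega> \<in> space M" for \<omega>
  proof -
    have "(\<lambda>N. \<integral>\<^sup>+s. ennreal ((?u N \<omega> s)\<^sup>2) \<partial>lborel) \<longlonglongrightarrow> (\<integral>\<^sup>+s. 0 \<partial>(lborel :: real measure))"
    proof (rule nn_integral_dominated_convergence[where w="\<lambda>s. ennreal ((2 * C)\<^sup>2) * indicator {0<..t} s"])
      show "(\<lambda>s. ennreal ((?u N \<omega> s)\<^sup>2)) \<in> borel_measurable lborel" for N
        using sec[OF \<omega>, of N] by measurable
      show "AE s in lborel. ennreal ((?u N \<omega> s)\<^sup>2) \<le> ennreal ((2 * C)\<^sup>2) * indicator {0<..t} s" for N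
        using bd by (intro AE_I2)
      show "(\<integral>\<^sup>+s. ennreal ((2 * C)\<^sup>2) * indicator {0<..t} s \<partial>lborel) < \<infinity>" unfolding fin by simp
      show "AE s in lborel. (\<lambda>N. ennreal ((?u N \<omega> s)\<^sup>2)) \<longlonglongrightarrow> 0"
      proof (rule AE_I2)
        fix s :: real
        have "(\<lambda>N. (?u N \<omega> s)\<^sup>2) \<longlonglongrightarrow> 0"
        proof (cases "s \<in> {0<..t}")
          case True
          then have "(\<lambda>N. (?u N \<omega> s)\<^sup>2) \<longlonglongrightarrow> ((g (\<Lambda> s \<omega>) - g (\<Lambda> s \<omega>)) * indicator {0<..t} s)\<^sup>2"
            using \<omega> assms by (intro tendsto_intros sample_tendsto) auto
          then show ?thesis by simp
        qed simp
        then show "(\<lambda>N. ennreal ((?u N \<omega> s)\<^sup>2)) \<longlonglongrightarrow> 0"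
          using tendsto_ennrealI by fastforce
      qed
    qed auto
    then show ?thesis by simp
  qed
  have "(\<lambda>N. \<integral>\<^sup>+\<omega>. (\<integral>\<^sup>+s. ennreal ((?u N \<omega> s)\<^sup>2) \<partial>lborel) \<partial>M) \<longlonglongrightarrow> (\<integral>\<^sup>+\<omega>. 0 \<partial>M)"
  proof (rule nn_integral_dominated_convergence[where w="\<lambda>\<omega>. ennreal ((2 * C)\<^sup>2 * t)"])
    show "(\<lambda>\<omega>. \<integral>\<^sup>+s. ennreal ((?u N \<omega> s)\<^sup>2) \<partial>lborel) \<in> borel_measurable M" for N
      using um[of N] by (intro lborel.borel_measurable_nn_integral) (simp add: case_prod_beta')
    show "AE \<omega> in M. (\<integral>\<^sup>+s. ennreal ((?u N \<omega> s)\<^sup>2) \<partial>lborel) \<le> ennreal ((2 * C)\<^sup>2 * t)" for N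
      unfolding fin[symmetric] by (intro AE_I2 nn_integral_mono bd)
    show "AE \<omega> in M. (\<lambda>N. \<integral>\<^sup>+s. ennreal ((?u N \<omega> s)\<^sup>2) \<partial>lborel) \<longlonglongrightarrow> 0"
      using inner by (rule AE_I2)
    show "(\<integral>\<^sup>+\<omega>. ennreal ((2 * C)\<^sup>2 * t) \<partial>M) < \<infinity>"
      by (simp add: emeasure_space_1 ennreal_mult_less_top)
  qed auto
  then show ?thesis by simp
qed

lemma ito_integral_tendsto:
  assumes "ito_integral M (natural_filtration M B \<Lambda>) B (\<lambda>s \<omega>. g (\<Lambda> s \<omega>)) J" "0 < t" "t \<le> T"
  shows "(\<lambda>N. \<integral>\<^sup>+\<omega>. ennreal ((J t \<omega> - elementary_integral B N (grid T N) (sample T N g) t \<omega>)\<^sup>2) \<partial>M) \<longlonglongrightarrow> 0"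
proof (rule tendsto_sandwich[OF _ _ tendsto_const])
  have T: "0 < T" using assms by simp
  let ?D = "\<lambda>N. \<integral>\<^sup>+\<omega>. (\<integral>\<^sup>+s. ennreal (((g (\<Lambda> s \<omega>) - elementary_process N (grid T N) (sample T N g) s \<omega>) *
    indicator {0<..t} s)\<^sup>2) \<partial>lborel) \<partial>M"
  show "\<forall>\<^sub>F N in sequentially. (\<integral>\<^sup>+\<omega>. ennreal ((J t \<omega> - elementary_integral B N (grid T N) (sample T N g) t \<omega>)\<^sup>2) \<partial>M)
    \<le> 4 * ?D N"
    by (intro always_eventually allI ito_integral_approx_le[OF assms(1,2)] elementary_sample T)
  show "(\<lambda>N. 4 * ?D N) \<longlonglongrightarrow> 0"
    using ennreal_tendsto_cmult[OF _ sample_L2_tendsto[OF assms(2,3)], of 4 g] by simp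
qed auto

text \<open>At time 0 both ends of every truncated increment are 0. The definition fixes the initial
  value of \<open>J\<close> only through an L2 limit, hence only almost surely; it is needed for the
  start above the barrier.\<close>

lemma ito_integral_0:
  assumes "ito_integral M (natural_filtration M B \<Lambda>) B (\<lambda>s \<omega>. g (\<Lambda> s \<omega>)) J"
  shows "AE \<omega> in M. J 0 \<omega> = 0"
proof -
  have [measurable]: "J 0 \<in> borel_measurable M" using assms by (simp add: ito_integral_def)
  from assms obtain n p \<xi> where E: "\<And>m::nat. elementary (natural_filtration M B \<Lambda>) (n m) (p m) (\<xi> m)"
    and "(\<lambda>m. \<integral>\<^sup>+\<omega>. ennreal ((J 0 \<omega> - elementary_integral B (n m) (p m) (\<xi> m) 0 \<omega>)\<^sup>2) \<partial>M) \<longlonglongrightarrow> 0"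
    unfolding ito_integral_def by (meson order_refl)
  moreover have "elementary_integral B (n m) (p m) (\<xi> m) 0 \<omega> = 0" for m \<omega>
  proof -
    have "0 \<le> p m k" if "k \<le> n m" for k
      using E[of m] that mono_onD[of "{..n m}" "p m" 0 k] by (auto simp: elementary_def)
    then show ?thesis by (simp add: elementary_integral_def)
  qed
  ultimately have "(\<lambda>m::nat. \<integral>\<^sup>+\<omega>. ennreal ((J 0 \<omega>)\<^sup>2) \<partial>M) \<longlonglongrightarrow> 0" by simp
  then have "(\<integral>\<^sup>+\<omega>. ennreal ((J 0 \<omega>)\<^sup>2) \<partial>M) = 0" using LIMSEQ_unique tendsto_const by blast
  then have "AE \<omega> in M. ennreal ((J 0 \<omega>)\<^sup>2) = 0" by (subst (asm) nn_integral_0_iff_AE) auto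
  then show ?thesis by eventually_elim simp
qed

text \<open>Both versions are L2 limits of the same sampled sums, since these do not refer to the
  approximating sequence that a version brings along.\<close>

lemma ito_integral_unique:
  assumes J: "ito_integral M (natural_filtration M B \<Lambda>) B (\<lambda>s \<omega>. g (\<Lambda> s \<omega>)) J"
    and J': "ito_integral M (natural_filtration M B \<Lambda>) B (\<lambda>s \<omega>. g (\<Lambda> s \<omega>)) J'"
    and t: "0 < t"
  shows "AE \<omega> in M. J t \<omega> = J' t \<omega>"
proof -
  have [measurable]: "J t \<in> borel_measurable M" "J' t \<in> borel_measurable M"
    using J J' t by (auto simp: ito_integral_def)
  let ?I = "\<lambda>N. elementary_integral B N (grid t N) (sample t N g) t"
  have [measurable]: "?I N \<in> borel_measurable M" for N
    using t by (intro elementary_integral_measurable elementary_sample) auto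
  let ?X = "\<integral>\<^sup>+\<omega>. ennreal ((J t \<omega> - J' t \<omega>)\<^sup>2) \<partial>M"
  let ?Y = "\<lambda>N. 2 * (\<integral>\<^sup>+\<omega>. ennreal ((J t \<omega> - ?I N \<omega>)\<^sup>2) \<partial>M) + 2 * (\<integral>\<^sup>+\<omega>. ennreal ((J' t \<omega> - ?I N \<omega>)\<^sup>2) \<partial>M)"
  have "?X \<le> ?Y N" for N
  proof -
    have "?X = (\<integral>\<^sup>+\<omega>. ennreal (((J t \<omega> - ?I N \<omega>) + (?I N \<omega> - J' t \<omega>))\<^sup>2) \<partial>M)" by simp
    also have "\<dots> \<le> 2 * (\<integral>\<^sup>+\<omega>. ennreal ((J t \<omega> - ?I N \<omega>)\<^sup>2) \<partial>M) + 2 * (\<integral>\<^sup>+\<omega>. ennreal ((?I N \<omega> - J' t \<omega>)\<^sup>2) \<partial>M)"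
      by (rule nn_integral_square_add_le) auto
    finally show ?thesis by (simp add: power2_commute)
  qed
  moreover have "?Y \<longlonglongrightarrow> 2 * 0 + 2 * 0"
    using J J' t by (intro tendsto_add ennreal_tendsto_cmult ito_integral_tendsto) auto
  ultimately have "?X \<le> 2 * 0 + 2 * 0" by (intro LIMSEQ_le_const) auto
  then have "?X = 0" by simp
  then have "AE \<omega> in M. ennreal ((J t \<omega> - J' t \<omega>)\<^sup>2) = 0" by (subst (asm) nn_integral_0_iff_AE) auto
  then show ?thesis by eventually_elim simp
qed

text \<open>Markov's inequality for the squared error, whence the factor
  \<open>1 / e\<^sup>2\<close>.\<close>

lemma ito_integral_tendsto_prob:
  assumes ito: "ito_integral M (natural_filtration M B \<Lambda>) B (\<lambda>s \<omega>. g (\<Lambda> s \<omega>)) J"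
    and t: "0 < t" "t \<le> T" and e: "0 < e"
  shows "(\<lambda>N. prob {\<omega>\<in>space M. e \<le> \<bar>J t \<omega> - elementary_integral B N (grid T N) (sample T N g) t \<omega>\<bar>}) \<longlonglongrightarrow> 0"
proof -
  have T: "0 < T" using t by simp
  let ?I = "\<lambda>N. elementary_integral B N (grid T N) (sample T N g) t"
  let ?S = "\<lambda>N. \<integral>\<^sup>+\<omega>. ennreal ((J t \<omega> - ?I N \<omega>)\<^sup>2) \<partial>M"
  have [measurable]: "J t \<in> borel_measurable M" "?I N \<in> borel_measurable M" for N
    using ito t T elementary_integral_measurable[OF elementary_sample[OF T], of t]
    by (auto simp: ito_integral_def)
  have 1: "emeasure M {\<omega>\<in>space M. e \<le> \<bar>J t \<omega> - ?I N \<omega>\<bar>} \<le> ennreal (1 / e\<^sup>2) * ?S N" for N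
  proof -
    have "emeasure M {\<omega>\<in>space M. e \<le> \<bar>J t \<omega> - ?I N \<omega>\<bar>} \<le>
        emeasure M {\<omega>\<in>space M. 1 \<le> ennreal (1 / e\<^sup>2) * ennreal ((J t \<omega> - ?I N \<omega>)\<^sup>2)}"
    proof (intro emeasure_mono subsetI CollectI conjI; (elim CollectE conjE)?)
      fix \<omega> assume le: "e \<le> \<bar>J t \<omega> - ?I N \<omega>\<bar>"
      then have "e\<^sup>2 \<le> (J t \<omega> - ?I N \<omega>)\<^sup>2" using e by (intro abs_le_square_iff[THEN iffD1]) auto
      then have "1 \<le> 1 / e\<^sup>2 * (J t \<omega> - ?I N \<omega>)\<^sup>2" using e by (simp add: field_simps)
      then have "ennreal 1 \<le> ennreal (1 / e\<^sup>2 * (J t \<omega> - ?I N \<omega>)\<^sup>2)" by (rule ennreal_leI)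
      then show "1 \<le> ennreal (1 / e\<^sup>2) * ennreal ((J t \<omega> - ?I N \<omega>)\<^sup>2)"
        by (simp only: ennreal_1 ennreal_mult zero_le_power2 zero_le_divide_1_iff)
    qed (use sets.sets_into_space in auto)
    also have "\<dots> \<le> ennreal (1 / e\<^sup>2) * ?S N"
      using nn_integral_Markov_inequality[of "\<lambda>\<omega>. ennreal ((J t \<omega> - ?I N \<omega>)\<^sup>2)"  "space M" M "ennreal (1 / e\<^sup>2)"]
      by (simp cong: nn_integral_cong)
    finally show ?thesis .
  qed
  have 2: "(\<lambda>N. ennreal (1 / e\<^sup>2) * ?S N) \<longlonglongrightarrow> 0"
    using ennreal_tendsto_cmult[OF _ ito_integral_tendsto[OF ito t], of "ennreal (1 / e\<^sup>2)"] by simp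
  have "(\<lambda>N. emeasure M {\<omega>\<in>space M. e \<le> \<bar>J t \<omega> - ?I N \<omega>\<bar>}) \<longlonglongrightarrow> 0"
  proof (rule tendsto_sandwich[OF _ _ tendsto_const 2])
    show "\<forall>\<^sub>F N in sequentially. emeasure M {\<omega>\<in>space M. e \<le> \<bar>J t \<omega> - ?I N \<omega>\<bar>} \<le> ennreal (1 / e\<^sup>2) * ?S N"
      by (rule always_eventually, rule allI, rule 1)
  qed simp
  then have "(\<lambda>N. enn2real (emeasure M {\<omega>\<in>space M. e \<le> \<bar>J t \<omega> - ?I N \<omega>\<bar>})) \<longlonglongrightarrow> enn2real 0"
    by (intro tendsto_enn2real) auto
  then show ?thesis by (simp add: measure_def)
qed

section \<open>Ordinary time integrals along the chain\<close>

lemma set_integrable_chain: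
  fixes g :: "2 \<Rightarrow> real"
  assumes "\<omega> \<in> space M"
  shows "set_integrable lborel {0..t} (\<lambda>s. g (\<Lambda> s \<omega>))"
proof -
  have m: "(\<lambda>s. g (\<Lambda> s \<omega>) * indicator {0<..t} s) \<in> borel_measurable borel"
    using integrand_section_measurable[OF assms, of g t] by simp
  \<comment> \<open>Measurability of the path is known on \<open>{0<..t}\<close> only; the value at
    the remaining point 0 is added by hand.\<close>
  have "(\<lambda>s. g (\<Lambda> s \<omega>) * indicator {0<..t} s + (if s = 0 \<and> 0 \<le> t then g (\<Lambda> 0 \<omega>) else 0)) \<in> borel_measurable borel"
    using m by measurable
  also have "(\<lambda>s. g (\<Lambda> s \<omega>) * indicator {0<..t} s + (if s = 0 \<and> 0 \<le> t then g (\<Lambda> 0 \<omega>) else 0)) =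
      (\<lambda>s. indicator {0..t} s *\<^sub>R g (\<Lambda> s \<omega>))"
    by (auto simp: indicator_def)
  finally show ?thesis unfolding set_integrable_def
    by (intro integrableI_bounded_set[where A="{0..t}" and B="\<Sum>j\<in>UNIV. \<bar>g j\<bar>"])
      (auto simp: indicator_def abs_le_sum_UNIV sum_nonneg emeasure_lborel_Icc_eq)
qed

text \<open>With time itself as integrator, \<open>elementary_integral\<close> is the Riemann sum of
  the sampled path. The clock of the sampled chain thus uses the same sampling points as the
  stochastic sum, and it converges for every path, not only in probability.\<close>

lemma chain_integral_tendsto:
  assumes "\<omega> \<in> space M" "0 \<le> t" "t \<le> T" "0 < T"
  shows "(\<lambda>N. elementary_integral (\<lambda>t \<omega>. t) N (grid T N) (sample T N g) t \<omega>) \<longlonglongrightarrow> (LBINT s:{0..t}. g (\<Lambda> s \<omega>))"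
proof -
  let ?e = "\<lambda>N s. elementary_process N (grid T N) (sample T N g) s \<omega>"
  have ge: "0 \<le> grid T N k" for N k using assms by (simp add: grid_nonneg)
  have eq: "elementary_integral (\<lambda>t \<omega>. t) N (grid T N) (sample T N g) t \<omega> =
     (\<integral>s. indicator {0<..t} s *\<^sub>R ?e N s \<partial>lborel)" for N
  proof -
    have le: "min t (grid T N k) \<le> min t (grid T N (Suc k))" for k
      using grid_mono[of T k "Suc k" N] assms by auto
    have *: "(\<lambda>s. indicator {0<..t} s *\<^sub>R ?e N s) =
       (\<lambda>s. \<Sum>k<N. sample T N g k \<omega> * indicator {min t (grid T N k)<..min t (grid T N (Suc k))} s)"
      unfolding elementary_process_def scaleR_sum_right
      by (intro ext sum.cong refl) (use ge order_le_less_trans[OF ge] in \<open>auto simp: indicator_def\<close>)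
    have "(\<integral>s. (\<Sum>k<N. sample T N g k \<omega> * indicator {min t (grid T N k)<..min t (grid T N (Suc k))} s) \<partial>lborel) =
       (\<Sum>k<N. sample T N g k \<omega> * (min t (grid T N (Suc k)) - min t (grid T N k)))"
      using le by (subst Bochner_Integration.integral_sum) (auto simp: measure_def)
    then show ?thesis unfolding * by (simp add: elementary_integral_def)
  qed
  have "(\<lambda>N. \<integral>s. indicator {0<..t} s *\<^sub>R ?e N s \<partial>lborel) \<longlonglongrightarrow> (\<integral>s. indicator {0<..t} s *\<^sub>R g (\<Lambda> s \<omega>) \<partial>lborel)"
  proof (rule integral_dominated_convergence[where w="\<lambda>s. (\<Sum>j\<in>UNIV. \<bar>g j\<bar>) * indicator {0<..t} s"])
    show "(\<lambda>s. indicator {0<..t} s *\<^sub>R g (\<Lambda> s \<omega>)) \<in> borel_measurable lborel"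
      using integrand_section_measurable[OF assms(1), of g t] by (simp add: mult.commute)
    show "(\<lambda>s. indicator {0<..t} s *\<^sub>R ?e N s) \<in> borel_measurable lborel" for N
      unfolding elementary_process_def by measurable
    show "AE s in lborel. (\<lambda>N. indicator {0<..t} s *\<^sub>R ?e N s) \<longlonglongrightarrow> indicator {0<..t} s *\<^sub>R g (\<Lambda> s \<omega>)"
    proof (rule AE_I2)
      fix s show "(\<lambda>N. indicator {0<..t} s *\<^sub>R ?e N s) \<longlonglongrightarrow> indicator {0<..t} s *\<^sub>R g (\<Lambda> s \<omega>)"
        using assms by (cases "s \<in> {0<..t}") (auto intro: sample_tendsto)
    qed
    show "AE s in lborel. norm (indicator {0<..t} s *\<^sub>R ?e N s) \<le> (\<Sum>j\<in>UNIV. \<bar>g j\<bar>) * indicator {0<..t} s" for N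
      using assms by (intro AE_I2) (auto simp: indicator_def intro!: abs_elementary_process_sample_le)
    show "integrable lborel (\<lambda>s. (\<Sum>j\<in>UNIV. \<bar>g j\<bar>) * indicator {0<..t} s)"
      using assms by (intro integrable_mult_right integrable_real_indicator) auto
  qed
  also have "(\<integral>s. indicator {0<..t} s *\<^sub>R g (\<Lambda> s \<omega>) \<partial>lborel) = (LBINT s:{0..t}. g (\<Lambda> s \<omega>))"
    unfolding set_lebesgue_integral_def
  proof (rule integral_cong_AE)
    show "(\<lambda>s. indicator {0<..t} s *\<^sub>R g (\<Lambda> s \<omega>)) \<in> borel_measurable lborel"
      using integrand_section_measurable[OF assms(1), of g t] by (simp add: mult.commute)
    show "(\<lambda>s. indicator {0..t} s *\<^sub>R g (\<Lambda> s \<omega>)) \<in> borel_measurable lborel"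
      using set_integrable_chain[OF assms(1), of t g] unfolding set_integrable_def by (rule borel_measurable_integrable)
    show "AE s in lborel. indicator {0<..t} s *\<^sub>R g (\<Lambda> s \<omega>) = indicator {0..t} s *\<^sub>R g (\<Lambda> s \<omega>)"
      using AE_lborel_singleton[of "0::real"] by eventually_elim (auto simp: indicator_def)
  qed
  finally show ?thesis unfolding eq .
qed

lemma chain_integral_continuous:
  fixes g :: "2 \<Rightarrow> real"
  assumes "\<omega> \<in> space M"
  shows "continuous_on {0..} (\<lambda>t. LBINT s:{0..t}. g (\<Lambda> s \<omega>))"
proof -
  have "continuous_on {0..b} (\<lambda>t. LBINT s:{0..t}. g (\<Lambda> s \<omega>))" for b
  proof -
    have "continuous_on {0..b} (\<lambda>t. integral {0..t} (\<lambda>s. g (\<Lambda> s \<omega>)))"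
      by (rule indefinite_integral_continuous_1)
        (rule set_borel_integral_eq_integral(1)[OF set_integrable_chain[OF assms]])
    then show ?thesis
      using set_borel_integral_eq_integral(2)[OF set_integrable_chain[OF assms, of _ g]] by simp
  qed
  then have "continuous (at t within {0..t + 1}) (\<lambda>t. LBINT s:{0..t}. g (\<Lambda> s \<omega>))" if "0 \<le> t" for t
    using that by (auto simp: continuous_on_eq_continuous_within)
  moreover have "at t within {0..t + 1} = at t within {0..}" if "0 \<le> t" for t :: real
    using that by (intro at_within_nhd[of t "{..<t + 1}"]) auto
  ultimately show ?thesis
    by (simp add: continuous_on_eq_continuous_within)
qed

end

section \<open>Comparison on a grid\<close>

lemma distributed_distr_eq:
  assumes "distributed M lborel X f" "distributed M lborel Y f"
  shows "distr M borel X = distr M borel Y"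
proof -
  have "distr M borel X = distr M lborel X" "distr M borel Y = distr M lborel Y"
    by (auto intro!: distr_cong)
  then show ?thesis using assms[THEN distributed_distr_eq_density] by simp
qed

lemma (in prob_space) prob_gt_cong_distr:
  assumes "distr M borel X = distr M borel Y"
    and [measurable]: "X \<in> borel_measurable M" "Y \<in> borel_measurable M"
  shows "prob {\<omega>\<in>space M. X \<omega> > y} = prob {\<omega>\<in>space M. Y \<omega> > (y::real)}"
proof -
  have *: "prob {\<omega>\<in>space M. Z \<omega> > y} = measure (distr M borel Z) {y<..}"
    if [measurable]: "Z \<in> borel_measurable M" for Z
    by (subst measure_distr) (auto intro!: arg_cong[where f=prob])
  show ?thesis using assms by (simp add: *)
qed

text \<open>The events \<open>r\<^sub>j \<eta> > g\<^sub>j\<close> are nested, so their intersection is one of them.\<close>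

lemma (in prob_space) prob_all_gt_le_scaled:
  fixes W :: "'i \<Rightarrow> 'a \<Rightarrow> real" and \<eta> :: "'a \<Rightarrow> real"
  assumes K: "finite K" and r: "\<And>j. j \<in> K \<Longrightarrow> 0 < r j"
    and [measurable]: "\<And>j. j \<in> K \<Longrightarrow> W j \<in> borel_measurable M" "\<eta> \<in> borel_measurable M"
    and eq: "\<And>j. j \<in> K \<Longrightarrow> distr M borel (W j) = distr M borel (\<lambda>\<omega>. r j * \<eta> \<omega>)"
  shows "prob {\<omega>\<in>space M. \<forall>j\<in>K. W j \<omega> > g j} \<le> prob {\<omega>\<in>space M. \<forall>j\<in>K. r j * \<eta> \<omega> > g j}"
proof (cases "K = {}")
  case False
  \<comment> \<open>The ratio is the level that \<open>\<eta>\<close> must exceed for index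
    \<open>j\<close>; the index with the largest ratio is the binding one.\<close>
  let ?q = "\<lambda>j. g j / r j"
  have "Max (?q ` K) \<in> ?q ` K" using K False by (intro Max_in) auto
  then obtain k where k: "k \<in> K" "?q k = Max (?q ` K)" by auto
  have max: "?q j \<le> ?q k" if "j \<in> K" for j using K that k(2) by auto
  have "prob {\<omega>\<in>space M. \<forall>j\<in>K. W j \<omega> > g j} \<le> prob {\<omega>\<in>space M. W k \<omega> > g k}"
    using k by (intro finite_measure_mono) auto
  also have "\<dots> = prob {\<omega>\<in>space M. r k * \<eta> \<omega> > g k}"
    using k by (intro prob_gt_cong_distr eq) auto
  also have "\<dots> \<le> prob {\<omega>\<in>space M. \<forall>j\<in>K. r j * \<eta> \<omega> > g j}"
  proof (intro finite_measure_mono subsetI CollectI conjI ballI; (elim CollectE conjE)?)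
    fix \<omega> j assume "g k < r k * \<eta> \<omega>" "j \<in> K"
    then have "?q k < \<eta> \<omega>" using r[OF k(1)] by (simp add: field_simps)
    with max[OF \<open>j \<in> K\<close>] have "?q j < \<eta> \<omega>" by simp
    then show "g j < r j * \<eta> \<omega>" using r[OF \<open>j \<in> K\<close>] by (simp add: field_simps)
  next
    show "{\<omega>\<in>space M. \<forall>j\<in>K. r j * \<eta> \<omega> > g j} \<in> events"
      using K by (intro sets.sets_Collect_finite_All) auto
  qed auto
  finally show ?thesis .
qed simp

text \<open>Both joint laws are the product of the marginals. This carries the probability of an
  event about all partial sums from one family of independent increments to another.\<close>

lemma (in prob_space) indep_vars_distr_cong:
  fixes U R :: "'i \<Rightarrow> 'a \<Rightarrow> real"
  assumes I: "I \<noteq> {}" and U: "indep_vars (\<lambda>_. borel) U I" and R: "indep_vars (\<lambda>_. borel) R I"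
    and eq: "\<And>i. i \<in> I \<Longrightarrow> distr M borel (U i) = distr M borel (R i)"
  shows "distr M (PiM I (\<lambda>_. borel)) (\<lambda>\<omega>. \<lambda>i\<in>I. U i \<omega>) = distr M (PiM I (\<lambda>_. borel)) (\<lambda>\<omega>. \<lambda>i\<in>I. R i \<omega>)"
proof -
  have "distr M (PiM I (\<lambda>_. borel)) (\<lambda>\<omega>. \<lambda>i\<in>I. U i \<omega>) = PiM I (\<lambda>i. distr M borel (U i))"
    using U indep_vars_iff_distr_eq_PiM'[OF I, where M'="\<lambda>_. borel" and X=U] by (auto simp: indep_vars_def)
  also have "\<dots> = PiM I (\<lambda>i. distr M borel (R i))" using eq by (rule PiM_cong[OF refl])
  also have "\<dots> = distr M (PiM I (\<lambda>_. borel)) (\<lambda>\<omega>. \<lambda>i\<in>I. R i \<omega>)"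
    using R indep_vars_iff_distr_eq_PiM'[OF I, where M'="\<lambda>_. borel" and X=R] by (auto simp: indep_vars_def)
  finally show ?thesis .
qed

lemma (in prob_space) normal_scale:
  assumes "distributed M lborel X (normal_density 0 s)" "0 < s" "0 < c"
  shows "distributed M lborel (\<lambda>\<omega>. c * X \<omega>) (normal_density 0 (c * s))"
  using normal_density_affine[OF assms(1,2), of c 0] assms(3) by simp

context brownian
begin

text \<open>Write \<open>B\<close> with volatility \<open>v\<^sub>k\<close> on the \<open>k\<close>-th cell as \<open>sqrt (s0\<^sup>2 - s1\<^sup>2) B(a\<^sub>j) + s1 W(t\<^sub>j)\<close> with
  \<open>W\<close> a Brownian motion independent of the first term; the increments of \<open>B\<close> after time \<open>T\<close> serve
  as \<open>W\<close>, so that no extension of the probability space is needed.\<close>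

lemma volatility_comparison:
  fixes P :: "nat \<Rightarrow> bool" and s0 s1 T :: real and N :: nat and f :: "nat \<Rightarrow> real"
  defines "v \<equiv> \<lambda>k. if P k then s0 else s1"
    and "a \<equiv> \<lambda>j. \<Sum>k<j. (if P k then 1 else 0) * (grid T N (Suc k) - grid T N k)"
  assumes s: "0 < s1" "s1 < s0" and T: "0 < T" and N: "0 < N"
    and \<eta>: "distributed M lborel \<eta> std_normal_density"
    and ind\<eta>: "indep_set (sets (vimage_algebra (space M) \<eta> borel)) (sets (process_sigma M borel {0..} B))"
    and K: "K \<subseteq> {1..N}"
  shows "prob {\<omega>\<in>space M. \<forall>j\<in>K. (\<Sum>k<j. v k * (B (grid T N (Suc k)) \<omega> - B (grid T N k) \<omega>)) > f j} \<le>
    prob {\<omega>\<in>space M. \<forall>j\<in>K. sqrt (s0\<^sup>2 - s1\<^sup>2) * B (a j) \<omega> + sqrt (grid T N j) * s1 * \<eta> \<omega> > f j}"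
proof -
  define h where "h = T / N"
  \<comment> \<open>With \<open>c\<^sup>2 + s1\<^sup>2 = s0\<^sup>2\<close>, a cell of high
    volatility gets variance \<open>c\<^sup>2 * h\<close> from the clock part and
    \<open>s1\<^sup>2 * h\<close> from \<open>W\<close>; a cell of low volatility gets only the
    latter.\<close>
  define c where "c = sqrt (s0\<^sup>2 - s1\<^sup>2)"
  have h: "0 < h" using T N by (simp add: h_def)
  have "s1\<^sup>2 < s0\<^sup>2" using s by (intro power_strict_mono) auto
  then have c: "0 < c" "c\<^sup>2 + s1\<^sup>2 = s0\<^sup>2" by (auto simp: c_def)
  have gS: "grid T N (Suc k) = grid T N k + h" for k by (simp add: grid_Suc h_def)
  have a0: "a 0 = 0" by (simp add: a_def)
  have aS: "a (Suc k) = a k + (if P k then h else 0)" for k by (simp add: a_def gS)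
  have a_mono: "i \<le> j \<Longrightarrow> a i \<le> a j" for i j
    by (rule lift_Suc_mono_le[of a]) (use h in \<open>auto simp: aS\<close>)
  have a_nonneg: "0 \<le> a j" for j using a_mono[of 0 j] a0 by simp
  have "a j \<le> grid T N j" for j
    by (induction j) (use h in \<open>auto simp: a0 aS gS\<close>)
  moreover have "grid T N N = T" using N by (simp add: grid_def)
  ultimately have aN: "a N \<le> T" by metis
  have K_fin: "finite K" using K finite_subset by blast
  have \<eta>m [measurable]: "\<eta> \<in> borel_measurable M"
    using distributed_measurable[OF \<eta>] by simp
  \<comment> \<open>One monotone partition serves both parts: the clock times \<open>a 0\<close> to
    \<open>a N\<close>, which do not exceed \<open>T\<close>, then the grid shifted by
    \<open>T\<close>. Cell \<open>N\<close> bridges the gap from \<open>a N\<close> to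
    \<open>T\<close>, hence the offset \<open>Suc N\<close> of the later cells.\<close>
  define q where "q k = (if k \<le> N then a k else T + grid T N (k - Suc N))" for k
  define X where "X k \<omega> = B (q (Suc k)) \<omega> - B (q k) \<omega>" for k \<omega>
  define W where "W j \<omega> = B (T + grid T N j) \<omega> - B T \<omega>" for j \<omega>
  have q_mono: "mono_on A q" for A
  proof (rule mono_onI)
    fix i j :: nat assume "i \<le> j"
    then show "q i \<le> q j"
      using a_mono[of i j] a_mono[of i N] aN grid_nonneg[OF T, of N "j - Suc N"]
        grid_mono[OF T, of "i - Suc N" "j - Suc N" N]
      by (auto simp: q_def)
  qed
  have q_nonneg: "0 \<le> q k" for k
    using a_nonneg T grid_nonneg[OF T, of N "k - Suc N"] by (auto simp: q_def)
  have ind: "indep_vars (\<lambda>_. borel) X {..<2 * N + 1}"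
    unfolding X_def by (rule indep_increments) (use q_nonneg q_mono in auto)
  have Xm [measurable]: "X k \<in> borel_measurable M" for k
    unfolding X_def by (intro borel_measurable_diff measurable_B q_nonneg)
  have XV: "X k \<omega> = B (a (Suc k)) \<omega> - B (a k) \<omega>" if "k < N" for k \<omega>
    using that by (simp add: X_def q_def)
  have XW: "X (Suc (N + k)) \<omega> = B (T + grid T N (Suc k)) \<omega> - B (T + grid T N k) \<omega>" for k \<omega>
    by (simp add: X_def q_def Suc_diff_le)
  have sumV: "(\<Sum>k<j. X k \<omega>) = B (a j) \<omega>" if "j \<le> N" "\<omega> \<in> space M" for j \<omega>
  proof -
    have "(\<Sum>k<j. X k \<omega>) = (\<Sum>k<j. B (a (Suc k)) \<omega> - B (a k) \<omega>)"
      using that by (intro sum.cong) (auto simp: XV)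
    then show ?thesis using sum_increments[OF that(2), of a j] a0 by simp
  qed
  have sumW: "(\<Sum>k<j. X (Suc (N + k)) \<omega>) = W j \<omega>" for j \<omega>
    using sum_lessThan_telescope[of "\<lambda>k. B (T + grid T N k) \<omega>" j] by (simp add: XW W_def)
  have distW: "distributed M lborel (X (Suc (N + k))) (normal_density 0 (sqrt h))" for k
    unfolding XW[abs_def]
    using distributed_increment[of "T + grid T N k" "T + grid T N (Suc k)"] h T grid_nonneg[OF T, of N k]
    by (simp add: gS)
  define U where "U k \<omega> = c * X k \<omega> + s1 * X (Suc (N + k)) \<omega>" for k \<omega>
  define R where "R k \<omega> = v k * (B (grid T N (Suc k)) \<omega> - B (grid T N k) \<omega>)" for k \<omega>
  have indU: "indep_vars (\<lambda>_. borel) U {..<N}"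
  proof -
    \<comment> \<open>\<open>U j\<close> uses the \<open>j\<close>-th clock increment and the
      \<open>j\<close>-th increment after \<open>T\<close>; these index pairs are disjoint for
      different \<open>j\<close>.\<close>
    have "indep_vars (\<lambda>j. PiM {j, Suc (N + j)} (\<lambda>_. borel)) (\<lambda>j \<omega>. restrict (\<lambda>i. X i \<omega>) {j, Suc (N + j)}) {..<N}"
      by (rule indep_vars_restrict[OF ind]) (auto simp: disjoint_family_on_def)
    from indep_vars_compose2[OF this, of "\<lambda>j x. c * x j + s1 * x (Suc (N + j))" "\<lambda>_. borel"]
    have "indep_vars (\<lambda>_. borel) (\<lambda>j \<omega>. c * restrict (\<lambda>i. X i \<omega>) {j, Suc (N + j)} j +
        s1 * restrict (\<lambda>i. X i \<omega>) {j, Suc (N + j)} (Suc (N + j))) {..<N}"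
      by measurable
    then show ?thesis unfolding U_def[abs_def] by simp
  qed
  have v: "0 < v k" for k using s by (auto simp: v_def)
  have indR: "indep_vars (\<lambda>_. borel) R {..<N}"
    unfolding R_def[abs_def]
    by (rule indep_vars_compose2[OF indep_increments[of "grid T N"], of N "\<lambda>k x. v k * x" "\<lambda>_. borel"])
      (auto intro!: mono_onI grid_mono T)
  have distR: "distributed M lborel (R k) (normal_density 0 (v k * sqrt h))" for k
    unfolding R_def[abs_def]
    using distributed_increment[of "grid T N k" "grid T N (Suc k)"] h grid_nonneg[OF T, of N k] v[of k]
    by (intro normal_scale) (auto simp: gS)
  have distU: "distributed M lborel (U k) (normal_density 0 (v k * sqrt h))" if "k < N" for k
  proof (cases "P k")
    case True
    have "indep_var (PiM {k} (\<lambda>_. borel)) (\<lambda>\<omega>. restrict (\<lambda>i. X i \<omega>) {k})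
        (PiM {Suc (N + k)} (\<lambda>_. borel)) (\<lambda>\<omega>. restrict (\<lambda>i. X i \<omega>) {Suc (N + k)})"
      by (rule indep_var_restrict[OF ind]) (use that in auto)
    from indep_var_compose[OF this, of "\<lambda>x. c * x k" borel "\<lambda>x. s1 * x (Suc (N + k))" borel]
    have "indep_var borel (\<lambda>\<omega>. c * X k \<omega>) borel (\<lambda>\<omega>. s1 * X (Suc (N + k)) \<omega>)"
      by (simp add: comp_def)
    moreover have "distributed M lborel (\<lambda>\<omega>. c * X k \<omega>) (normal_density 0 (c * sqrt h))"
    proof (intro normal_scale)
      have "X k = (\<lambda>\<omega>. B (a (Suc k)) \<omega> - B (a k) \<omega>)" using XV[OF that] by auto
      then show "distributed M lborel (X k) (normal_density 0 (sqrt h))"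
        using distributed_increment[of "a k" "a (Suc k)"] a_nonneg[of k] h True by (simp add: aS)
    qed (use h c in auto)
    moreover have "distributed M lborel (\<lambda>\<omega>. s1 * X (Suc (N + k)) \<omega>) (normal_density 0 (s1 * sqrt h))"
      using s h by (intro normal_scale distW) auto
    ultimately have "distributed M lborel (U k) (normal_density (0 + 0) (sqrt ((c * sqrt h)\<^sup>2 + (s1 * sqrt h)\<^sup>2)))"
      unfolding U_def[abs_def] using c s h by (intro add_indep_normal) auto
    also have "sqrt ((c * sqrt h)\<^sup>2 + (s1 * sqrt h)\<^sup>2) = s0 * sqrt h"
    proof -
      have "(c * sqrt h)\<^sup>2 + (s1 * sqrt h)\<^sup>2 = (s0 * sqrt h)\<^sup>2"
        by (simp add: power_mult_distrib distrib_right[symmetric] c)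
      then show ?thesis using s h by simp
    qed
    finally show ?thesis using True by (simp add: v_def)
  next
    \<comment> \<open>The clock stands still on this cell, so its increment is identically zero and
      has no density; the normal law must come from the \<open>W\<close> part alone instead of a
      convolution.\<close>
    case False
    then have "U k = (\<lambda>\<omega>. s1 * X (Suc (N + k)) \<omega>)"
      using that by (auto simp: U_def XV aS)
    then show ?thesis using False s h normal_scale[OF distW[of k], of s1] by (simp add: v_def)
  qed
  have rvU: "U k \<in> borel_measurable M" for k unfolding U_def[abs_def] by measurable
  have rvR: "R k \<in> borel_measurable M" for k
    using distributed_measurable[OF distR[of k]] by simp
  define Q where "Q = {x \<in> space (PiM {..<N} (\<lambda>_. borel :: real measure)). \<forall>j\<in>K. (\<Sum>k<j. x k) > f j}"
  have sum_meas: "(\<lambda>x. \<Sum>k<j. x k) \<in> borel_measurable (PiM {..<N} (\<lambda>_. borel :: real measure))" if "j \<in> K" for j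
    using that K by (intro borel_measurable_sum measurable_component_singleton) auto
  have Q: "Q \<in> sets (PiM {..<N} (\<lambda>_. borel))"
    unfolding Q_def using sum_meas K_fin by (intro sets.sets_Collect_finite_All borel_measurable_less) auto
  have pre: "prob {\<omega>\<in>space M. \<forall>j\<in>K. (\<Sum>k<j. Z k \<omega>) > f j} =
      measure (distr M (PiM {..<N} (\<lambda>_. borel)) (\<lambda>\<omega>. \<lambda>i\<in>{..<N}. Z i \<omega>)) Q"
    if [measurable]: "\<And>k. Z k \<in> borel_measurable M" for Z
  proof -
    have sub: "(\<Sum>k<j. (\<lambda>i\<in>{..<N}. Z i \<omega>) k) = (\<Sum>k<j. Z k \<omega>)" if "j \<in> K" for j \<omega>
      using that K by (intro sum.cong) auto
    have "(\<lambda>i\<in>{..<N}. Z i \<omega>) \<in> Q \<longleftrightarrow> (\<forall>j\<in>K. (\<Sum>k<j. Z k \<omega>) > f j)" for \<omega>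
      unfolding Q_def by (simp add: sub space_PiM del: restrict_apply)
    then have "(\<lambda>\<omega>. \<lambda>i\<in>{..<N}. Z i \<omega>) -` Q \<inter> space M = {\<omega>\<in>space M. \<forall>j\<in>K. (\<Sum>k<j. Z k \<omega>) > f j}"
      by blast
    then show ?thesis using Q by (subst measure_distr) auto
  qed
  have "prob {\<omega>\<in>space M. \<forall>j\<in>K. (\<Sum>k<j. R k \<omega>) > f j} = prob {\<omega>\<in>space M. \<forall>j\<in>K. (\<Sum>k<j. U k \<omega>) > f j}"
    unfolding pre[OF rvR] pre[OF rvU]
    by (subst indep_vars_distr_cong[OF _ indU indR])
      (use N in \<open>auto intro: distributed_distr_eq distR distU\<close>)
  also have "{\<omega>\<in>space M. \<forall>j\<in>K. (\<Sum>k<j. U k \<omega>) > f j} =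
      {\<omega>\<in>space M. \<forall>j\<in>K. c * B (a j) \<omega> + s1 * W j \<omega> > f j}"
  proof (intro Collect_cong conj_cong refl ball_cong)
    fix \<omega> j assume "\<omega> \<in> space M" "j \<in> K"
    then have "(\<Sum>k<j. U k \<omega>) = c * B (a j) \<omega> + s1 * W j \<omega>"
      using K by (auto simp: U_def sum.distrib sum_distrib_left[symmetric] sumV sumW)
    then show "(f j < (\<Sum>k<j. U k \<omega>)) = (f j < c * B (a j) \<omega> + s1 * W j \<omega>)" by simp
  qed
  also have "prob {\<omega>\<in>space M. \<forall>j\<in>K. c * B (a j) \<omega> + s1 * W j \<omega> > f j} \<le>
      prob {\<omega>\<in>space M. \<forall>j\<in>K. c * B (a j) \<omega> + sqrt (grid T N j) * s1 * \<eta> \<omega> > f j}"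
  proof -
    \<comment> \<open>\<open>?S\<close> determines every \<open>B (a j)\<close>, \<open>?Y\<close>
      determines every \<open>W j\<close>. Since \<open>?Y\<close> and \<open>\<eta>\<close> are
      each independent of \<open>?S\<close>, both probabilities are integrals over the law of
      \<open>?S\<close> and only their sections must be compared.\<close>
    let ?S = "\<lambda>\<omega>. restrict (\<lambda>i. X i \<omega>) {..<N}"
    let ?J = "{Suc N..<2 * N + 1}"
    let ?Y = "\<lambda>\<omega>. restrict (\<lambda>i. X i \<omega>) ?J"
    let ?PS = "PiM {..<N} (\<lambda>_. borel :: real measure)"
    let ?PY = "PiM ?J (\<lambda>_. borel :: real measure)"
    \<comment> \<open>\<open>indep_var\<close> relates variables of one value type, so
      \<open>\<eta>\<close> is wrapped as a family with the single index 0.\<close>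
    let ?H = "\<lambda>\<omega>. \<lambda>i\<in>{0::nat}. \<eta> \<omega>"
    let ?PH = "PiM {0::nat} (\<lambda>_. borel :: real measure)"
    let ?C2 = "{z \<in> space (?PS \<Otimes>\<^sub>M ?PY). \<forall>j\<in>K. c * (\<Sum>k<j. fst z k) + s1 * (\<Sum>k<j. snd z (Suc (N + k))) > f j}"
    let ?C3 = "{z \<in> space (?PS \<Otimes>\<^sub>M ?PH). \<forall>j\<in>K. c * (\<Sum>k<j. fst z k) + sqrt (grid T N j) * s1 * snd z 0 > f j}"
    have fst_meas: "(\<lambda>z. \<Sum>k<j. fst z k) \<in> borel_measurable (?PS \<Otimes>\<^sub>M ?PY)"
        "(\<lambda>z. \<Sum>k<j. fst z k) \<in> borel_measurable (?PS \<Otimes>\<^sub>M ?PH)" if "j \<in> K" for j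
      by (rule measurable_compose[OF measurable_fst sum_meas[OF that]])+
    have snd_meas: "(\<lambda>z. \<Sum>k<j. snd z (Suc (N + k))) \<in> borel_measurable (?PS \<Otimes>\<^sub>M ?PY)" if "j \<in> K" for j
      using that K
      by (intro borel_measurable_sum measurable_compose[OF measurable_snd measurable_component_singleton]) auto
    have C2: "?C2 \<in> sets (?PS \<Otimes>\<^sub>M ?PY)"
      using K_fin fst_meas snd_meas
      by (intro sets.sets_Collect_finite_All borel_measurable_less borel_measurable_add borel_measurable_times) auto
    have "(\<lambda>z. snd z 0) \<in> borel_measurable (?PS \<Otimes>\<^sub>M ?PH)"
      by (intro measurable_compose[OF measurable_snd measurable_component_singleton]) auto
    then have C3: "?C3 \<in> sets (?PS \<Otimes>\<^sub>M ?PH)"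
      using K_fin fst_meas
      by (intro sets.sets_Collect_finite_All borel_measurable_less borel_measurable_add borel_measurable_times) auto
    have ind2: "indep_var ?PS ?S ?PY ?Y"
      by (rule indep_var_restrict[OF ind]) auto
    have ind3: "indep_var ?PS ?S ?PH ?H"
    proof (rule indep_set_imp_indep_var[OF indep_set_commute[OF ind\<eta>]])
      have "X k \<in> borel_measurable (process_sigma M borel {0..} B)" for k
        unfolding X_def using q_nonneg
        by (intro borel_measurable_diff measurable_process_sigma) auto
      then show "?S \<in> measurable (process_sigma M borel {0..} B) ?PS"
        by (intro measurable_restrict) auto
      show "?H \<in> measurable (vimage_algebra (space M) \<eta> borel) ?PH"
        by (intro measurable_restrict measurable_vimage_algebra1) auto
    qed auto
    have S: "(\<Sum>k<j. ?S \<omega> k) = B (a j) \<omega>" if "j \<in> K" "\<omega> \<in> space M" for j \<omega>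
    proof -
      have "(\<Sum>k<j. ?S \<omega> k) = (\<Sum>k<j. X k \<omega>)" using that K by (intro sum.cong) auto
      then show ?thesis using that K sumV[of j \<omega>] by auto
    qed
    have Y: "(\<Sum>k<j. ?Y \<omega> (Suc (N + k))) = W j \<omega>" if "j \<in> K" for j \<omega>
    proof -
      have "(\<Sum>k<j. ?Y \<omega> (Suc (N + k))) = (\<Sum>k<j. X (Suc (N + k)) \<omega>)"
        using that K by (intro sum.cong) auto
      then show ?thesis by (simp add: sumW)
    qed
    have eq2: "(?S \<omega>, ?Y \<omega>') \<in> ?C2 \<longleftrightarrow> (\<forall>j\<in>K. c * B (a j) \<omega> + s1 * W j \<omega>' > f j)" if "\<omega> \<in> space M" for \<omega> \<omega>'
    proof -
      have "(?S \<omega>, ?Y \<omega>') \<in> space (?PS \<Otimes>\<^sub>M ?PY)" by (simp add: space_pair_measure space_PiM)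
      then show ?thesis using S[OF _ that] Y by (auto simp del: restrict_apply)
    qed
    have eq3: "(?S \<omega>, \<lambda>i\<in>{0}. y) \<in> ?C3 \<longleftrightarrow> (\<forall>j\<in>K. c * B (a j) \<omega> + sqrt (grid T N j) * s1 * y > f j)" if "\<omega> \<in> space M" for \<omega> y
    proof -
      have "(?S \<omega>, \<lambda>i\<in>{0}. y) \<in> space (?PS \<Otimes>\<^sub>M ?PH)" by (simp add: space_pair_measure space_PiM)
      moreover have "(\<lambda>i\<in>{0::nat}. y) 0 = y" by simp
      ultimately show ?thesis using S[OF _ that] by (auto simp del: restrict_apply)
    qed
    have inner: "emeasure M {\<omega>' \<in> space M. (?S \<omega>, ?Y \<omega>') \<in> ?C2} \<le> emeasure M {\<omega>' \<in> space M. (?S \<omega>, ?H \<omega>') \<in> ?C3}"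
      if \<omega>: "\<omega> \<in> space M" for \<omega>
    proof -
      \<comment> \<open>With \<open>B (a j) \<omega>\<close> frozen, dividing by \<open>s1\<close>
        leaves the same deterministic threshold for \<open>W j\<close> and for the scaled
        \<open>\<eta>\<close>.\<close>
      define g where "g j = (f j - c * B (a j) \<omega>) / s1" for j
      have "prob {\<omega>'\<in>space M. \<forall>j\<in>K. W j \<omega>' > g j} \<le> prob {\<omega>'\<in>space M. \<forall>j\<in>K. sqrt (grid T N j) * \<eta> \<omega>' > g j}"
      proof (rule prob_all_gt_le_scaled[OF K_fin])
        fix j assume "j \<in> K"
        \<comment> \<open>Index 0 is outside \<open>K\<close>; there \<open>W\<close> would vanish
          and the scale of \<open>\<eta>\<close> would not be positive.\<close>
        then have gj: "0 < grid T N j" using K T N by (auto simp: grid_def)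
        then show "0 < sqrt (grid T N j)" by simp
        show "W j \<in> borel_measurable M"
          unfolding W_def using T gj by (intro borel_measurable_diff measurable_B) auto
        have "distributed M lborel (W j) (normal_density 0 (sqrt (grid T N j)))"
          unfolding W_def using distributed_increment[of T "T + grid T N j"] T gj by simp
        moreover have "distributed M lborel (\<lambda>\<omega>. sqrt (grid T N j) * \<eta> \<omega>) (normal_density 0 (sqrt (grid T N j)))"
          using normal_scale[OF \<eta>, of "sqrt (grid T N j)"] gj by simp
        ultimately show "distr M borel (W j) = distr M borel (\<lambda>\<omega>. sqrt (grid T N j) * \<eta> \<omega>)"
          by (rule distributed_distr_eq)
      qed simp
      moreover have "c * B (a j) \<omega> + s1 * x > f j \<longleftrightarrow> x > g j" for j x
        using s by (simp add: g_def field_simps)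
      moreover have "c * B (a j) \<omega> + sqrt (grid T N j) * s1 * x > f j \<longleftrightarrow> sqrt (grid T N j) * x > g j" for j x
        using s by (simp add: g_def field_simps)
      ultimately show ?thesis unfolding eq2[OF \<omega>] eq3[OF \<omega>]
        by (simp add: emeasure_eq_measure)
    qed
    have "emeasure M {\<omega> \<in> space M. (?S \<omega>, ?Y \<omega>) \<in> ?C2} \<le> emeasure M {\<omega> \<in> space M. (?S \<omega>, ?H \<omega>) \<in> ?C3}"
      unfolding emeasure_indep_var[OF ind2 C2] emeasure_indep_var[OF ind3 C3]
      by (intro nn_integral_mono inner)
    moreover have "{\<omega> \<in> space M. (?S \<omega>, ?Y \<omega>) \<in> ?C2} = {\<omega>\<in>space M. \<forall>j\<in>K. c * B (a j) \<omega> + s1 * W j \<omega> > f j}"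
      using eq2 by blast
    moreover have "{\<omega> \<in> space M. (?S \<omega>, ?H \<omega>) \<in> ?C3} =
        {\<omega>\<in>space M. \<forall>j\<in>K. c * B (a j) \<omega> + sqrt (grid T N j) * s1 * \<eta> \<omega> > f j}"
      using eq3 by blast
    ultimately show ?thesis by (simp add: emeasure_eq_measure)
  qed
  finally show ?thesis unfolding R_def c_def .
qed

end

section \<open>Comparison of the sampled processes on chain events\<close>

locale regime_switching_normal = regime_switching M B \<Lambda> for M :: "'a measure" and B \<Lambda> +
  fixes \<eta> :: "'a \<Rightarrow> real"
  assumes normal_\<eta>: "distributed M lborel \<eta> std_normal_density"
    and indep_\<eta>: "indep_set (sets (vimage_algebra (space M) \<eta> borel))
      (sigma_sets (space M) (sets (process_sigma M borel {0..} B) \<union>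
         sets (process_sigma M (count_space UNIV) {0..} \<Lambda>)))"
begin

lemma measurable_\<eta> [measurable]: "\<eta> \<in> borel_measurable M"
  using distributed_measurable[OF normal_\<eta>] by simp

text \<open>Regrouped so that the chain stands alone: an event about \<open>\<eta>\<close> and
  \<open>B\<close> together then factors from any chain event.\<close>

lemma indep_\<eta>_B_\<Lambda>:
  "indep_set (sigma_sets (space M) (sets (vimage_algebra (space M) \<eta> borel) \<union> sets (process_sigma M borel {0..} B)))
     (sets (process_sigma M (count_space UNIV) {0..} \<Lambda>))"
  by (rule indep_set_sigma_Un[OF _ _ _ indep_\<eta> indep_B_\<Lambda>])
    (use sets.sigma_algebra_axioms[of "process_sigma M (count_space UNIV) {0..} \<Lambda>"]
      sets.sigma_algebra_axioms[of "process_sigma M borel {0..} B"]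
      sets.sigma_algebra_axioms[of "vimage_algebra (space M) \<eta> borel"] in auto)

lemma indep_\<eta>_B: "indep_set (sets (vimage_algebra (space M) \<eta> borel)) (sets (process_sigma M borel {0..} B))"
  by (rule indep_set_mono[OF indep_\<eta>]) (auto intro: sigma_sets.Basic)

text \<open>Patterns are extensional functions, so there are finitely many and each sequence of
  sampled states is counted once, which makes the pieces disjoint.\<close>

lemma prob_eq_sum_patterns:
  assumes "A \<in> events" "0 < T"
  shows "prob A = (\<Sum>i\<in>{..<N} \<rightarrow>\<^sub>E UNIV. prob (A \<inter> {\<omega>\<in>space M. \<forall>k<N. \<Lambda> (grid T N (Suc k)) \<omega> = i k}))"
proof -
  let ?I = "{..<N} \<rightarrow>\<^sub>E (UNIV :: 2 set)"
  let ?E = "\<lambda>i. A \<inter> {\<omega>\<in>space M. \<forall>k<N. \<Lambda> (grid T N (Suc k)) \<omega> = i k}"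
  have fin: "finite ?I" by (intro finite_PiE) auto
  have [measurable]: "\<Lambda> (grid T N (Suc k)) \<in> measurable M (count_space UNIV)" for k
    using assms by (intro measurable_\<Lambda> grid_nonneg)
  have "{\<omega>\<in>space M. \<forall>k<N. \<Lambda> (grid T N (Suc k)) \<omega> = i k} \<in> events" for i by measurable
  then have meas: "?E ` ?I \<subseteq> events" using sets.Int[OF assms(1)] by blast
  have disj: "disjoint_family_on ?E ?I"
    unfolding disjoint_family_on_def
  proof (intro ballI impI)
    fix i j assume ij: "i \<in> ?I" "j \<in> ?I" "i \<noteq> j"
    then obtain k where "k < N" "i k \<noteq> j k" by (metis PiE_ext lessThan_iff)
    then show "?E i \<inter> ?E j = {}" by auto
  qed
  have "A = (\<Union>i\<in>?I. ?E i)"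
  proof (intro equalityI subsetI)
    fix \<omega> assume "\<omega> \<in> A"
    then have "\<omega> \<in> ?E (\<lambda>k\<in>{..<N}. \<Lambda> (grid T N (Suc k)) \<omega>)"
      using sets.sets_into_space[OF assms(1)] by auto
    then show "\<omega> \<in> (\<Union>i\<in>?I. ?E i)"
      by (intro UN_I[of "\<lambda>k\<in>{..<N}. \<Lambda> (grid T N (Suc k)) \<omega>"]) simp_all
  qed auto
  then show ?thesis using finite_measure_finite_Union[OF fin meas disj] by simp
qed

text \<open>On one pattern the coefficients and the clock are constants, so each event is an event
  of \<open>B\<close>, or of \<open>B\<close> and \<open>\<eta>\<close>, cut with a chain event.
  Independence turns both into products with the same chain factor, the deterministic comparison
  applies to the other factor, and summing over patterns gives the claim. The threshold
  \<open>f\<close> may depend on the clock because the clock is constant there as well.\<close>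

lemma sampled_comparison:
  fixes \<sigma> :: "2 \<Rightarrow> real" and T :: real and N :: nat and f :: "nat \<Rightarrow> real \<Rightarrow> real"
  defines "Y \<equiv> \<lambda>j \<omega>. \<Sum>k<j. sample T N \<sigma> k \<omega> * (B (grid T N (Suc k)) \<omega> - B (grid T N k) \<omega>)"
    and "a \<equiv> \<lambda>j \<omega>. \<Sum>k<j. sample T N (\<lambda>i. if i = 0 then 1 else 0) k \<omega> * (grid T N (Suc k) - grid T N k)"
  assumes \<sigma>: "0 < \<sigma> 1" "\<sigma> 1 < \<sigma> 0" and T: "0 < T" and N: "0 < N" and K: "K \<subseteq> {1..N}"
    and L: "L \<in> sets (process_sigma M (count_space UNIV) {0..} \<Lambda>)"
    and A1: "{\<omega>\<in>space M. \<forall>j\<in>K. Y j \<omega> > f j (a j \<omega>)} \<in> events"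
    and A2: "{\<omega>\<in>space M. \<forall>j\<in>K. sqrt ((\<sigma> 0)\<^sup>2 - (\<sigma> 1)\<^sup>2) * B (a j \<omega>) \<omega> + sqrt (grid T N j) * \<sigma> 1 * \<eta> \<omega> > f j (a j \<omega>)} \<in> events"
  shows "prob (L \<inter> {\<omega>\<in>space M. \<forall>j\<in>K. Y j \<omega> > f j (a j \<omega>)}) \<le>
    prob (L \<inter> {\<omega>\<in>space M. \<forall>j\<in>K. sqrt ((\<sigma> 0)\<^sup>2 - (\<sigma> 1)\<^sup>2) * B (a j \<omega>) \<omega> + sqrt (grid T N j) * \<sigma> 1 * \<eta> \<omega> > f j (a j \<omega>)})"
proof -
  let ?SL = "process_sigma M (count_space UNIV) {0..} \<Lambda>"
  let ?SB = "process_sigma M borel {0..} B"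
  let ?SE = "sigma (space M) (sets (vimage_algebra (space M) \<eta> borel) \<union> sets ?SB)"
  let ?E = "\<lambda>i. {\<omega>\<in>space M. \<forall>k<N. \<Lambda> (grid T N (Suc k)) \<omega> = i k}"
  let ?A1 = "{\<omega>\<in>space M. \<forall>j\<in>K. Y j \<omega> > f j (a j \<omega>)}"
  let ?A2 = "{\<omega>\<in>space M. \<forall>j\<in>K. sqrt ((\<sigma> 0)\<^sup>2 - (\<sigma> 1)\<^sup>2) * B (a j \<omega>) \<omega> + sqrt (grid T N j) * \<sigma> 1 * \<eta> \<omega> > f j (a j \<omega>)}"
  have exhaust: "x = 0 \<or> x = 1" for x :: 2 using exhaust_2[of x] by auto
  have K_fin: "finite K" using K finite_subset by blast
  have LM: "L \<in> events" using L subalgebra_\<Lambda> by auto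
  have sp: "space ?SE = space M" and se: "sets ?SE = sigma_sets (space M) (sets (vimage_algebra (space M) \<eta> borel) \<union> sets ?SB)"
    using process_sigma_subset_Pow[of borel "{0..}" B] sets.sets_into_space[of _ "vimage_algebra (space M) \<eta> borel"]
    by (auto intro!: space_measure_of sets_measure_of)
  have EL: "L \<inter> ?E i \<in> sets ?SL" for i
  proof -
    have "{\<omega>\<in>space ?SL. \<forall>k\<in>{..<N}. \<Lambda> (grid T N (Suc k)) \<omega> = i k} \<in> sets ?SL"
    proof (rule sets.sets_Collect_finite_All)
      fix k
      have [measurable]: "\<Lambda> (grid T N (Suc k)) \<in> measurable ?SL (count_space UNIV)"
        using T by (intro measurable_process_sigma) (auto simp: grid_nonneg)
      show "{\<omega>\<in>space ?SL. \<Lambda> (grid T N (Suc k)) \<omega> = i k} \<in> sets ?SL" by measurable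
    qed simp
    then have "?E i \<in> sets ?SL" unfolding Ball_def lessThan_iff space_process_sigma .
    with L show ?thesis by (rule sets.Int)
  qed
  have B_SE: "B t \<in> borel_measurable ?SE" if "0 \<le> t" for t
  proof (rule subsetD[OF measurable_mono])
    show "B t \<in> borel_measurable ?SB" using that by (intro measurable_process_sigma) auto
    show "sets ?SB \<subseteq> sets ?SE" unfolding se by (auto intro: sigma_sets.Basic)
  qed (simp_all add: sp)
  have \<eta>_SE: "\<eta> \<in> borel_measurable ?SE"
  proof (rule subsetD[OF measurable_mono])
    show "\<eta> \<in> borel_measurable (vimage_algebra (space M) \<eta> borel)"
      by (rule measurable_vimage_algebra1) auto
    show "sets (vimage_algebra (space M) \<eta> borel) \<subseteq> sets ?SE" unfolding se by (auto intro: sigma_sets.Basic)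
  qed (simp_all add: sp)
  have "prob (L \<inter> ?A1 \<inter> ?E i) \<le> prob (L \<inter> ?A2 \<inter> ?E i)" for i
  proof -
    define b where "b j = (\<Sum>k<j. (if i k = 0 then 1 else 0) * (grid T N (Suc k) - grid T N k))" for j
    define v where "v k = (if i k = 0 then \<sigma> 0 else \<sigma> 1)" for k
    have b: "0 \<le> b j" for j
      unfolding b_def using grid_mono[OF T] by (intro sum_nonneg) auto
    let ?C1 = "{\<omega>\<in>space M. \<forall>j\<in>K. (\<Sum>k<j. v k * (B (grid T N (Suc k)) \<omega> - B (grid T N k) \<omega>)) > f j (b j)}"
    let ?C2 = "{\<omega>\<in>space M. \<forall>j\<in>K. sqrt ((\<sigma> 0)\<^sup>2 - (\<sigma> 1)\<^sup>2) * B (b j) \<omega> + sqrt (grid T N j) * \<sigma> 1 * \<eta> \<omega> > f j (b j)}"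
    have ab: "a j \<omega> = b j" if "j \<in> K" "\<omega> \<in> ?E i" for j \<omega>
      unfolding a_def b_def sample_def using that K by (intro sum.cong) auto
    have Yv: "Y j \<omega> = (\<Sum>k<j. v k * (B (grid T N (Suc k)) \<omega> - B (grid T N k) \<omega>))" if "j \<in> K" "\<omega> \<in> ?E i" for j \<omega>
      unfolding Y_def sample_def
    proof (intro sum.cong refl)
      fix k assume "k \<in> {..<j}"
      then have "\<Lambda> (grid T N (Suc k)) \<omega> = i k" using that K by auto
      then show "\<sigma> (\<Lambda> (grid T N (Suc k)) \<omega>) * (B (grid T N (Suc k)) \<omega> - B (grid T N k) \<omega>) =
          v k * (B (grid T N (Suc k)) \<omega> - B (grid T N k) \<omega>)"
        using exhaust[of "i k"] by (auto simp: v_def)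
    qed
    have e1: "L \<inter> ?A1 \<inter> ?E i = ?C1 \<inter> (L \<inter> ?E i)" using ab Yv by auto
    have e2: "L \<inter> ?A2 \<inter> ?E i = ?C2 \<inter> (L \<inter> ?E i)" using ab by auto
    have C1: "?C1 \<in> sets ?SB"
    proof -
      have "{\<omega>\<in>space ?SB. \<forall>j\<in>K. (\<Sum>k<j. v k * (B (grid T N (Suc k)) \<omega> - B (grid T N k) \<omega>)) > f j (b j)} \<in> sets ?SB"
        using K_fin T grid_nonneg[OF T]
        by (intro sets.sets_Collect_finite_All borel_measurable_less borel_measurable_sum borel_measurable_times
            borel_measurable_diff measurable_process_sigma borel_measurable_const) auto
      then show ?thesis by simp
    qed
    have C2: "?C2 \<in> sets ?SE"
    proof -
      have "{\<omega>\<in>space ?SE. \<forall>j\<in>K. sqrt ((\<sigma> 0)\<^sup>2 - (\<sigma> 1)\<^sup>2) * B (b j) \<omega> + sqrt (grid T N j) * \<sigma> 1 * \<eta> \<omega> > f j (b j)} \<in> sets ?SE"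
        using K_fin b
        by (intro sets.sets_Collect_finite_All borel_measurable_less borel_measurable_add borel_measurable_times
            B_SE \<eta>_SE borel_measurable_const) auto
      then show ?thesis unfolding sp .
    qed
    have "prob (?C1 \<inter> (L \<inter> ?E i)) = prob ?C1 * prob (L \<inter> ?E i)"
      by (rule indep_setD[OF indep_B_\<Lambda> C1 EL])
    also have "\<dots> \<le> prob ?C2 * prob (L \<inter> ?E i)"
      using volatility_comparison[OF \<sigma> T N normal_\<eta> indep_\<eta>_B K, where P="\<lambda>k. i k = 0" and f="\<lambda>j. f j (b j)"]
      by (intro mult_right_mono) (simp_all add: v_def b_def)
    also have "\<dots> = prob (?C2 \<inter> (L \<inter> ?E i))"
      by (rule indep_setD[OF indep_\<eta>_B_\<Lambda> C2[unfolded se] EL, symmetric])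
    finally show ?thesis unfolding e1 e2 .
  qed
  then show ?thesis
    using prob_eq_sum_patterns[OF sets.Int[OF LM A1] T, of N] prob_eq_sum_patterns[OF sets.Int[OF LM A2] T, of N]
    by (simp add: sum_mono)
qed

end

section \<open>Passage to the limit\<close>

lemma (in prob_space) cond_probability_mono:
  assumes sub: "subalgebra M F" and [measurable]: "A \<in> events" "B \<in> events"
    and le: "\<And>L. L \<in> sets F \<Longrightarrow> prob (L \<inter> A) \<le> prob (L \<inter> B)"
  shows "AE \<omega> in M. cond_probability M F A \<omega> \<le> cond_probability M F B \<omega>"
proof -
  interpret F: finite_measure_subalgebra M F
    using sub by unfold_locales
  let ?f = "cond_probability M F A" and ?g = "cond_probability M F B"
  have int: "integrable M (indicator C :: 'a \<Rightarrow> real)" if "C \<in> events" for C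
    using that by (intro integrable_real_indicator) (auto simp: emeasure_eq_measure)
  have fF [measurable]: "?f \<in> borel_measurable F" "?g \<in> borel_measurable F"
    by (auto simp: cond_probability_def)
  have fi: "integrable M ?f" "integrable M ?g"
    unfolding cond_probability_def using int[OF assms(2)] int[OF assms(3)] F.real_cond_exp_int(1) by auto
  have spF: "space F = space M" using sub by (simp add: subalgebra_def)
  \<comment> \<open>The inequality is tested on the very event where it fails. There the difference
    is positive, yet its integral is at most 0, so this event is null.\<close>
  define L where "L = {\<omega>\<in>space F. ?f \<omega> > ?g \<omega>}"
  have LF: "L \<in> sets F" unfolding L_def by measurable
  then have L_ev [measurable]: "L \<in> events" using sub by (auto simp: subalgebra_def)
  have intL: "(\<integral>\<omega>\<in>L. cond_probability M F C \<omega> \<partial>M) = prob (L \<inter> C)" if C: "C \<in> events" for C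
  proof -
    have "(\<integral>\<omega>\<in>L. cond_probability M F C \<omega> \<partial>M) = (\<integral>\<omega>\<in>L. indicator C \<omega> \<partial>M)"
      unfolding cond_probability_def by (rule F.real_cond_exp_intA[OF int[OF C] LF, symmetric])
    also have "\<dots> = (\<integral>\<omega>. indicator (L \<inter> C) \<omega> \<partial>M)"
      unfolding set_lebesgue_integral_def
      by (intro Bochner_Integration.integral_cong) (auto simp: indicator_def)
    also have "\<dots> = prob (L \<inter> C)"
      using C sets.sets_into_space[OF C] by (simp add: Int_absorb2 Int_assoc)
    finally show ?thesis .
  qed
  let ?h = "\<lambda>\<omega>. indicator L \<omega> *\<^sub>R (?f \<omega> - ?g \<omega>)"
  have hi: "integrable M ?h"
    using fi by (intro integrable_mult_indicator) auto
  have "(\<integral>\<omega>. ?h \<omega> \<partial>M) = (\<integral>\<omega>\<in>L. ?f \<omega> \<partial>M) - (\<integral>\<omega>\<in>L. ?g \<omega> \<partial>M)"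
    unfolding set_lebesgue_integral_def scaleR_diff_right
    by (intro Bochner_Integration.integral_diff integrable_mult_indicator L_ev fi)
  also have "\<dots> \<le> 0" using le[OF LF] by (simp add: intL)
  finally have "(\<integral>\<omega>. ?h \<omega> \<partial>M) \<le> 0" .
  moreover have h0: "0 \<le> ?h \<omega>" for \<omega> by (auto simp: L_def indicator_def)
  moreover have "0 \<le> (\<integral>\<omega>. ?h \<omega> \<partial>M)" using h0 by (intro integral_nonneg_AE AE_I2)
  ultimately have "(\<integral>\<omega>. ?h \<omega> \<partial>M) = 0" by linarith
  then have "AE \<omega> in M. ?h \<omega> = 0"
    using integral_nonneg_eq_0_iff_AE[OF hi] h0 by simp
  then show ?thesis
    using AE_space by eventually_elim (auto simp: L_def spF indicator_def split: if_splits)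
qed

lemma (in prob_space) cond_probability_cong_AE:
  assumes "subalgebra M F" and [measurable]: "A \<in> events" "B \<in> events"
    and eq: "AE \<omega> in M. \<omega> \<in> A \<longleftrightarrow> \<omega> \<in> B"
  shows "AE \<omega> in M. cond_probability M F A \<omega> = cond_probability M F B \<omega>"
proof -
  interpret F: finite_measure_subalgebra M F
    using assms(1) by unfold_locales
  show ?thesis unfolding cond_probability_def
    by (rule F.real_cond_exp_cong) (use eq in \<open>auto simp: indicator_def\<close>)
qed

text \<open>Dominated convergence for indicators; it converts errors that disappear at each sample
  point into vanishing probabilities.\<close>

lemma (in prob_space) prob_tendsto_0:
  assumes [measurable]: "\<And>n. E n \<in> events"
    and ev: "\<And>\<omega>. \<omega> \<in> space M \<Longrightarrow> \<forall>\<^sub>F n in sequentially. \<omega> \<notin> E n"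
  shows "(\<lambda>n. prob (E n)) \<longlonglongrightarrow> 0"
proof -
  have "(\<lambda>n. \<integral>\<omega>. indicator (E n) \<omega> \<partial>M) \<longlonglongrightarrow> (\<integral>\<omega>. (0::real) \<partial>M)"
  proof (rule integral_dominated_convergence[where w="\<lambda>_. 1"])
    show "AE \<omega> in M. (\<lambda>n. indicator (E n) \<omega> :: real) \<longlonglongrightarrow> 0"
    proof (rule AE_I2)
      fix \<omega> assume "\<omega> \<in> space M"
      from ev[OF this] show "(\<lambda>n. indicator (E n) \<omega> :: real) \<longlonglongrightarrow> 0"
        by (intro tendsto_eventually) (auto elim: eventually_mono)
    qed
  qed (auto simp: indicator_def)
  then show ?thesis
    using sets.sets_into_space[OF assms(1)] by (simp add: Int_absorb2)
qed

section \<open>Grid points, dyadic times and continuous paths\<close>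

lemma elementary_integral_grid:
  assumes "0 < T" "j \<le> N"
  shows "elementary_integral Z N (grid T N) \<xi> (grid T N j) \<omega> =
    (\<Sum>k<j. \<xi> k \<omega> * (Z (grid T N (Suc k)) \<omega> - Z (grid T N k) \<omega>))"
proof -
  have "elementary_integral Z N (grid T N) \<xi> (grid T N j) \<omega> =
    (\<Sum>k<N. if k < j then \<xi> k \<omega> * (Z (grid T N (Suc k)) \<omega> - Z (grid T N k) \<omega>) else 0)"
    unfolding elementary_integral_def
  proof (intro sum.cong refl)
    fix k
    show "\<xi> k \<omega> * (Z (min (grid T N j) (grid T N (Suc k))) \<omega> - Z (min (grid T N j) (grid T N k)) \<omega>) =
      (if k < j then \<xi> k \<omega> * (Z (grid T N (Suc k)) \<omega> - Z (grid T N k) \<omega>) else 0)"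
      using grid_mono[OF assms(1), of "Suc k" j N] grid_mono[OF assms(1), of k j N]
        grid_mono[OF assms(1), of j k N] grid_mono[OF assms(1), of j "Suc k" N]
      by (auto simp: min_absorb1 min_absorb2)
  qed
  also have "\<dots> = (\<Sum>k<j. \<xi> k \<omega> * (Z (grid T N (Suc k)) \<omega> - Z (grid T N k) \<omega>))"
    using assms(2) by (intro sum.mono_neutral_cong_right) auto
  finally show ?thesis .
qed

text \<open>Powers of two make the levels nested. Time 0 is left out because the grid comparison
  concerns positive times; it is still a limit of dyadic times.\<close>

definition dyadics :: "real \<Rightarrow> nat \<Rightarrow> real set" where
  "dyadics T m = grid T (2 ^ m) ` {1..2 ^ m}"

lemma finite_dyadics: "finite (dyadics T m)"
  by (simp add: dyadics_def)

lemma dyadics_subset: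
  assumes "0 < T"
  shows "dyadics T m \<subseteq> {0<..T}"
  using assms by (auto simp: dyadics_def grid_def field_simps)

lemma grid_refine: "0 < c \<Longrightarrow> grid T (N * c) (j * c) = grid T N j"
  by (simp add: grid_def)

lemma dyadics_mono:
  assumes "m \<le> n"
  shows "dyadics T m \<subseteq> dyadics T n"
proof -
  have p: "(2::nat) ^ n = 2 ^ m * 2 ^ (n - m)" using assms by (simp flip: power_add)
  show ?thesis
  proof
    fix t assume "t \<in> dyadics T m"
    then obtain j where j: "1 \<le> j" "j \<le> 2 ^ m" "t = grid T (2 ^ m) j" by (auto simp: dyadics_def)
    then have "t = grid T (2 ^ n) (j * 2 ^ (n - m))" by (simp add: p grid_refine)
    moreover have "j * 2 ^ (n - m) \<in> {1..2 ^ n}" using j by (simp add: p)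
    ultimately show "t \<in> dyadics T n" by (auto simp: dyadics_def)
  qed
qed

lemma dyadics_dense:
  assumes T: "0 < T" and t: "0 \<le> t" "t \<le> T"
  obtains s where "\<And>m. s m \<in> dyadics T m" "s \<longlonglongrightarrow> t"
proof -
  have "\<exists>u\<in>dyadics T m. t \<le> u \<and> u \<le> t + T / 2 ^ m" for m
  proof (cases "t = 0")
    \<comment> \<open>Time 0 lies in no cell; the first grid point takes the place of a right cell
      end.\<close>
    case True
    then show ?thesis using T
      by (intro bexI[of _ "grid T (2 ^ m) 1"]) (auto simp: dyadics_def grid_def)
  next
    case False
    then have "0 < t" using t by simp
    then obtain k where k: "k < 2 ^ m" "grid T (2 ^ m) k < t" "t \<le> grid T (2 ^ m) (Suc k)"
      using obtain_grid_cell[of t T "2 ^ m"] t by auto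
    have "grid T (2 ^ m) (Suc k) \<in> dyadics T m"
      unfolding dyadics_def using k(1) by (intro imageI) auto
    moreover have "grid T (2 ^ m) (Suc k) \<le> t + T / 2 ^ m"
      using k(2) by (simp add: grid_Suc)
    ultimately show ?thesis using k(3) by blast
  qed
  then obtain s where s: "\<And>m. s m \<in> dyadics T m" "\<And>m. t \<le> s m" "\<And>m. s m \<le> t + T / 2 ^ m"
    by metis
  have "(\<lambda>m. t + T / 2 ^ m) \<longlonglongrightarrow> t + 0"
    using LIMSEQ_divide_realpow_zero[of 2 T] by (intro tendsto_add tendsto_const) auto
  then have "s \<longlonglongrightarrow> t"
    using s by (intro tendsto_sandwich[of "\<lambda>_. t" s sequentially "\<lambda>m. t + T / 2 ^ m"]) auto
  with s(1) show ?thesis by (rule that)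
qed

text \<open>A weak inequality survives limits along dyadic times, a strict one does not; this is why
  positivity is handled through bounds \<open>e\<close>.\<close>

lemma continuous_ge_if_dyadics:
  fixes V :: "real \<Rightarrow> real"
  assumes T: "0 < T" and V: "continuous_on {0..T} V" and le: "\<And>m u. u \<in> dyadics T m \<Longrightarrow> e \<le> V u"
    and t: "t \<in> {0..T}"
  shows "e \<le> V t"
proof -
  from dyadics_dense[OF T] t obtain s where s: "\<And>m. s m \<in> dyadics T m" "s \<longlonglongrightarrow> t" by auto
  have "s m \<in> {0..T}" for m using s(1)[of m] dyadics_subset[OF T, of m] by auto
  then have "(\<lambda>m. V (s m)) \<longlonglongrightarrow> V t"
    by (intro continuous_on_tendsto_compose[OF V s(2) t]) simp
  then show ?thesis using le[OF s(1)] by (intro LIMSEQ_le_const) auto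
qed

text \<open>A positive continuous function on a compact interval is bounded away from 0. Positivity
  at all times thus becomes a countable condition, which gives measurability and an increasing limit
  in \<open>r\<close>.\<close>

lemma continuous_pos_iff_dyadics:
  fixes V :: "real \<Rightarrow> real"
  assumes T: "0 < T" and V: "continuous_on {0..T} V"
  shows "(\<forall>t\<in>{0..T}. 0 < V t) \<longleftrightarrow> (\<exists>r. \<forall>m. \<forall>t\<in>dyadics T m. 1 / real (Suc r) \<le> V t)"
proof
  assume pos: "\<forall>t\<in>{0..T}. 0 < V t"
  obtain u where u: "u \<in> {0..T}" "\<forall>t\<in>{0..T}. V u \<le> V t"
    using continuous_attains_inf[OF _ _ V] T by auto
  obtain r where r: "1 / real (Suc r) < V u"
    using pos u(1) reals_Archimedean[of "V u"] by (auto simp: inverse_eq_divide)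
  have "1 / real (Suc r) \<le> V t" if "t \<in> dyadics T m" for t m
  proof -
    have "t \<in> {0..T}" using that dyadics_subset[OF T, of m] by auto
    then have "V u \<le> V t" using u(2) by blast
    then show ?thesis using r by linarith
  qed
  then show "\<exists>r. \<forall>m. \<forall>t\<in>dyadics T m. 1 / real (Suc r) \<le> V t" by blast
next
  assume "\<exists>r. \<forall>m. \<forall>t\<in>dyadics T m. 1 / real (Suc r) \<le> V t"
  then obtain r where r: "\<And>m t. t \<in> dyadics T m \<Longrightarrow> 1 / real (Suc r) \<le> V t" by blast
  show "\<forall>t\<in>{0..T}. 0 < V t"
  proof
    fix t assume "t \<in> {0..T}"
    then have "1 / real (Suc r) \<le> V t" using continuous_ge_if_dyadics[OF T V] r by blast
    moreover have "0 < 1 / real (Suc r)" by simp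
    ultimately show "0 < V t" by linarith
  qed
qed

lemma INF_pos_iff:
  fixes V :: "real \<Rightarrow> real"
  assumes T: "0 < T" and V: "continuous_on {0..T} V"
  shows "(INF t\<in>{0..T}. V t) > 0 \<longleftrightarrow> (\<forall>t\<in>{0..T}. 0 < V t)"
proof -
  obtain u where u: "u \<in> {0..T}" "\<forall>t\<in>{0..T}. V u \<le> V t"
    using continuous_attains_inf[OF _ _ V] T by auto
  have "(INF t\<in>{0..T}. V t) = V u"
    using u by (intro cInf_eq_minimum) auto
  then show ?thesis using u by force
qed

lemma sets_all_pos:
  fixes V :: "real \<Rightarrow> 'a \<Rightarrow> real"
  assumes T: "0 < T" and V: "\<And>\<omega>. \<omega> \<in> space M \<Longrightarrow> continuous_on {0..T} (\<lambda>t. V t \<omega>)"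
    and Vm: "\<And>t. t \<in> {0..T} \<Longrightarrow> V t \<in> borel_measurable M"
  shows "{\<omega>\<in>space M. \<forall>t\<in>{0..T}. 0 < V t \<omega>} \<in> sets M"
proof -
  have "{\<omega>\<in>space M. \<forall>t\<in>dyadics T m. 1 / real (Suc r) \<le> V t \<omega>} \<in> sets M" for m r
  proof (rule sets.sets_Collect_finite_All[OF _ finite_dyadics])
    fix t assume "t \<in> dyadics T m"
    then have [measurable]: "V t \<in> borel_measurable M" using dyadics_subset[OF T, of m] by (intro Vm) auto
    show "{\<omega>\<in>space M. 1 / real (Suc r) \<le> V t \<omega>} \<in> sets M" by measurable
  qed
  then have "{\<omega>\<in>space M. \<exists>r. \<forall>m. \<forall>t\<in>dyadics T m. 1 / real (Suc r) \<le> V t \<omega>} \<in> sets M"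
    by (intro sets.sets_Collect_countable_Ex sets.sets_Collect_countable_All)
  also have "{\<omega>\<in>space M. \<exists>r. \<forall>m. \<forall>t\<in>dyadics T m. 1 / real (Suc r) \<le> V t \<omega>} =
      {\<omega>\<in>space M. \<forall>t\<in>{0..T}. 0 < V t \<omega>}"
    using continuous_pos_iff_dyadics[OF T V] by (intro Collect_cong conj_cong refl) simp
  finally show ?thesis .
qed

text \<open>The delicate direction excludes hits accumulating at \<open>T\<close> from the right,
  which would make the infimum equal to \<open>T\<close>: since
  \<open>X T \<omega> \<noteq> a\<close>, continuity gives a gap \<open>d\<close> after
  \<open>T\<close> without hits.\<close>

lemma hitting_time_gt_iff:
  assumes T: "0 < T" and X: "continuous_on {0..} (\<lambda>t. X t \<omega>)"
  shows "hitting_time X a \<omega> > ereal T \<longleftrightarrow> (\<forall>t\<in>{0<..T}. X t \<omega> \<noteq> a)"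
proof
  assume gt: "hitting_time X a \<omega> > ereal T"
  show "\<forall>t\<in>{0<..T}. X t \<omega> \<noteq> a"
  proof (intro ballI notI)
    fix t assume "t \<in> {0<..T}" "X t \<omega> = a"
    then have "hitting_time X a \<omega> \<le> ereal t" unfolding hitting_time_def by (intro INF_lower) auto
    then show False using gt \<open>t \<in> {0<..T}\<close> by (metis ereal_less_eq(3) greaterThanAtMost_iff leD order_trans)
  qed
next
  assume ne: "\<forall>t\<in>{0<..T}. X t \<omega> \<noteq> a"
  then have "X T \<omega> \<noteq> a" using T by auto
  moreover have "((\<lambda>t. X t \<omega>) \<longlongrightarrow> X T \<omega>) (at T within {0..})"
    using X T by (auto simp: continuous_on_def)
  ultimately have "\<forall>\<^sub>F t in at T within {0..}. X t \<omega> \<noteq> a" by (intro tendsto_imp_eventually_ne)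
  then obtain d where d: "0 < d" "\<And>t. t \<in> {0..} \<Longrightarrow> t \<noteq> T \<Longrightarrow> dist t T < d \<Longrightarrow> X t \<omega> \<noteq> a"
    unfolding eventually_at by auto
  have "ereal (T + d) \<le> hitting_time X a \<omega>"
    unfolding hitting_time_def
  proof (rule INF_greatest)
    fix t assume t: "t \<in> {t. 0 < t \<and> X t \<omega> = a}"
    have "\<not> t < T + d"
    proof
      assume "t < T + d"
      then show False
        using t ne d(2)[of t] by (cases "t \<le> T") (auto simp: dist_real_def)
    qed
    then show "ereal (T + d) \<le> ereal t" by simp
  qed
  moreover have "ereal T < ereal (T + d)" using d(1) by simp
  ultimately show "hitting_time X a \<omega> > ereal T" by (rule order_less_le_trans[rotated])
qed

text \<open>Rounding \<open>\<tau>\<close> up to multiples of \<open>1 / Suc n\<close> gives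
  countably many times, so measurability at fixed times is enough; continuity of paths removes the
  rounding.\<close>

lemma (in brownian) measurable_B_random_time:
  assumes [measurable]: "\<tau> \<in> borel_measurable M" and \<tau>: "\<And>\<omega>. \<omega> \<in> space M \<Longrightarrow> 0 \<le> \<tau> \<omega>"
  shows "(\<lambda>\<omega>. B (\<tau> \<omega>) \<omega>) \<in> borel_measurable M"
proof -
  define k where "k n \<omega> = nat \<lceil>real (Suc n) * \<tau> \<omega>\<rceil>" for n \<omega>
  have k_meas: "k n \<in> measurable M (count_space UNIV)" for n
    unfolding k_def by measurable
  have meas: "(\<lambda>\<omega>. B (real (k n \<omega>) / real (Suc n)) \<omega>) \<in> borel_measurable M" for n
    using measurable_compose_countable[where f="\<lambda>i \<omega>. B (real i / real (Suc n)) \<omega>", OF _ k_meas]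
    by (simp add: measurable_B)
  have lim: "(\<lambda>n. B (real (k n \<omega>) / real (Suc n)) \<omega>) \<longlonglongrightarrow> B (\<tau> \<omega>) \<omega>" if \<omega>: "\<omega> \<in> space M" for \<omega>
  proof -
    have r: "real (k n \<omega>) = of_int \<lceil>real (Suc n) * \<tau> \<omega>\<rceil>" for n
      using \<tau>[OF \<omega>] by (simp add: k_def)
    have le: "\<tau> \<omega> \<le> real (k n \<omega>) / real (Suc n)" for n
      using le_of_int_ceiling[of "real (Suc n) * \<tau> \<omega>"] unfolding r by (simp add: pos_le_divide_eq mult.commute)
    have ge: "real (k n \<omega>) / real (Suc n) \<le> \<tau> \<omega> + 1 / real (Suc n)" for n
    proof -
      have "real (k n \<omega>) \<le> real (Suc n) * \<tau> \<omega> + 1" unfolding r by linarith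
      then have "real (k n \<omega>) / real (Suc n) \<le> (real (Suc n) * \<tau> \<omega> + 1) / real (Suc n)"
        by (rule divide_right_mono) simp
      then show ?thesis by (simp add: add_divide_distrib)
    qed
    have "(\<lambda>n. \<tau> \<omega> + 1 / real (Suc n)) \<longlonglongrightarrow> \<tau> \<omega> + 0"
      using LIMSEQ_inverse_real_of_nat by (intro tendsto_add tendsto_const) (simp add: inverse_eq_divide)
    then have up: "(\<lambda>n. \<tau> \<omega> + 1 / real (Suc n)) \<longlonglongrightarrow> \<tau> \<omega>" by simp
    have "(\<lambda>n. real (k n \<omega>) / real (Suc n)) \<longlonglongrightarrow> \<tau> \<omega>"
      by (rule tendsto_sandwich[OF always_eventually[OF allI[OF le]] always_eventually[OF allI[OF ge]] tendsto_const up])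
    then show ?thesis
      using continuous_on_tendsto_compose[OF continuous_B[OF \<omega>], of "\<lambda>n. real (k n \<omega>) / real (Suc n)" "\<tau> \<omega>"] \<tau>[OF \<omega>]
      by simp
  qed
  show ?thesis by (rule borel_measurable_LIMSEQ_real[OF lim meas])
qed

section \<open>Occupation times and versions of the integral\<close>

context regime_switching
begin

definition occ :: "real \<Rightarrow> 'a \<Rightarrow> real" where
  "occ t \<omega> = (LBINT s:{0..t}. if \<Lambda> s \<omega> = 0 then 1 else 0)"

text \<open>On two states every function is affine in the indicator of state 0: \<open>g i\<close>
  equals \<open>g 1 + (g 0 - g 1) * (if i = 0 then 1 else 0)\<close>.\<close>

lemma chain_integral_eq:
  fixes g :: "2 \<Rightarrow> real"
  assumes \<omega>: "\<omega> \<in> space M" and t: "0 \<le> t"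
  shows "(LBINT s:{0..t}. g (\<Lambda> s \<omega>)) = g 0 * occ t \<omega> + g 1 * (t - occ t \<omega>)"
proof -
  have exhaust: "x = 0 \<or> x = 1" for x :: 2 using exhaust_2[of x] by auto
  have int: "set_integrable lborel {0..t} (\<lambda>s. if \<Lambda> s \<omega> = 0 then 1 else 0 :: real)"
    by (rule set_integrable_chain[OF \<omega>, of t "\<lambda>i. if i = 0 then 1 else 0"])
  have intc: "set_integrable lborel {0..t} (\<lambda>s. g 1)"
    by (rule set_integrable_chain[OF \<omega>, of t "\<lambda>i. g 1"])
  have "(LBINT s:{0..t}. g (\<Lambda> s \<omega>)) = (LBINT s:{0..t}. g 1 + (g 0 - g 1) * (if \<Lambda> s \<omega> = 0 then 1 else 0))"
  proof (rule set_lebesgue_integral_cong)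
    show "\<forall>s. s \<in> {0..t} \<longrightarrow> g (\<Lambda> s \<omega>) = g 1 + (g 0 - g 1) * (if \<Lambda> s \<omega> = 0 then 1 else 0)"
      using exhaust by fastforce
  qed simp
  also have "\<dots> = (LBINT s:{0..t}. g 1) + (LBINT s:{0..t}. (g 0 - g 1) * (if \<Lambda> s \<omega> = 0 then 1 else 0))"
    using intc int by (intro set_integral_add) auto
  also have "\<dots> = g 1 * t + (g 0 - g 1) * occ t \<omega>"
    using t by (simp add: occ_def set_lebesgue_integral_def)
  finally show ?thesis by (simp add: algebra_simps)
qed

lemma occupation_time_eq_integral:
  assumes "\<omega> \<in> space M"
  shows "occupation_time \<Lambda> i t \<omega> = (LBINT s:{0..t}. if \<Lambda> s \<omega> = i then 1 else 0)"
proof -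
  have "(LBINT s:{0..t}. if \<Lambda> s \<omega> = i then 1 else 0 :: real) = (\<integral>s. indicator {s\<in>{0..t}. \<Lambda> s \<omega> = i} s \<partial>lborel)"
    unfolding set_lebesgue_integral_def by (intro Bochner_Integration.integral_cong) (auto simp: indicator_def)
  then show ?thesis by (simp add: occupation_time_def)
qed

lemma occupation_time_0: "\<omega> \<in> space M \<Longrightarrow> occupation_time \<Lambda> 0 t \<omega> = occ t \<omega>"
  by (simp add: occupation_time_eq_integral occ_def)

lemma occupation_time_1: "\<omega> \<in> space M \<Longrightarrow> 0 \<le> t \<Longrightarrow> occupation_time \<Lambda> 1 t \<omega> = t - occ t \<omega>"
  using chain_integral_eq[of \<omega> t "\<lambda>i. if i = 1 then 1 else 0"] by (simp add: occupation_time_eq_integral)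

lemma occ_nonneg: "\<omega> \<in> space M \<Longrightarrow> 0 \<le> occ t \<omega>"
  using occupation_time_0[of \<omega> t] by (simp add: occupation_time_def flip: occupation_time_0)

lemma continuous_occ: "\<omega> \<in> space M \<Longrightarrow> continuous_on {0..} (\<lambda>t. occ t \<omega>)"
  unfolding occ_def by (rule chain_integral_continuous[of \<omega> "\<lambda>i. if i = 0 then 1 else 0"])

text \<open>The clock of the sampled chain. Given the samples, the stochastic sum at a grid time
  \<open>t\<close> has variance \<open>(\<sigma> 1)\<^sup>2 * t\<close> plus
  \<open>(\<sigma> 0)\<^sup>2 - (\<sigma> 1)\<^sup>2\<close> times this clock, without
  discretisation error.\<close>

definition occ_grid :: "real \<Rightarrow> nat \<Rightarrow> real \<Rightarrow> 'a \<Rightarrow> real" where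
  "occ_grid T N = elementary_integral (\<lambda>t \<omega>. t) N (grid T N) (sample T N (\<lambda>i. if i = 0 then 1 else 0))"

lemma occ_grid_tendsto:
  assumes "\<omega> \<in> space M" "0 \<le> t" "t \<le> T" "0 < T"
  shows "(\<lambda>N. occ_grid T N t \<omega>) \<longlonglongrightarrow> occ t \<omega>"
  unfolding occ_grid_def occ_def
  by (rule chain_integral_tendsto[OF assms, of "\<lambda>i. if i = 0 then 1 else 0"])

lemma occ_grid_measurable:
  assumes "0 < T"
  shows "occ_grid T N t \<in> borel_measurable M"
  unfolding occ_grid_def elementary_integral_def using assms
  by (intro borel_measurable_sum borel_measurable_times sample_measurable borel_measurable_const)

lemma occ_grid_nonneg:
  assumes "0 < T"
  shows "0 \<le> occ_grid T N t \<omega>"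
  unfolding occ_grid_def elementary_integral_def
proof (intro sum_nonneg mult_nonneg_nonneg)
  fix k show "0 \<le> min t (grid T N (Suc k)) - min t (grid T N k)"
    using grid_mono[OF assms, of k "Suc k" N] by auto
qed (simp add: sample_def)

lemma occ_measurable:
  assumes "0 \<le> t"
  shows "occ t \<in> borel_measurable M"
proof (rule borel_measurable_LIMSEQ_real)
  \<comment> \<open>The horizon \<open>t + 1\<close> is positive even for
    \<open>t = 0\<close>.\<close>
  show "(\<lambda>N. occ_grid (t + 1) N t \<omega>) \<longlonglongrightarrow> occ t \<omega>" if "\<omega> \<in> space M" for \<omega>
    using that assms by (intro occ_grid_tendsto) auto
  show "occ_grid (t + 1) N t \<in> borel_measurable M" for N
    using assms by (intro occ_grid_measurable) simp
qed

lemma ito_integral_continuous: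
  "ito_integral M F B H J \<Longrightarrow> \<omega> \<in> space M \<Longrightarrow> continuous_on {0..} (\<lambda>t. J t \<omega>)"
  by (simp add: ito_integral_def)

text \<open>Almost sure equality holds simultaneously at the countably many dyadic times, and
  continuity extends it to the interval, applied to the difference and to its negative.\<close>

lemma ito_integral_indistinguishable:
  assumes J: "ito_integral M (natural_filtration M B \<Lambda>) B (\<lambda>s \<omega>. g (\<Lambda> s \<omega>)) J"
    and J': "ito_integral M (natural_filtration M B \<Lambda>) B (\<lambda>s \<omega>. g (\<Lambda> s \<omega>)) J'"
    and T: "0 < T"
  shows "AE \<omega> in M. \<forall>t\<in>{0..T}. J t \<omega> = J' t \<omega>"
proof -
  have cont: "continuous_on {0..T} (\<lambda>t. J t \<omega> - J' t \<omega>)" if "\<omega> \<in> space M" for \<omega>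
    by (intro continuous_on_diff continuous_on_subset[OF ito_integral_continuous[OF J that]]
        continuous_on_subset[OF ito_integral_continuous[OF J' that]]) auto
  have "AE \<omega> in M. \<forall>m. \<forall>t\<in>dyadics T m. J t \<omega> = J' t \<omega>"
    unfolding AE_all_countable
  proof
    fix m
    show "AE \<omega> in M. \<forall>t\<in>dyadics T m. J t \<omega> = J' t \<omega>"
      using dyadics_subset[OF T, of m]
      by (intro AE_finite_allI finite_dyadics ito_integral_unique[OF J J']) auto
  qed
  with AE_space show ?thesis
  proof eventually_elim
    case (elim \<omega>)
    show ?case
    proof
      fix t assume t: "t \<in> {0..T}"
      have "0 \<le> J t \<omega> - J' t \<omega>"
        using elim by (intro continuous_ge_if_dyadics[OF T cont _ t]) auto
      moreover have "0 \<le> - (J t \<omega> - J' t \<omega>)"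
        using elim by (intro continuous_ge_if_dyadics[OF T continuous_on_minus[OF cont] _ t]) auto
      ultimately show "J t \<omega> = J' t \<omega>" by simp
    qed
  qed
qed

end

section \<open>From the grid to the interval\<close>

context regime_switching_normal
begin

context
  fixes \<sigma> :: "2 \<Rightarrow> real" and J :: "real \<Rightarrow> 'a \<Rightarrow> real" and T b d0 d1 :: real and L :: "'a set"
  assumes \<sigma>: "0 < \<sigma> 1" "\<sigma> 1 < \<sigma> 0" and T: "0 < T"
    and J: "ito_integral M (natural_filtration M B \<Lambda>) B (\<lambda>s \<omega>. \<sigma> (\<Lambda> s \<omega>)) J"
    and L: "L \<in> sets (process_sigma M (count_space UNIV) {0..} \<Lambda>)"
begin

text \<open>Drift and distance to the barrier as a function of time and of the occupation time
  \<open>u\<close> of state 0, so that the exact clock and the sampled clock can be inserted into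
  the same expression.\<close>

private definition "drift t u = d0 * u + d1 * (t - u) + b"

private definition "Y t \<omega> = J t \<omega> + drift t (occ t \<omega>)"

private definition "Z t \<omega> = sqrt ((\<sigma> 0)\<^sup>2 - (\<sigma> 1)\<^sup>2) * B (occ t \<omega>) \<omega> + sqrt t * \<sigma> 1 * \<eta> \<omega> + drift t (occ t \<omega>)"

private definition "YN N t \<omega> = elementary_integral B N (grid T N) (sample T N \<sigma>) t \<omega> + drift t (occ_grid T N t \<omega>)"

private definition "ZN N t \<omega> = sqrt ((\<sigma> 0)\<^sup>2 - (\<sigma> 1)\<^sup>2) * B (occ_grid T N t \<omega>) \<omega> + sqrt t * \<sigma> 1 * \<eta> \<omega> +
  drift t (occ_grid T N t \<omega>)"

private lemma L_events [measurable]: "L \<in> events"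
  using L subalgebra_\<Lambda> by auto

private lemma J_measurable: "0 \<le> t \<Longrightarrow> J t \<in> borel_measurable M"
  using J by (simp add: ito_integral_def)

private lemma drift_measurable: "u \<in> borel_measurable M \<Longrightarrow> (\<lambda>\<omega>. drift t (u \<omega>)) \<in> borel_measurable M"
  unfolding drift_def
  by (intro borel_measurable_add borel_measurable_times borel_measurable_diff borel_measurable_const)

private lemma Y_measurable: "0 \<le> t \<Longrightarrow> Y t \<in> borel_measurable M"
  unfolding Y_def by (intro borel_measurable_add J_measurable drift_measurable occ_measurable)

private lemma Z_measurable: "0 \<le> t \<Longrightarrow> Z t \<in> borel_measurable M"
  unfolding Z_def
  by (intro borel_measurable_add borel_measurable_times borel_measurable_const measurable_B_random_time
    measurable_\<eta> drift_measurable occ_measurable occ_nonneg)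

private lemma YN_measurable: "0 \<le> t \<Longrightarrow> YN N t \<in> borel_measurable M"
  unfolding YN_def
  by (intro borel_measurable_add elementary_integral_measurable elementary_sample T drift_measurable occ_grid_measurable)

private lemma ZN_measurable: "0 \<le> t \<Longrightarrow> ZN N t \<in> borel_measurable M"
  unfolding ZN_def
  by (intro borel_measurable_add borel_measurable_times borel_measurable_const measurable_B_random_time
    measurable_\<eta> drift_measurable occ_grid_measurable occ_grid_nonneg T)

private lemma Y_continuous: "\<omega> \<in> space M \<Longrightarrow> continuous_on {0..T} (\<lambda>t. Y t \<omega>)"
  unfolding Y_def drift_def
  by (intro continuous_intros continuous_on_subset[OF continuous_occ, of \<omega> "{0..T}"]
      continuous_on_subset[OF ito_integral_continuous[OF J], of \<omega> "{0..T}"]) auto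

private lemma Z_continuous: "\<omega> \<in> space M \<Longrightarrow> continuous_on {0..T} (\<lambda>t. Z t \<omega>)"
  unfolding Z_def drift_def
  by (intro continuous_intros continuous_on_subset[OF continuous_occ, of \<omega> "{0..T}"]
      continuous_on_compose2[OF continuous_B, of \<omega> "{0..T}" "\<lambda>t. occ t \<omega>"])
    (auto simp: occ_nonneg)

private lemma drift_tendsto:
  assumes "\<omega> \<in> space M" "0 \<le> t" "t \<le> T"
  shows "(\<lambda>N. drift t (occ_grid T N t \<omega>)) \<longlonglongrightarrow> drift t (occ t \<omega>)"
  unfolding drift_def by (intro tendsto_intros occ_grid_tendsto assms T)

private lemma ZN_tendsto:
  assumes "\<omega> \<in> space M" "0 \<le> t" "t \<le> T"
  shows "(\<lambda>N. ZN N t \<omega>) \<longlonglongrightarrow> Z t \<omega>"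
  unfolding ZN_def Z_def
proof (intro tendsto_intros drift_tendsto assms)
  show "(\<lambda>N. B (occ_grid T N t \<omega>) \<omega>) \<longlonglongrightarrow> B (occ t \<omega>) \<omega>"
    using assms T
    by (intro continuous_on_tendsto_compose[OF continuous_B[OF assms(1)] occ_grid_tendsto])
      (auto simp: occ_nonneg occ_grid_nonneg)
qed

private lemma grid_comparison:
  assumes N: "0 < N" and S: "S \<subseteq> grid T N ` {1..N}"
  shows "prob (L \<inter> {\<omega>\<in>space M. \<forall>t\<in>S. YN N t \<omega> > e}) \<le> prob (L \<inter> {\<omega>\<in>space M. \<forall>t\<in>S. ZN N t \<omega> > e})"
proof -
  obtain K where K: "K \<subseteq> {1..N}" "S = grid T N ` K" using S by (meson subset_image_iff)
  have fin: "finite K" using K(1) finite_subset by blast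
  \<comment> \<open>The drift moves into the threshold; its dependence on the clock is the second
    argument of \<open>f\<close>.\<close>
  define f where "f j u = e - drift (grid T N j) u" for j u
  let ?Y = "\<lambda>j \<omega>. \<Sum>k<j. sample T N \<sigma> k \<omega> * (B (grid T N (Suc k)) \<omega> - B (grid T N k) \<omega>)"
  let ?a = "\<lambda>j \<omega>. \<Sum>k<j. sample T N (\<lambda>i. if i = 0 then 1 else 0) k \<omega> * (grid T N (Suc k) - grid T N k)"
  have occ: "occ_grid T N (grid T N j) \<omega> = ?a j \<omega>" if "j \<in> K" for j \<omega>
    unfolding occ_grid_def using that K by (intro elementary_integral_grid T) auto
  have YY: "YN N (grid T N j) \<omega> > e \<longleftrightarrow> ?Y j \<omega> > f j (?a j \<omega>)" if "j \<in> K" for j \<omega>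
    unfolding YN_def f_def occ[OF that, symmetric]
    using elementary_integral_grid[OF T, of j N B "sample T N \<sigma>" \<omega>] that K(1) by (auto simp: field_simps)
  have ZZ: "ZN N (grid T N j) \<omega> > e \<longleftrightarrow>
      sqrt ((\<sigma> 0)\<^sup>2 - (\<sigma> 1)\<^sup>2) * B (?a j \<omega>) \<omega> + sqrt (grid T N j) * \<sigma> 1 * \<eta> \<omega> > f j (?a j \<omega>)" if "j \<in> K" for j \<omega>
    unfolding ZN_def f_def occ[OF that] by (auto simp: field_simps)
  have A1: "{\<omega>\<in>space M. \<forall>t\<in>S. YN N t \<omega> > e} = {\<omega>\<in>space M. \<forall>j\<in>K. ?Y j \<omega> > f j (?a j \<omega>)}"
    using YY by (auto simp: K(2))
  have A2: "{\<omega>\<in>space M. \<forall>t\<in>S. ZN N t \<omega> > e} =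
      {\<omega>\<in>space M. \<forall>j\<in>K. sqrt ((\<sigma> 0)\<^sup>2 - (\<sigma> 1)\<^sup>2) * B (?a j \<omega>) \<omega> + sqrt (grid T N j) * \<sigma> 1 * \<eta> \<omega> > f j (?a j \<omega>)}"
    using ZZ by (auto simp: K(2))
  have pos: "0 \<le> t" if "t \<in> S" for t using that K(2) grid_nonneg[OF T] by auto
  have finS: "finite S" using fin K(2) by simp
  have "{\<omega>\<in>space M. \<forall>t\<in>S. YN N t \<omega> > e} \<in> events"
    by (intro sets.sets_Collect_finite_All finS borel_measurable_less borel_measurable_const YN_measurable pos)
  moreover have "{\<omega>\<in>space M. \<forall>t\<in>S. ZN N t \<omega> > e} \<in> events"
    by (intro sets.sets_Collect_finite_All finS borel_measurable_less borel_measurable_const ZN_measurable pos)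
  ultimately show ?thesis unfolding A1 A2
    by (intro sampled_comparison[OF \<sigma> T N K(1) L])
qed

private lemma dyadic_comparison:
  assumes e: "0 < e"
  shows "prob (L \<inter> {\<omega>\<in>space M. \<forall>t\<in>dyadics T m. 2 * e \<le> Y t \<omega>}) \<le>
    prob (L \<inter> {\<omega>\<in>space M. \<forall>t\<in>dyadics T m. e \<le> Z t \<omega>})"
proof -
  let ?S = "dyadics T m"
  \<comment> \<open>All these grids contain the dyadic times of level \<open>m\<close>, so the set
    of times stays fixed while the mesh tends to 0.\<close>
  define N where "N n = (2::nat) ^ (m + n)" for n
  have N_lim: "filterlim N at_top sequentially"
    unfolding N_def by (intro filterlim_subseq strict_monoI) auto
  have S: "0 < t" "t \<le> T" if "t \<in> ?S" for t using dyadics_subset[OF T, of m] that by auto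
  have S': "0 \<le> t" if "t \<in> ?S" for t using S(1)[OF that] by simp
  define A where "A = {\<omega>\<in>space M. \<forall>t\<in>?S. 2 * e \<le> Y t \<omega>}"
  define AN where "AN n = {\<omega>\<in>space M. \<forall>t\<in>?S. YN (N n) t \<omega> > e}" for n
  define C where "C = {\<omega>\<in>space M. \<forall>t\<in>?S. e \<le> Z t \<omega>}"
  define CN where "CN n = {\<omega>\<in>space M. \<forall>t\<in>?S. ZN (N n) t \<omega> > e}" for n
  \<comment> \<open>\<open>P\<close> collects the error of the integral, which vanishes only in
    probability; the errors in \<open>Q\<close> and \<open>CN n - C\<close> disappear at every
    sample point.\<close>
  define P where "P n t = {\<omega>\<in>space M. e / 2 \<le> \<bar>J t \<omega> - elementary_integral B (N n) (grid T (N n)) (sample T (N n) \<sigma>) t \<omega>\<bar>}" for n t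
  define Q where "Q n t = {\<omega>\<in>space M. e / 2 \<le> \<bar>drift t (occ t \<omega>) - drift t (occ_grid T (N n) t \<omega>)\<bar>}" for n t
  note meas = borel_measurable_less borel_measurable_le borel_measurable_const borel_measurable_abs borel_measurable_diff
    sets.sets_Collect_finite_All finite_dyadics
  have A [measurable]: "A \<in> events" unfolding A_def by (intro meas Y_measurable S')
  have AN [measurable]: "AN n \<in> events" for n unfolding AN_def by (intro meas YN_measurable S')
  have C [measurable]: "C \<in> events" unfolding C_def by (intro meas Z_measurable S')
  have CN [measurable]: "CN n \<in> events" for n unfolding CN_def by (intro meas ZN_measurable S')
  have P [measurable]: "P n t \<in> events" if "t \<in> ?S" for n t
    unfolding P_def using that
    by (intro meas J_measurable elementary_integral_measurable elementary_sample T S')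
  have Q [measurable]: "Q n t \<in> events" if "t \<in> ?S" for n t
    unfolding Q_def using that by (intro meas drift_measurable occ_measurable occ_grid_measurable T S')
  have step: "prob (L \<inter> A) \<le> prob (L \<inter> C) + ((\<Sum>t\<in>?S. prob (P n t)) + (\<Sum>t\<in>?S. prob (Q n t)) + prob (CN n - C))" for n
  proof -
    have sub: "L \<inter> A \<subseteq> (L \<inter> AN n) \<union> ((\<Union>t\<in>?S. P n t) \<union> (\<Union>t\<in>?S. Q n t))"
    proof
      fix \<omega> assume \<omega>: "\<omega> \<in> L \<inter> A"
      then have sp: "\<omega> \<in> space M" by (simp add: A_def)
      show "\<omega> \<in> (L \<inter> AN n) \<union> ((\<Union>t\<in>?S. P n t) \<union> (\<Union>t\<in>?S. Q n t))"
      proof (cases "\<omega> \<in> (\<Union>t\<in>?S. P n t) \<union> (\<Union>t\<in>?S. Q n t)")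
        case False
        have "YN (N n) t \<omega> > e" if t: "t \<in> ?S" for t
        proof -
          have "\<bar>J t \<omega> - elementary_integral B (N n) (grid T (N n)) (sample T (N n) \<sigma>) t \<omega>\<bar> < e / 2"
            "\<bar>drift t (occ t \<omega>) - drift t (occ_grid T (N n) t \<omega>)\<bar> < e / 2"
            using False t sp by (auto simp: P_def Q_def not_le)
          moreover have "2 * e \<le> J t \<omega> + drift t (occ t \<omega>)" using \<omega> t by (auto simp: A_def Y_def)
          ultimately show ?thesis unfolding YN_def by linarith
        qed
        then show ?thesis using \<omega> sp by (auto simp: AN_def)
      qed blast
    qed
    have fin: "finite ?S" by (rule finite_dyadics)
    have [measurable]: "(\<Union>t\<in>?S. P n t) \<in> events" "(\<Union>t\<in>?S. Q n t) \<in> events"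
      by (intro sets.finite_UN fin P Q; assumption)+
    have "prob (L \<inter> A) \<le> prob ((L \<inter> AN n) \<union> ((\<Union>t\<in>?S. P n t) \<union> (\<Union>t\<in>?S. Q n t)))"
      using sub fin by (intro finite_measure_mono) auto
    also have "\<dots> \<le> prob (L \<inter> AN n) + prob ((\<Union>t\<in>?S. P n t) \<union> (\<Union>t\<in>?S. Q n t))"
      using fin by (intro measure_Un_le) auto
    also have "prob ((\<Union>t\<in>?S. P n t) \<union> (\<Union>t\<in>?S. Q n t)) \<le> prob (\<Union>t\<in>?S. P n t) + prob (\<Union>t\<in>?S. Q n t)"
      using fin by (intro measure_Un_le) auto
    also have "prob (\<Union>t\<in>?S. P n t) \<le> (\<Sum>t\<in>?S. prob (P n t))"
      using fin P by (intro finite_measure_subadditive_finite) auto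
    also have "prob (\<Union>t\<in>?S. Q n t) \<le> (\<Sum>t\<in>?S. prob (Q n t))"
      using fin Q by (intro finite_measure_subadditive_finite) auto
    also have "prob (L \<inter> AN n) \<le> prob (L \<inter> CN n)"
      unfolding AN_def CN_def
    proof (rule grid_comparison)
      show "?S \<subseteq> grid T (N n) ` {1..N n}"
        using dyadics_mono[of m "m + n" T] by (simp add: N_def dyadics_def)
    qed (simp add: N_def)
    also have "prob (L \<inter> CN n) \<le> prob ((L \<inter> C) \<union> (CN n - C))"
      by (intro finite_measure_mono) auto
    also have "\<dots> \<le> prob (L \<inter> C) + prob (CN n - C)"
      by (intro measure_Un_le) auto
    finally show ?thesis by simp
  qed
  have P_lim: "(\<lambda>n. prob (P n t)) \<longlonglongrightarrow> 0" if "t \<in> ?S" for t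
    unfolding P_def
    by (rule filterlim_compose[OF ito_integral_tendsto_prob[OF J S[OF that]] N_lim]) (use e in simp)
  have Q_lim: "(\<lambda>n. prob (Q n t)) \<longlonglongrightarrow> 0" if "t \<in> ?S" for t
  proof (rule prob_tendsto_0)
    fix \<omega> assume \<omega>: "\<omega> \<in> space M"
    have "(\<lambda>n. drift t (occ_grid T (N n) t \<omega>)) \<longlonglongrightarrow> drift t (occ t \<omega>)"
      using filterlim_compose[OF drift_tendsto[OF \<omega> S'[OF that] S(2)[OF that]] N_lim] .
    then have "\<forall>\<^sub>F n in sequentially. dist (drift t (occ_grid T (N n) t \<omega>)) (drift t (occ t \<omega>)) < e / 2"
      using e by (intro tendstoD) auto
    then show "\<forall>\<^sub>F n in sequentially. \<omega> \<notin> Q n t"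
      by eventually_elim (auto simp: Q_def dist_real_def abs_minus_commute)
  qed (use Q that in auto)
  have C_lim: "(\<lambda>n. prob (CN n - C)) \<longlonglongrightarrow> 0"
  proof (rule prob_tendsto_0)
    fix \<omega> assume \<omega>: "\<omega> \<in> space M"
    show "\<forall>\<^sub>F n in sequentially. \<omega> \<notin> CN n - C"
    proof (cases "\<omega> \<in> C")
      case False
      then obtain t where t: "t \<in> ?S" "Z t \<omega> < e" using \<omega> by (auto simp: C_def not_le)
      have "(\<lambda>n. ZN (N n) t \<omega>) \<longlonglongrightarrow> Z t \<omega>"
        using filterlim_compose[OF ZN_tendsto[OF \<omega> S'[OF t(1)] S(2)[OF t(1)]] N_lim] .
      then have "\<forall>\<^sub>F n in sequentially. ZN (N n) t \<omega> < e" using t(2) by (rule order_tendstoD)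
      then show ?thesis by eventually_elim (use t(1) less_asym in \<open>auto simp: CN_def\<close>)
    qed simp
  qed auto
  have "(\<lambda>n. prob (L \<inter> C) + ((\<Sum>t\<in>?S. prob (P n t)) + (\<Sum>t\<in>?S. prob (Q n t)) + prob (CN n - C))) \<longlonglongrightarrow>
      prob (L \<inter> C) + ((\<Sum>t\<in>?S. 0) + (\<Sum>t\<in>?S. 0) + 0)"
    by (intro tendsto_intros P_lim Q_lim C_lim)
  from LIMSEQ_le_const[OF this, of "prob (L \<inter> A)"] step
  have "prob (L \<inter> A) \<le> prob (L \<inter> C)" by simp
  then show ?thesis by (simp add: A_def C_def)
qed

text \<open>For fixed \<open>e\<close> the level \<open>m\<close> goes to infinity first: the events
  for \<open>Z\<close> decrease to one on which \<open>e \<le> Z\<close> on the whole interval, so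
  \<open>Z\<close> is positive. Then \<open>e\<close> decreases to 0: the events for
  \<open>Y\<close> increase, and by compactness their union is positivity of \<open>Y\<close>. The
  reverse order of limits would lose the uniform bound.\<close>

lemma survival_comparison:
  defines "V \<equiv> \<lambda>t \<omega>. J t \<omega> + (d0 * occ t \<omega> + d1 * (t - occ t \<omega>) + b)"
    and "V' \<equiv> \<lambda>t \<omega>. sqrt ((\<sigma> 0)\<^sup>2 - (\<sigma> 1)\<^sup>2) * B (occ t \<omega>) \<omega> + sqrt t * \<sigma> 1 * \<eta> \<omega> +
      (d0 * occ t \<omega> + d1 * (t - occ t \<omega>) + b)"
  shows "{\<omega>\<in>space M. \<forall>t\<in>{0..T}. 0 < V t \<omega>} \<in> events" (is ?th1)
    and "{\<omega>\<in>space M. \<forall>t\<in>{0..T}. 0 < V' t \<omega>} \<in> events" (is ?th2)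
    and "\<omega> \<in> space M \<Longrightarrow> continuous_on {0..T} (\<lambda>t. V t \<omega>)"
    and "\<omega> \<in> space M \<Longrightarrow> continuous_on {0..T} (\<lambda>t. V' t \<omega>)"
    and "prob (L \<inter> {\<omega>\<in>space M. \<forall>t\<in>{0..T}. 0 < V t \<omega>}) \<le> prob (L \<inter> {\<omega>\<in>space M. \<forall>t\<in>{0..T}. 0 < V' t \<omega>})"
proof -
  have VY: "V = Y" and VZ: "V' = Z"
    unfolding V_def V'_def Y_def[abs_def] Z_def[abs_def] drift_def by auto
  show EY: ?th1 and EZ: ?th2 unfolding VY VZ
    using sets_all_pos[OF T Y_continuous Y_measurable] sets_all_pos[OF T Z_continuous Z_measurable] by auto
  show "\<omega> \<in> space M \<Longrightarrow> continuous_on {0..T} (\<lambda>t. V t \<omega>)" "\<omega> \<in> space M \<Longrightarrow> continuous_on {0..T} (\<lambda>t. V' t \<omega>)"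
    unfolding VY VZ by (rule Y_continuous Z_continuous; assumption)+
  note EZ' [measurable] = EZ[unfolded VZ]
  define A where "A e = {\<omega>\<in>space M. \<forall>m. \<forall>t\<in>dyadics T m. e \<le> Y t \<omega>}" for e
  define C where "C m e = {\<omega>\<in>space M. \<forall>t\<in>dyadics T m. e \<le> Z t \<omega>}" for m e
  have pos: "0 \<le> t" if "t \<in> dyadics T m" for t m using that dyadics_subset[OF T, of m] by auto
  have Dm: "{\<omega>\<in>space M. \<forall>t\<in>dyadics T m. e \<le> Y t \<omega>} \<in> events" for m e
    by (intro sets.sets_Collect_finite_All finite_dyadics borel_measurable_le borel_measurable_const Y_measurable pos)
  have Am [measurable]: "A e \<in> events" for e
    unfolding A_def by (intro sets.sets_Collect_countable_All Dm)
  have Cm [measurable]: "C m e \<in> events" for m e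
    unfolding C_def
    by (intro sets.sets_Collect_finite_All finite_dyadics borel_measurable_le borel_measurable_const Z_measurable pos)
  let ?EY = "{\<omega>\<in>space M. \<forall>t\<in>{0..T}. 0 < Y t \<omega>}" and ?EZ = "{\<omega>\<in>space M. \<forall>t\<in>{0..T}. 0 < Z t \<omega>}"
  have AC: "prob (L \<inter> A (2 * e)) \<le> prob (L \<inter> ?EZ)" if e: "0 < e" for e
  proof -
    have "prob (L \<inter> A (2 * e)) \<le> prob (L \<inter> C m e)" for m
    proof -
      have "prob (L \<inter> A (2 * e)) \<le> prob (L \<inter> {\<omega>\<in>space M. \<forall>t\<in>dyadics T m. 2 * e \<le> Y t \<omega>})"
        using Dm by (intro finite_measure_mono) (auto simp: A_def)
      also have "\<dots> \<le> prob (L \<inter> C m e)"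
        unfolding C_def by (rule dyadic_comparison[OF e])
      finally show ?thesis .
    qed
    moreover have "(\<lambda>m. prob (L \<inter> C m e)) \<longlonglongrightarrow> prob (\<Inter>m. L \<inter> C m e)"
    proof (rule finite_Lim_measure_decseq)
      show "decseq (\<lambda>m. L \<inter> C m e)"
        unfolding decseq_def C_def using dyadics_mono[of _ _ T] by blast
    qed auto
    ultimately have "prob (L \<inter> A (2 * e)) \<le> prob (\<Inter>m. L \<inter> C m e)"
      by (intro LIMSEQ_le_const) auto
    also have "\<dots> \<le> prob (L \<inter> ?EZ)"
    proof (rule finite_measure_mono)
      show "(\<Inter>m. L \<inter> C m e) \<subseteq> L \<inter> ?EZ"
      proof
        fix \<omega> assume \<omega>: "\<omega> \<in> (\<Inter>m. L \<inter> C m e)"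
        then have sp: "\<omega> \<in> space M" and le: "\<And>m t. t \<in> dyadics T m \<Longrightarrow> e \<le> Z t \<omega>"
          by (auto simp: C_def)
        have "0 < Z t \<omega>" if "t \<in> {0..T}" for t
        proof -
          have "e \<le> Z t \<omega>" using continuous_ge_if_dyadics[OF T Z_continuous[OF sp]] le that by blast
          then show ?thesis using e by simp
        qed
        then show "\<omega> \<in> L \<inter> ?EZ" using \<omega> sp by auto
      qed
    qed auto
    finally show ?thesis .
  qed
  have "(\<lambda>r. prob (L \<inter> A (1 / real (Suc r)))) \<longlonglongrightarrow> prob (\<Union>r. L \<inter> A (1 / real (Suc r)))"
  proof (rule finite_Lim_measure_incseq)
    show "incseq (\<lambda>r. L \<inter> A (1 / real (Suc r)))"
    proof (rule incseq_SucI)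
      fix r
      have "1 / real (Suc (Suc r)) \<le> 1 / real (Suc r)" by (intro divide_left_mono) auto
      then show "L \<inter> A (1 / real (Suc r)) \<subseteq> L \<inter> A (1 / real (Suc (Suc r)))"
        unfolding A_def by (blast intro: order_trans)
    qed
  qed auto
  moreover have "prob (L \<inter> A (1 / real (Suc r))) \<le> prob (L \<inter> ?EZ)" for r
  proof -
    have "2 * (x / 2) = x" for x :: real by simp
    moreover have "prob (L \<inter> A (2 * (1 / real (Suc r) / 2))) \<le> prob (L \<inter> ?EZ)" by (rule AC) simp
    ultimately show ?thesis by (simp only:)
  qed
  ultimately have "prob (\<Union>r. L \<inter> A (1 / real (Suc r))) \<le> prob (L \<inter> ?EZ)"
    by (intro LIMSEQ_le_const2) auto
  moreover have "L \<inter> ?EY = (\<Union>r. L \<inter> A (1 / real (Suc r)))"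
    using continuous_pos_iff_dyadics[OF T Y_continuous] unfolding A_def by auto
  ultimately show "prob (L \<inter> {\<omega>\<in>space M. \<forall>t\<in>{0..T}. 0 < V t \<omega>}) \<le> prob (L \<inter> {\<omega>\<in>space M. \<forall>t\<in>{0..T}. 0 < V' t \<omega>})"
    unfolding VY VZ by simp
qed

end

end

(* The paths under INF are continuous on {0..T}, so each INF is a minimum. *)
theorem proposition3p4:
  fixes M :: "'a measure"
    and \<mu> \<sigma> rate \<Delta> :: "2 \<Rightarrow> real"
    and x a T :: real
    and B X J :: "real \<Rightarrow> 'a \<Rightarrow> real"
    and \<Lambda> :: "real \<Rightarrow> 'a \<Rightarrow> 2"
    and \<eta>\<^sub>0 :: "'a \<Rightarrow> real"
    and \<alpha> \<beta> :: "real \<Rightarrow> 'a \<Rightarrow> real"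
    and F\<^sub>\<Lambda> :: "'a measure"
  assumes "prob_space M"
    and "\<sigma> 0 > \<sigma> 1" and "\<sigma> 1 > 0"
    and "rate 0 > 0" and "rate 1 > 0"
    and "regime_switching_GBM M \<mu> \<sigma> rate x B \<Lambda> X"
    and "AE \<omega> in M. \<Lambda> 0 \<omega> = 0"
    and "volatility_integral M B \<Lambda> \<sigma> J"
    and "\<And>i. \<Delta> i = \<mu> i - (\<sigma> i)\<^sup>2 / 2"
    and "0 < a" and "a < x" and "T > 0"
    and "F\<^sub>\<Lambda> = process_sigma M (count_space UNIV) {0..T} \<Lambda>"
    and "\<alpha> = occupation_time \<Lambda> 0" and "\<beta> = occupation_time \<Lambda> 1"
    and "distributed M lborel \<eta>\<^sub>0 std_normal_density"
    and "prob_space.indep_set M (sets (vimage_algebra (space M) \<eta>\<^sub>0 borel))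
           (sets (process_sigma M (borel \<Otimes>\<^sub>M count_space UNIV) {0..} (\<lambda>t \<omega>. (B t \<omega>, \<Lambda> t \<omega>))))"
  shows "AE \<omega> in M.
    cond_probability M F\<^sub>\<Lambda> {\<omega>\<in>space M. hitting_time X a \<omega> > ereal T} \<omega> =
    cond_probability M F\<^sub>\<Lambda>
      {\<omega>\<in>space M. (INF t\<in>{0..T}. J t \<omega> + (LBINT s:{0..t}. \<Delta> (\<Lambda> s \<omega>)) - ln (a / x)) > 0} \<omega> \<and>
    cond_probability M F\<^sub>\<Lambda>
      {\<omega>\<in>space M. (INF t\<in>{0..T}. J t \<omega> + (LBINT s:{0..t}. \<Delta> (\<Lambda> s \<omega>)) - ln (a / x)) > 0} \<omega>
    \<le> cond_probability M F\<^sub>\<Lambda>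
      {\<omega>\<in>space M. (INF t\<in>{0..T}. sqrt ((\<sigma> 0)\<^sup>2 - (\<sigma> 1)\<^sup>2) * B (\<alpha> t \<omega>) \<omega> + sqrt t * \<sigma> 1 * \<eta>\<^sub>0 \<omega>
          + \<Delta> 0 * \<alpha> t \<omega> + \<Delta> 1 * \<beta> t \<omega> - ln (a / x)) > 0} \<omega>"
proof -
  interpret prob_space M by fact
  have GBM: "standard_brownian_motion M B" "markov_chain_Q M (two_state_Q rate) \<Lambda>"
    "indep_set (sets (process_sigma M borel {0..} B)) (sets (process_sigma M (count_space UNIV) {0..} \<Lambda>))"
    using assms(6) by (simp_all add: regime_switching_GBM_def)
  \<comment> \<open>The process \<open>X\<close> brings its own version \<open>J'\<close> of the
    integral, equal to \<open>J\<close> only outside a null set; the hitting event and the event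
    about \<open>J\<close> therefore agree almost surely.\<close>
  from assms(6) obtain J' where J'v: "volatility_integral M B \<Lambda> \<sigma> J'" and
    X: "\<And>t \<omega>. 0 \<le> t \<Longrightarrow> \<omega> \<in> space M \<Longrightarrow>
      X t \<omega> = x * exp ((LBINT s:{0..t}. \<mu> (\<Lambda> s \<omega>) - (\<sigma> (\<Lambda> s \<omega>))\<^sup>2 / 2) + J' t \<omega>)"
    unfolding regime_switching_GBM_def by blast
  interpret regime_switching M B \<Lambda>
    using GBM by unfold_locales (auto simp: markov_chain_Q_def)
  let ?BL = "process_sigma M (borel \<Otimes>\<^sub>M count_space UNIV) {0..} (\<lambda>t \<omega>. (B t \<omega>, \<Lambda> t \<omega>))"
  have BL: "(\<lambda>\<omega>. (B t \<omega>, \<Lambda> t \<omega>)) \<in> measurable ?BL (borel \<Otimes>\<^sub>M count_space UNIV)" if "0 \<le> t" for t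
    using that by (intro measurable_process_sigma[where X="\<lambda>t \<omega>. (B t \<omega>, \<Lambda> t \<omega>)"]) (auto simp: space_pair_measure)
  have "sets (process_sigma M borel {0..} B) \<subseteq> sets ?BL"
    using measurable_compose[OF BL measurable_fst] by (intro sets_process_sigma_le) auto
  moreover have "sets (process_sigma M (count_space UNIV) {0..} \<Lambda>) \<subseteq> sets ?BL"
    using measurable_compose[OF BL measurable_snd] by (intro sets_process_sigma_le) auto
  ultimately have "sigma_sets (space M) (sets (process_sigma M borel {0..} B) \<union>
      sets (process_sigma M (count_space UNIV) {0..} \<Lambda>)) \<subseteq> sets ?BL"
    using sets.sigma_sets_subset[of _ ?BL] by simp
  then interpret regime_switching_normal M B \<Lambda> \<eta>\<^sub>0
    using assms(16,17) by unfold_locales (auto intro: indep_set_mono)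
  have J: "ito_integral M (natural_filtration M B \<Lambda>) B (\<lambda>s \<omega>. \<sigma> (\<Lambda> s \<omega>)) J"
    and J': "ito_integral M (natural_filtration M B \<Lambda>) B (\<lambda>s \<omega>. \<sigma> (\<Lambda> s \<omega>)) J'"
    using assms(8) J'v by (simp_all add: volatility_integral_def)
  note T = \<open>T > 0\<close> and \<sigma> = \<open>\<sigma> 1 > 0\<close> \<open>\<sigma> 0 > \<sigma> 1\<close>
  define b where "b = - ln (a / x)"
  have x: "0 < x" using \<open>0 < a\<close> \<open>a < x\<close> by simp
  have drift: "(LBINT s:{0..t}. \<Delta> (\<Lambda> s \<omega>)) = \<Delta> 0 * occ t \<omega> + \<Delta> 1 * (t - occ t \<omega>)"
    if "\<omega> \<in> space M" "0 \<le> t" for t \<omega>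
    using that by (rule chain_integral_eq)
  let ?D = "\<lambda>t \<omega>. \<Delta> 0 * occ t \<omega> + \<Delta> 1 * (t - occ t \<omega>) + b"
  let ?V = "\<lambda>t \<omega>. J t \<omega> + ?D t \<omega>"
  let ?V' = "\<lambda>t \<omega>. sqrt ((\<sigma> 0)\<^sup>2 - (\<sigma> 1)\<^sup>2) * B (occ t \<omega>) \<omega> + sqrt t * \<sigma> 1 * \<eta>\<^sub>0 \<omega> + ?D t \<omega>"
  let ?EY = "{\<omega>\<in>space M. \<forall>t\<in>{0..T}. 0 < ?V t \<omega>}" and ?EZ = "{\<omega>\<in>space M. \<forall>t\<in>{0..T}. 0 < ?V' t \<omega>}"
  let ?H = "{\<omega>\<in>space M. hitting_time X a \<omega> > ereal T}"
  note surv = survival_comparison[OF \<sigma> T J, where b=b and ?d0.0="\<Delta> 0" and ?d1.0="\<Delta> 1"]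
  \<comment> \<open>Measurability and continuity do not mention \<open>L\<close>, so any chain
    event, here the empty one, discharges the hypothesis on it.\<close>
  note surv0 = surv[OF sets.empty_sets]
  have sub: "sets F\<^sub>\<Lambda> \<subseteq> sets (process_sigma M (count_space UNIV) {0..} \<Lambda>)"
    unfolding assms(13) by (rule sets_process_sigma_mono) auto
  then have F: "subalgebra M F\<^sub>\<Lambda>"
    using subalgebra_\<Lambda> by (auto simp: subalgebra_def assms(13))
  have EY: "{\<omega>\<in>space M. (INF t\<in>{0..T}. J t \<omega> + (LBINT s:{0..t}. \<Delta> (\<Lambda> s \<omega>)) - ln (a / x)) > 0} = ?EY"
  proof (intro Collect_cong conj_cong refl)
    fix \<omega> assume \<omega>: "\<omega> \<in> space M"
    have "(INF t\<in>{0..T}. J t \<omega> + (LBINT s:{0..t}. \<Delta> (\<Lambda> s \<omega>)) - ln (a / x)) = (INF t\<in>{0..T}. ?V t \<omega>)"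
      using \<omega> by (intro INF_cong refl) (simp add: drift b_def)
    then show "(INF t\<in>{0..T}. J t \<omega> + (LBINT s:{0..t}. \<Delta> (\<Lambda> s \<omega>)) - ln (a / x)) > 0 \<longleftrightarrow> (\<forall>t\<in>{0..T}. 0 < ?V t \<omega>)"
      using INF_pos_iff[OF T surv0(3)[OF \<omega>]] by simp
  qed
  have EZ: "{\<omega>\<in>space M. (INF t\<in>{0..T}. sqrt ((\<sigma> 0)\<^sup>2 - (\<sigma> 1)\<^sup>2) * B (\<alpha> t \<omega>) \<omega> + sqrt t * \<sigma> 1 * \<eta>\<^sub>0 \<omega>
          + \<Delta> 0 * \<alpha> t \<omega> + \<Delta> 1 * \<beta> t \<omega> - ln (a / x)) > 0} = ?EZ"
  proof (intro Collect_cong conj_cong refl)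
    fix \<omega> assume \<omega>: "\<omega> \<in> space M"
    have "(INF t\<in>{0..T}. sqrt ((\<sigma> 0)\<^sup>2 - (\<sigma> 1)\<^sup>2) * B (\<alpha> t \<omega>) \<omega> + sqrt t * \<sigma> 1 * \<eta>\<^sub>0 \<omega>
          + \<Delta> 0 * \<alpha> t \<omega> + \<Delta> 1 * \<beta> t \<omega> - ln (a / x)) = (INF t\<in>{0..T}. ?V' t \<omega>)"
      using \<omega> by (intro INF_cong refl) (simp add: assms(14,15) occupation_time_0 occupation_time_1 b_def)
    then show "(INF t\<in>{0..T}. sqrt ((\<sigma> 0)\<^sup>2 - (\<sigma> 1)\<^sup>2) * B (\<alpha> t \<omega>) \<omega> + sqrt t * \<sigma> 1 * \<eta>\<^sub>0 \<omega>
          + \<Delta> 0 * \<alpha> t \<omega> + \<Delta> 1 * \<beta> t \<omega> - ln (a / x)) > 0 \<longleftrightarrow> (\<forall>t\<in>{0..T}. 0 < ?V' t \<omega>)"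
      using INF_pos_iff[OF T surv0(4)[OF \<omega>]] by simp
  qed
  let ?W = "\<lambda>t \<omega>. J' t \<omega> + (\<Delta> 0 * occ t \<omega> + \<Delta> 1 * (t - occ t \<omega>))"
  have XW: "X t \<omega> = x * exp (?W t \<omega>)" if "\<omega> \<in> space M" "0 \<le> t" for t \<omega>
    using X[OF that(2,1)] drift[OF that] by (simp add: assms(9) add.commute)
  have Wc: "continuous_on {0..} (\<lambda>t. ?W t \<omega>)" if "\<omega> \<in> space M" for \<omega>
    by (intro continuous_intros continuous_occ ito_integral_continuous[OF J'] that)
  have Xc: "continuous_on {0..} (\<lambda>t. X t \<omega>)" if "\<omega> \<in> space M" for \<omega>
  proof -
    have "continuous_on {0..} (\<lambda>t. x * exp (?W t \<omega>))" by (intro continuous_intros Wc that)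
    then show ?thesis by (rule continuous_on_eq) (use that in \<open>simp add: XW\<close>)
  qed
  have Xm: "X t \<in> borel_measurable M" if "0 \<le> t" for t
  proof -
    have [measurable]: "J' t \<in> borel_measurable M" "occ t \<in> borel_measurable M"
      using J' that by (auto simp: ito_integral_def occ_measurable)
    have "(\<lambda>\<omega>. x * exp (?W t \<omega>)) \<in> borel_measurable M" by measurable
    then show ?thesis using that by (subst measurable_cong[OF XW]) auto
  qed
  have H: "?H \<in> events"
  proof -
    \<comment> \<open>Time 0 does not count as a hit, but measurability was shown for conditions on
      a compact interval. Replacing \<open>t\<close> by \<open>max t (T / Suc n)\<close> tests the
      times from \<open>T / Suc n\<close> to \<open>T\<close>, and all \<open>n\<close> together
      exhaust \<open>{0<..T}\<close>.\<close>
    have "{\<omega>\<in>space M. \<forall>t\<in>{0..T}. 0 < \<bar>X (max t (T / real (Suc n))) \<omega> - a\<bar>} \<in> events" for n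
    proof (rule sets_all_pos[OF T])
      show "continuous_on {0..T} (\<lambda>t. \<bar>X (max t (T / real (Suc n))) \<omega> - a\<bar>)" if "\<omega> \<in> space M" for \<omega>
        by (intro continuous_intros continuous_on_compose2[OF Xc[OF that]]) (auto intro: le_max_iff_disj[THEN iffD2])
      show "(\<lambda>\<omega>. \<bar>X (max t (T / real (Suc n))) \<omega> - a\<bar>) \<in> borel_measurable M" for t
        by (intro borel_measurable_abs borel_measurable_diff Xm borel_measurable_const) (use T in \<open>simp add: le_max_iff_disj\<close>)
    qed
    then have "{\<omega>\<in>space M. \<forall>n. \<forall>t\<in>{0..T}. 0 < \<bar>X (max t (T / real (Suc n))) \<omega> - a\<bar>} \<in> events"
      by (intro sets.sets_Collect_countable_All)
    also have "{\<omega>\<in>space M. \<forall>n. \<forall>t\<in>{0..T}. 0 < \<bar>X (max t (T / real (Suc n))) \<omega> - a\<bar>} = ?H"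
    proof (intro Collect_cong conj_cong refl)
      fix \<omega> assume \<omega>: "\<omega> \<in> space M"
      have "(\<forall>n. \<forall>t\<in>{0..T}. 0 < \<bar>X (max t (T / real (Suc n))) \<omega> - a\<bar>) \<longleftrightarrow> (\<forall>t\<in>{0<..T}. X t \<omega> \<noteq> a)"
      proof (intro iffI allI ballI)
        fix t assume all: "\<forall>n. \<forall>t\<in>{0..T}. 0 < \<bar>X (max t (T / real (Suc n))) \<omega> - a\<bar>" and t: "t \<in> {0<..T}"
        obtain n where "1 / real (Suc n) < t / T"
          using t T reals_Archimedean[of "t / T"] by (auto simp: inverse_eq_divide)
        then have "max t (T / real (Suc n)) = t" using T by (simp add: field_simps)
        moreover have "t \<in> {0..T}" using t by simp
        ultimately have "0 < \<bar>X t \<omega> - a\<bar>" using all by metis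
        then show "X t \<omega> \<noteq> a" by simp
      next
        fix n t assume ne: "\<forall>t\<in>{0<..T}. X t \<omega> \<noteq> a" and t: "t \<in> {0..T}"
        have "0 < T / real (Suc n)" "T / real (Suc n) \<le> T" using T by (auto simp: field_simps)
        then have "max t (T / real (Suc n)) \<in> {0<..T}" using t by auto
        then show "0 < \<bar>X (max t (T / real (Suc n))) \<omega> - a\<bar>" using ne by simp
      qed
      then show "(\<forall>n. \<forall>t\<in>{0..T}. 0 < \<bar>X (max t (T / real (Suc n))) \<omega> - a\<bar>) \<longleftrightarrow> hitting_time X a \<omega> > ereal T"
        using hitting_time_gt_iff[where X=X and \<omega>=\<omega>, OF T Xc[OF \<omega>]] by simp
    qed
    finally show ?thesis .
  qed
  have "AE \<omega> in M. \<omega> \<in> ?H \<longleftrightarrow> \<omega> \<in> ?EY"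
    using AE_space ito_integral_0[OF J] ito_integral_indistinguishable[OF J J' T]
  proof eventually_elim
    case (elim \<omega>)
    note \<omega> = elim(1)
    \<comment> \<open>The start lies strictly above the barrier: integral and occupation time vanish
      at 0, and what remains is \<open>b = ln (x / a)\<close>.\<close>
    have V0: "?V 0 \<omega> > 0"
    proof -
      have "occ 0 \<omega> = 0" unfolding occ_def set_lebesgue_integral_def
      proof (rule integral_eq_zero_AE)
        show "AE s in lborel. indicator {0..0} s *\<^sub>R (if \<Lambda> s \<omega> = 0 then 1 else 0) = (0 :: real)"
          using AE_lborel_singleton[of "0::real"] by eventually_elim auto
      qed
      moreover have "b > 0" using \<open>0 < a\<close> \<open>a < x\<close> by (simp add: b_def ln_div)
      ultimately show ?thesis using elim(2) by simp
    qed
    \<comment> \<open>Since \<open>exp b = x / a\<close>, the process is \<open>a * exp\<close> of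
      \<open>?V\<close>, and hitting \<open>a\<close> means a zero of \<open>?V\<close>.\<close>
    have hit: "X t \<omega> = a \<longleftrightarrow> ?V t \<omega> = 0" if t: "t \<in> {0..T}" for t
    proof -
      have exp_b: "exp b = x / a" using x \<open>0 < a\<close> by (simp add: b_def exp_minus)
      have "?W t \<omega> = ?V t \<omega> - b" using elim(3) t by auto
      then have "X t \<omega> = x * exp (?V t \<omega> - b)" using XW[OF \<omega>, of t] t by simp
      also have "\<dots> = a * exp (?V t \<omega>)"
        using x \<open>0 < a\<close> by (simp only: exp_diff exp_b) simp
      finally show ?thesis using \<open>0 < a\<close> by simp
    qed
    have "(\<forall>t\<in>{0<..T}. X t \<omega> \<noteq> a) \<longleftrightarrow> (\<forall>t\<in>{0..T}. 0 < ?V t \<omega>)"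
    proof
      assume ne: "\<forall>t\<in>{0<..T}. X t \<omega> \<noteq> a"
      show "\<forall>t\<in>{0..T}. 0 < ?V t \<omega>"
      proof (rule ballI, rule ccontr)
        fix t assume t: "t \<in> {0..T}" and le: "\<not> 0 < ?V t \<omega>"
        have "continuous_on {0..t} (\<lambda>t. ?V t \<omega>)"
          using t by (intro continuous_on_subset[OF surv0(3)[OF \<omega>]]) auto
        \<comment> \<open>A continuous path that starts above 0 must pass through 0 before it can be
          nonpositive; the zero is a hit at a positive time.\<close>
        then obtain u where u: "0 \<le> u" "u \<le> t" "?V u \<omega> = 0"
          using IVT2'[of "\<lambda>t. ?V t \<omega>" t 0 0] le V0 t by auto
        then have "u \<noteq> 0" using V0 by auto
        then have "u \<in> {0<..T}" "u \<in> {0..T}" using u t by auto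
        then show False using ne hit u(3) by blast
      qed
    next
      assume pos: "\<forall>t\<in>{0..T}. 0 < ?V t \<omega>"
      show "\<forall>t\<in>{0<..T}. X t \<omega> \<noteq> a"
      proof
        fix t assume "t \<in> {0<..T}"
        then have t: "t \<in> {0..T}" by auto
        with pos have "0 < ?V t \<omega>" by blast
        then show "X t \<omega> \<noteq> a" using hit[OF t] by simp
      qed
    qed
    then show ?case using \<omega> hitting_time_gt_iff[where X=X and \<omega>=\<omega>, OF T Xc[OF \<omega>]] by simp
  qed
  from cond_probability_cong_AE[OF F H surv0(1) this]
  have 1: "AE \<omega> in M. cond_probability M F\<^sub>\<Lambda> ?H \<omega> = cond_probability M F\<^sub>\<Lambda> ?EY \<omega>" .
  have 2: "AE \<omega> in M. cond_probability M F\<^sub>\<Lambda> ?EY \<omega> \<le> cond_probability M F\<^sub>\<Lambda> ?EZ \<omega>"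
    by (rule cond_probability_mono[OF F surv0(1,2)]) (use sub in \<open>auto intro!: surv(5)\<close>)
  show ?thesis unfolding EY EZ using 1 2 by eventually_elim simp
qed

end
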